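(* Let $(G,\pi_G)$ be a Poisson-Lie group with a Poisson action on a Poisson manifold $(M,\pi_M)$, and let $X\subset M$ be an orbit of the action. The following assertions are equivalent: (i) $X$ is a coregular Poisson-Dirac submanifold of $(M,\pi_M)$; (ii) $X$ is a Poisson-Dirac submanifold of $(M,\pi_M)$; (iii) for some $x\in X$, the linear subspace $T_xX\subset(T_xM,\pi_{M,x})$ is Poisson-Dirac (inherits a Poisson structure), that is, $\pi_{M,x}^\sharp(N^*_xX)\cap T_xX=0$.
   Context: A Poisson-Lie group is a Lie group $G$ with a Poisson structure $\pi_G$ for which multiplication $(G,\pi_G)\times(G,\pi_G)\to(G,\pi_G)$ is a Poisson map. An action $\alpha:G\times M\to M$ on a Poisson manifold is Poisson if $\alpha:(G,\pi_G)\times(M,\pi_M)\to(M,\pi_M)$ is a Poisson map. For a Poisson manifold $(M,\pi_M)$, $\pi_M^\sharp:T^*M\to TM$ is contraction with $\pi_M$, $\mathrm{Gr}(\pi_M)=\{\pi_M^\sharp(\xi)+\xi\}\subset TM\oplus T^*M$, and $N^*X\subset T^*M|_X$ is the annihilator of $TX$. A submanifold $i:X\to M$ is Poisson-Dirac if $i^!\mathrm{Gr}(\pi_M):=\{u+i^*\xi : i_*u=\pi_M^\sharp(\xi)\}\subset TX\oplus T^*X$ equals $\mathrm{Gr}(\pi_X)$ for a (unique, automatically Poisson) smooth bivector $\pi_X$ on $X$. It is coregular Poisson-Dirac if $\pi_M^\sharp(N^*X)\cap TX=0$ and $TX\oplus\pi_M^\sharp(N^*X)$ is a vector subbundle of $TM|_X$.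 For an orbit these definitions are read for the (injectively immersed) inclusion $i:X\to M$. *)

theory Defs
  imports "HOL-Analysis.Analysis" "HOL-Algebra.Group_Action"
begin

section \<open>Model spaces\<close>

text \<open>Manifolds are modelled on finite-dimensional real vector spaces. The class
  \<open>euclidean_space\<close> is too narrow for this because it excludes dimension \<open>0\<close>: a fixed point of an
  action is a zero-dimensional orbit. The inner product is an auxiliary choice.\<close>

class fin_dim_inner = real_inner +
  assumes finite_spanning: "\<exists>B. finite B \<and> (\<forall>x. \<exists>c. x = (\<Sum>b\<in>B. c b *\<^sub>R b))"

subclass (in euclidean_space) fin_dim_inner
proof
  show "\<exists>B::'a set. finite B \<and> (\<forall>x. \<exists>c. x = (\<Sum>b\<in>B. c b *\<^sub>R b))"
    by (metis finite_Basis euclidean_representation)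
qed

lemma ex_finite_span_UNIV: "\<exists>B::'a::fin_dim_inner set. finite B \<and> span B = UNIV"
proof -
  obtain B :: "'a set" where B: "finite B" "\<And>x. \<exists>c. x = (\<Sum>b\<in>B. c b *\<^sub>R b)"
    using finite_spanning by blast
  have "x \<in> span B" for x
  proof -
    obtain c where "x = (\<Sum>b\<in>B. c b *\<^sub>R b)"
      using B(2) by blast
    then show ?thesis
      by (auto intro: span_sum span_scale span_base)
  qed
  then show ?thesis
    using B(1) by blast
qed

instance prod :: (fin_dim_inner, fin_dim_inner) fin_dim_inner
proof
  obtain A :: "'a set" where A: "finite A" "\<And>x. \<exists>c. x = (\<Sum>b\<in>A. c b *\<^sub>R b)"
    using finite_spanning by blast
  obtain B :: "'b set" where B: "finite B" "\<And>x. \<exists>c. x = (\<Sum>b\<in>B. c b *\<^sub>R b)"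
    using finite_spanning by blast
  let ?C = "(\<lambda>a. (a, 0)) ` A \<union> (\<lambda>b. (0, b)) ` B :: ('a \<times> 'b) set"
  have fin: "finite ?C"
    using A(1) B(1) by blast
  have "z \<in> span ?C" for z
  proof -
    obtain c d where cd: "fst z = (\<Sum>b\<in>A. c b *\<^sub>R b)" "snd z = (\<Sum>b\<in>B. d b *\<^sub>R b)"
      using A(2) B(2) by meson
    have "z = (\<Sum>b\<in>A. c b *\<^sub>R (b, 0)) + (\<Sum>b\<in>B. d b *\<^sub>R (0, b))"
      by (rule prod_eqI) (simp_all add: cd fst_sum snd_sum)
    also have "\<dots> \<in> span ?C"
      by (intro span_add span_sum span_scale span_base) auto
    finally show ?thesis .
  qed
  then have "\<forall>z. \<exists>c. z = (\<Sum>b\<in>?C. c b *\<^sub>R b)"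
    using span_finite[OF fin] by blast
  then show "\<exists>C::('a \<times> 'b) set. finite C \<and> (\<forall>x. \<exists>c. x = (\<Sum>b\<in>C. c b *\<^sub>R b))"
    using fin by blast
qed

text \<open>The zero-dimensional model space.\<close>

instantiation unit :: real_inner
begin

definition zero_unit :: unit where "zero_unit = ()"
definition plus_unit :: "unit \<Rightarrow> unit \<Rightarrow> unit" where "plus_unit _ _ = ()"
definition scaleR_unit :: "real \<Rightarrow> unit \<Rightarrow> unit" where "scaleR_unit _ _ = ()"
definition norm_unit :: "unit \<Rightarrow> real" where "norm_unit _ = 0"
definition dist_unit :: "unit \<Rightarrow> unit \<Rightarrow> real" where "dist_unit _ _ = 0"
definition sgn_unit :: "unit \<Rightarrow> unit" where "sgn_unit _ = ()"
definition inner_unit :: "unit \<Rightarrow> unit \<Rightarrow> real" where "inner_unit _ _ = 0"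
definition uniformity_unit :: "(unit \<times> unit) filter"
  where "uniformity_unit = (INF e\<in>{0<..}. principal {(x, y). dist x y < e})"
definition open_unit :: "unit set \<Rightarrow> bool"
  where "open_unit U = (\<forall>x\<in>U. eventually (\<lambda>(x', y). x' = x \<longrightarrow> y \<in> U) uniformity)"

instance
  by standard
    (auto simp: dist_unit_def norm_unit_def inner_unit_def uniformity_unit_def open_unit_def)

end

instance unit :: fin_dim_inner
  by standard (auto intro!: exI[of _ "{}"])


section \<open>Smooth maps between open sets of model spaces\<close>

text \<open>\<open>k\<close>-fold continuous differentiability on an open set: \<open>f\<close> is differentiable and all of its
  directional derivatives are \<open>(k - 1)\<close>-fold continuously differentiable.\<close>

primrec k_times_smooth_on ::
    "nat \<Rightarrow> 'e::real_normed_vector set \<Rightarrow> ('e \<Rightarrow> 'f::real_normed_vector) \<Rightarrow> bool" where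
  "k_times_smooth_on 0 S f \<longleftrightarrow> continuous_on S f"
| "k_times_smooth_on (Suc k) S f \<longleftrightarrow>
     (\<forall>x\<in>S. f differentiable (at x)) \<and>
     (\<forall>v. k_times_smooth_on k S (\<lambda>x. frechet_derivative f (at x) v))"

definition smooth_on :: "'e::real_normed_vector set \<Rightarrow> ('e \<Rightarrow> 'f::real_normed_vector) \<Rightarrow> bool"
  where "smooth_on S f \<longleftrightarrow> (\<forall>k. k_times_smooth_on k S f)"


section \<open>Smooth manifolds\<close>

text \<open>A chart is a pair of its domain and the coordinate map. An atlas is not assumed to be maximal.
  Every point carries a preferred chart \<open>chart_at\<close>, which serves to identify the tangent
  space at that point with the model space.\<close>

record ('a, 'e) manifold =
  mtop :: "'a topology"
  atlas :: "('a set \<times> ('a \<Rightarrow> 'e)) set"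
  chart_at :: "'a \<Rightarrow> 'a set \<times> ('a \<Rightarrow> 'e)"

definition points :: "('a, 'e) manifold \<Rightarrow> 'a set"
  where "points M = topspace (mtop M)"

definition smooth_manifold :: "('a, 'e::fin_dim_inner) manifold \<Rightarrow> bool" where
  "smooth_manifold M \<longleftrightarrow>
     Hausdorff_space (mtop M) \<and> second_countable (mtop M) \<and>
     (\<forall>(U, \<phi>)\<in>atlas M. openin (mtop M) U \<and> open (\<phi> ` U) \<and>
        homeomorphic_map (subtopology (mtop M) U) (top_of_set (\<phi> ` U)) \<phi>) \<and>
     (\<forall>(U, \<phi>)\<in>atlas M. \<forall>(V, \<psi>)\<in>atlas M. smooth_on (\<phi> ` (U \<inter> V)) (\<psi> \<circ> inv_into U \<phi>)) \<and>
     (\<forall>x\<in>points M. chart_at M x \<in> atlas M \<and> x \<in> fst (chart_at M x))"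

definition model_manifold :: "('e::fin_dim_inner, 'e) manifold" where
  "model_manifold = \<lparr>mtop = euclidean, atlas = {(UNIV, id)}, chart_at = (\<lambda>_. (UNIV, id))\<rparr>"

definition prod_manifold ::
    "('a, 'e) manifold \<Rightarrow> ('b, 'f) manifold \<Rightarrow> ('a \<times> 'b, 'e \<times> 'f) manifold" where
  "prod_manifold M N =
     \<lparr>mtop = prod_topology (mtop M) (mtop N),
      atlas = {(U \<times> V, map_prod \<phi> \<psi>) | U \<phi> V \<psi>. (U, \<phi>) \<in> atlas M \<and> (V, \<psi>) \<in> atlas N},
      chart_at = (\<lambda>(x, y). (fst (chart_at M x) \<times> fst (chart_at N y),
                            map_prod (snd (chart_at M x)) (snd (chart_at N y))))\<rparr>"

definition smooth_map ::
    "('a, 'e::real_normed_vector) manifold \<Rightarrow> ('b, 'f::real_normed_vector) manifold \<Rightarrow> ('a \<Rightarrow> 'b) \<Rightarrow> bool"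
  where "smooth_map M N f \<longleftrightarrow>
     continuous_map (mtop M) (mtop N) f \<and>
     (\<forall>(U, \<phi>)\<in>atlas M. \<forall>(V, \<psi>)\<in>atlas N.
        smooth_on (\<phi> ` (U \<inter> f -` V)) (\<psi> \<circ> f \<circ> inv_into U \<phi>))"

text \<open>Through \<open>chart_at\<close>, the tangent space of a manifold modelled on \<open>'e\<close> is \<open>'e\<close> at each point and
  the cotangent space is the dual \<open>'e \<Rightarrow>\<^sub>L real\<close>. The differential \<open>T\<^sub>x f : T\<^sub>x M \<rightarrow> T\<^bsub>f x\<^esub> N\<close> is the
  derivative of \<open>f\<close> in the preferred charts at \<open>x\<close> and at \<open>f x\<close>.\<close>

definition differential ::
    "('a, 'e::real_normed_vector) manifold \<Rightarrow> ('b, 'f::real_normed_vector) manifold \<Rightarrow>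
     ('a \<Rightarrow> 'b) \<Rightarrow> 'a \<Rightarrow> 'e \<Rightarrow>\<^sub>L 'f" where
  "differential M N f x =
     (case chart_at M x of (U, \<phi>) \<Rightarrow> case chart_at N (f x) of (V, \<psi>) \<Rightarrow>
        Blinfun (frechet_derivative (\<psi> \<circ> f \<circ> inv_into U \<phi>) (at (\<phi> x))))"

definition immersion ::
    "('a, 'e::real_normed_vector) manifold \<Rightarrow> ('b, 'f::real_normed_vector) manifold \<Rightarrow> ('a \<Rightarrow> 'b) \<Rightarrow> bool"
  where "immersion M N f \<longleftrightarrow>
     smooth_map M N f \<and> (\<forall>x\<in>points M. inj (blinfun_apply (differential M N f x)))"

definition submersion ::
    "('a, 'e::real_normed_vector) manifold \<Rightarrow> ('b, 'f::real_normed_vector) manifold \<Rightarrow> ('a \<Rightarrow> 'b) \<Rightarrow> bool"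
  where "submersion M N f \<longleftrightarrow>
     smooth_map M N f \<and> (\<forall>x\<in>points M. surj (blinfun_apply (differential M N f x)))"


section \<open>Poisson manifolds\<close>

text \<open>An element of \<open>\<Lambda>\<^sup>2 E\<close>, for a finite-dimensional \<open>E\<close>, is a skew-symmetric bilinear form on the
  dual of \<open>E\<close>.\<close>

type_synonym 'e bivector = "('e \<Rightarrow>\<^sub>L real) \<Rightarrow> ('e \<Rightarrow>\<^sub>L real) \<Rightarrow> real"

definition is_bivector :: "'e::real_normed_vector bivector \<Rightarrow> bool"
  where "is_bivector P \<longleftrightarrow> bilinear P \<and> (\<forall>\<xi> \<eta>. P \<xi> \<eta> = - P \<eta> \<xi>)"

text \<open>The coordinate expression of a bivector field in a chart \<open>(U, \<phi>)\<close> is its push-forward along \<open>\<phi>\<close>.\<close>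

definition smooth_bivector_field ::
    "('a, 'e::fin_dim_inner) manifold \<Rightarrow> ('a \<Rightarrow> 'e bivector) \<Rightarrow> bool" where
  "smooth_bivector_field M \<pi> \<longleftrightarrow>
     (\<forall>x\<in>points M. is_bivector (\<pi> x)) \<and>
     (\<forall>(U, \<phi>)\<in>atlas M. \<forall>a b.
        smooth_on (\<phi> ` U)
          (\<lambda>y. let x = inv_into U \<phi> y; D = differential M model_manifold \<phi> x
               in \<pi> x (a o\<^sub>L D) (b o\<^sub>L D)))"

definition poisson_bracket ::
    "('a, 'e::fin_dim_inner) manifold \<Rightarrow> ('a \<Rightarrow> 'e bivector) \<Rightarrow> ('a \<Rightarrow> real) \<Rightarrow> ('a \<Rightarrow> real) \<Rightarrow> 'a \<Rightarrow> real"
  where "poisson_bracket M \<pi> f g x =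
     \<pi> x (differential M model_manifold f x) (differential M model_manifold g x)"

definition poisson_manifold ::
    "('a, 'e::fin_dim_inner) manifold \<Rightarrow> ('a \<Rightarrow> 'e bivector) \<Rightarrow> bool" where
  "poisson_manifold M \<pi> \<longleftrightarrow>
     smooth_manifold M \<and> smooth_bivector_field M \<pi> \<and>
     (\<forall>f g h. smooth_map M model_manifold f \<and> smooth_map M model_manifold g \<and>
              smooth_map M model_manifold h \<longrightarrow>
        (\<forall>x\<in>points M.
           poisson_bracket M \<pi> f (poisson_bracket M \<pi> g h) x +
           poisson_bracket M \<pi> g (poisson_bracket M \<pi> h f) x +
           poisson_bracket M \<pi> h (poisson_bracket M \<pi> f g) x = 0))"

definition prod_bivector_field ::
    "('a \<Rightarrow> 'e::real_normed_vector bivector) \<Rightarrow> ('b \<Rightarrow> 'f::real_normed_vector bivector) \<Rightarrow>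
     'a \<times> 'b \<Rightarrow> ('e \<times> 'f) bivector" where
  "prod_bivector_field \<pi> \<rho> = (\<lambda>(x, y) \<xi> \<eta>.
     let i = Blinfun (\<lambda>u. (u, 0)); j = Blinfun (\<lambda>v. (0, v))
     in \<pi> x (\<xi> o\<^sub>L i) (\<eta> o\<^sub>L i) + \<rho> y (\<xi> o\<^sub>L j) (\<eta> o\<^sub>L j))"

definition poisson_map ::
    "('a, 'e::fin_dim_inner) manifold \<Rightarrow> ('a \<Rightarrow> 'e bivector) \<Rightarrow>
     ('b, 'f::fin_dim_inner) manifold \<Rightarrow> ('b \<Rightarrow> 'f bivector) \<Rightarrow> ('a \<Rightarrow> 'b) \<Rightarrow> bool" where
  "poisson_map M \<pi> N \<rho> f \<longleftrightarrow>
     smooth_map M N f \<and>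
     (\<forall>x\<in>points M. \<forall>\<xi> \<eta>.
        \<pi> x (\<xi> o\<^sub>L differential M N f x) (\<eta> o\<^sub>L differential M N f x) = \<rho> (f x) \<xi> \<eta>)"

text \<open>Contraction \<open>\<pi>\<^sup>\<sharp> \<xi> = \<pi>(\<xi>, \<cdot>)\<close>, viewed as a vector through \<open>E = E\<^sup>*\<^sup>*\<close>; the lemma \<open>sharp\<close> below
  shows that it is well defined.\<close>

definition sharp :: "'e::real_normed_vector bivector \<Rightarrow> ('e \<Rightarrow>\<^sub>L real) \<Rightarrow> 'e"
  where "sharp P \<xi> = (THE u. \<forall>\<eta>. blinfun_apply \<eta> u = P \<xi> \<eta>)"

lemma sharp:
  fixes P :: "'e::fin_dim_inner bivector"
  assumes "is_bivector P"
  shows "blinfun_apply \<eta> (sharp P \<xi>) = P \<xi> \<eta>"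
proof -
  obtain B :: "'e set" where B: "finite B" "span B = UNIV"
    using ex_finite_span_UNIV by blast
  obtain C :: "'e set" where C: "finite C" "span C = UNIV" "pairwise orthogonal C"
    using basis_orthogonal[OF B(1)] B(2) by metis
  have expand: "v = (\<Sum>b\<in>C. (b \<bullet> v / (b \<bullet> b)) *\<^sub>R b)" for v
  proof -
    let ?w = "v - (\<Sum>b\<in>C. (b \<bullet> v / (b \<bullet> b)) *\<^sub>R b)"
    have "orthogonal ?w b" if "b \<in> C" for b
    proof -
      have "(\<Sum>a\<in>C. (a \<bullet> v / (a \<bullet> a)) * (a \<bullet> b)) = (\<Sum>a\<in>C. if a = b then b \<bullet> v else 0)"
        using C(3) that by (intro sum.cong) (auto simp: pairwise_def orthogonal_def)
      then show ?thesis
        using that C(1)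
        by (simp add: orthogonal_def inner_diff_left inner_sum_left inner_commute[of b])
    qed
    then have "orthogonal ?w ?w"
      using C(2) orthogonal_to_span[of ?w C ?w] by blast
    then have "?w = 0"
      unfolding orthogonal_def inner_eq_zero_iff .
    then show ?thesis
      unfolding right_minus_eq .
  qed
  have lin: "linear (P \<xi>)"
    using assms by (simp add: is_bivector_def bilinear_def)
  define u where "u = (\<Sum>b\<in>C. (P \<xi> (blinfun_inner_right b) / (b \<bullet> b)) *\<^sub>R b)"
  have u: "blinfun_apply \<zeta> u = P \<xi> \<zeta>" for \<zeta>
  proof -
    have "\<zeta> = (\<Sum>b\<in>C. (blinfun_apply \<zeta> b / (b \<bullet> b)) *\<^sub>R blinfun_inner_right b)"
    proof (rule blinfun_eqI)
      fix v
      have "blinfun_apply \<zeta> v = blinfun_apply \<zeta> (\<Sum>b\<in>C. (b \<bullet> v / (b \<bullet> b)) *\<^sub>R b)"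
        using expand[of v] by (rule arg_cong)
      then show "blinfun_apply \<zeta> v =
          blinfun_apply (\<Sum>b\<in>C. (blinfun_apply \<zeta> b / (b \<bullet> b)) *\<^sub>R blinfun_inner_right b) v"
        by (simp add: blinfun.bilinear_simps mult.commute)
    qed
    then have "P \<xi> \<zeta> = P \<xi> (\<Sum>b\<in>C. (blinfun_apply \<zeta> b / (b \<bullet> b)) *\<^sub>R blinfun_inner_right b)"
      by simp
    also have "\<dots> = blinfun_apply \<zeta> u"
      using lin by (simp add: u_def linear_sum linear_scale blinfun.bilinear_simps mult.commute)
    finally show ?thesis ..
  qed
  have "sharp P \<xi> = u"
    unfolding sharp_def
  proof (rule the_equality)
    fix w assume w: "\<forall>\<zeta>. blinfun_apply \<zeta> w = P \<xi> \<zeta>"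
    have "blinfun_apply (blinfun_inner_right (w - u)) w =
        blinfun_apply (blinfun_inner_right (w - u)) u"
      by (simp only: w u)
    then have "(w - u) \<bullet> (w - u) = 0"
      by (simp add: inner_diff_right)
    then show "w = u"
      by simp
  qed (use u in simp)
  then show ?thesis
    using u by simp
qed


section \<open>Poisson-Lie groups and Poisson actions\<close>

text \<open>The group operations are those of \<open>G\<close>, the smooth structure on its carrier is \<open>L\<close>.\<close>

definition lie_group :: "('g, 'z) monoid_scheme \<Rightarrow> ('g, 'k::fin_dim_inner) manifold \<Rightarrow> bool" where
  "lie_group G L \<longleftrightarrow>
     Group.group G \<and> smooth_manifold L \<and> points L = carrier G \<and>
     smooth_map (prod_manifold L L) L (\<lambda>(g, h). g \<otimes>\<^bsub>G\<^esub> h) \<and>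
     smooth_map L L (\<lambda>g. inv\<^bsub>G\<^esub> g)"

definition poisson_lie_group ::
    "('g, 'z) monoid_scheme \<Rightarrow> ('g, 'k::fin_dim_inner) manifold \<Rightarrow> ('g \<Rightarrow> 'k bivector) \<Rightarrow> bool" where
  "poisson_lie_group G L \<pi> \<longleftrightarrow>
     lie_group G L \<and> poisson_manifold L \<pi> \<and>
     poisson_map (prod_manifold L L) (prod_bivector_field \<pi> \<pi>) L \<pi> (\<lambda>(g, h). g \<otimes>\<^bsub>G\<^esub> h)"

definition poisson_action ::
    "('g, 'z) monoid_scheme \<Rightarrow> ('g, 'k::fin_dim_inner) manifold \<Rightarrow> ('g \<Rightarrow> 'k bivector) \<Rightarrow>
     ('a, 'm::fin_dim_inner) manifold \<Rightarrow> ('a \<Rightarrow> 'm bivector) \<Rightarrow> ('g \<Rightarrow> 'a \<Rightarrow> 'a) \<Rightarrow> bool" where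
  "poisson_action G L \<pi>G M \<pi>M \<alpha> \<longleftrightarrow>
     group_action G (points M) \<alpha> \<and>
     poisson_map (prod_manifold L M) (prod_bivector_field \<pi>G \<pi>M) M \<pi>M (\<lambda>(g, x). \<alpha> g x)"

text \<open>\<open>X\<close> is an orbit with its canonical manifold structure, that of \<open>G / G\<^sub>x\<close>. It is determined by the
  requirement that the orbit map \<open>g \<mapsto> \<alpha> g x\<close> is a surjective submersion onto \<open>X\<close>; the inclusion
  into \<open>M\<close> is then an injective immersion. Neither the topology nor the charts of \<open>X\<close> have
  to be restrictions of those of \<open>M\<close>.\<close>

definition orbit_manifold ::
    "('g, 'z) monoid_scheme \<Rightarrow> ('g, 'k::fin_dim_inner) manifold \<Rightarrow> ('g \<Rightarrow> 'a \<Rightarrow> 'a) \<Rightarrow>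
     ('a, 'm::fin_dim_inner) manifold \<Rightarrow> ('a, 'x::fin_dim_inner) manifold \<Rightarrow> bool" where
  "orbit_manifold G L \<alpha> M X \<longleftrightarrow>
     smooth_manifold X \<and> immersion X M id \<and>
     (\<exists>x\<in>points M. points X = orbit G \<alpha> x \<and> submersion L X (\<lambda>g. \<alpha> g x))"


section \<open>Poisson-Dirac submanifolds\<close>

text \<open>Below, \<open>X\<close> is an immersed submanifold of \<open>M\<close>: its points are points of \<open>M\<close> and the inclusion
  \<open>id\<close> is an immersion.\<close>

definition tangent_subspace ::
    "('a, 'x::real_normed_vector) manifold \<Rightarrow> ('a, 'm::real_normed_vector) manifold \<Rightarrow> 'a \<Rightarrow> 'm set"
  where "tangent_subspace X M x = range (blinfun_apply (differential X M id x))"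

definition conormal_space ::
    "('a, 'x::real_normed_vector) manifold \<Rightarrow> ('a, 'm::real_normed_vector) manifold \<Rightarrow> 'a \<Rightarrow>
     ('m \<Rightarrow>\<^sub>L real) set" where
  "conormal_space X M x = {\<xi>. \<forall>u\<in>tangent_subspace X M x. blinfun_apply \<xi> u = 0}"

definition bivector_graph :: "'e::real_normed_vector bivector \<Rightarrow> ('e \<times> ('e \<Rightarrow>\<^sub>L real)) set"
  where "bivector_graph P = {(sharp P \<xi>, \<xi>) | \<xi>. True}"

text \<open>The pullback \<open>i\<^sup>! Gr(\<pi>)\<close> at the point \<open>x\<close> of \<open>X\<close>.\<close>

definition pullback_graph ::
    "('a, 'x::real_normed_vector) manifold \<Rightarrow> ('a, 'm::real_normed_vector) manifold \<Rightarrow>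
     ('a \<Rightarrow> 'm bivector) \<Rightarrow> 'a \<Rightarrow> ('x \<times> ('x \<Rightarrow>\<^sub>L real)) set" where
  "pullback_graph X M \<pi> x =
     {(u, \<xi> o\<^sub>L differential X M id x) | u \<xi>.
        (blinfun_apply (differential X M id x) u, \<xi>) \<in> bivector_graph (\<pi> x)}"

definition poisson_dirac_submanifold ::
    "('a, 'x::fin_dim_inner) manifold \<Rightarrow> ('a, 'm::fin_dim_inner) manifold \<Rightarrow> ('a \<Rightarrow> 'm bivector) \<Rightarrow> bool"
  where "poisson_dirac_submanifold X M \<pi> \<longleftrightarrow>
     (\<exists>\<pi>X. smooth_bivector_field X \<pi>X \<and>
        (\<forall>x\<in>points X. pullback_graph X M \<pi> x = bivector_graph (\<pi>X x)))"

text \<open>Smoothness, over the open set \<open>W\<close> of \<open>X\<close>, of a section of \<open>TM|\<^sub>X\<close>, expressed in the charts of \<open>X\<close>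
  and the bundle charts of \<open>TM\<close> given by the charts of \<open>M\<close>.\<close>

definition smooth_section_along ::
    "('a, 'x::fin_dim_inner) manifold \<Rightarrow> ('a, 'm::fin_dim_inner) manifold \<Rightarrow> 'a set \<Rightarrow> ('a \<Rightarrow> 'm) \<Rightarrow> bool"
  where "smooth_section_along X M W s \<longleftrightarrow>
     (\<forall>(U, \<phi>)\<in>atlas X. \<forall>(V, \<psi>)\<in>atlas M.
        smooth_on (\<phi> ` (W \<inter> U \<inter> V))
          (\<lambda>y. let x = inv_into U \<phi> y
               in blinfun_apply (differential M model_manifold \<psi> x) (s x)))"

text \<open>A family of subspaces \<open>E x\<close> of \<open>T\<^sub>x M\<close>, for \<open>x\<close> in \<open>X\<close>, is a vector subbundle of rank \<open>r\<close> if it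
  is locally spanned by a smooth frame with \<open>r\<close> elements.\<close>

definition vector_subbundle_along ::
    "('a, 'x::fin_dim_inner) manifold \<Rightarrow> ('a, 'm::fin_dim_inner) manifold \<Rightarrow> ('a \<Rightarrow> 'm set) \<Rightarrow> bool"
  where "vector_subbundle_along X M E \<longleftrightarrow>
     (\<exists>r::nat. \<forall>x\<in>points X. \<exists>W s.
        openin (mtop X) W \<and> x \<in> W \<and>
        (\<forall>j<r. smooth_section_along X M W (s j)) \<and>
        (\<forall>y\<in>W. inj_on (\<lambda>j. s j y) {..<r} \<and> independent ((\<lambda>j. s j y) ` {..<r}) \<and>
                span ((\<lambda>j. s j y) ` {..<r}) = E y))"

definition coregular_poisson_dirac_submanifold ::
    "('a, 'x::fin_dim_inner) manifold \<Rightarrow> ('a, 'm::fin_dim_inner) manifold \<Rightarrow> ('a \<Rightarrow> 'm bivector) \<Rightarrow> bool"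
  where "coregular_poisson_dirac_submanifold X M \<pi> \<longleftrightarrow>
     (\<forall>x\<in>points X. sharp (\<pi> x) ` conormal_space X M x \<inter> tangent_subspace X M x = {0}) \<and>
     vector_subbundle_along X M
       (\<lambda>x. {u + v | u v. u \<in> tangent_subspace X M x \<and> v \<in> sharp (\<pi> x) ` conormal_space X M x})"

end

theory Submission
  imports Defs
begin

text \<open>Condition (ii) forces \<open>\<pi>\<^sup>\<sharp>(N\<^sup>*X) \<inter> TX = 0\<close> at every point: a vector \<open>\<pi>\<^sup>\<sharp> \<xi>\<close> in the intersection
  restricts \<open>\<xi>\<close> to \<open>0\<close> on \<open>TX\<close>, so it corresponds to a point over \<open>0\<close> in the graph of \<open>\<pi>\<^sub>X\<close>. Conversely,
  translation by \<open>k \<in> G\<close> is in general not a Poisson map, but its defect is the push-forward of \<open>\<pi>\<^sub>G\<close>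
  at \<open>k\<close>, which is tangent to the orbit and invisible to conormal covectors. Hence translations
  map the spaces \<open>\<pi>\<^sup>\<sharp>(N\<^sup>*X)\<close> to each other, as they do the spaces \<open>TX\<close>. So transversality at one
  point propagates to the whole orbit and \<open>\<pi>\<^sup>\<sharp>(N\<^sup>*X)\<close> has constant rank. Constant rank gives smooth local
  frames of \<open>TX \<oplus> \<pi>\<^sup>\<sharp>(N\<^sup>*X)\<close>; the dual frames give smooth lifts of covectors of \<open>X\<close> that
  vanish on \<open>\<pi>\<^sup>\<sharp>(N\<^sup>*X)\<close>, and \<open>\<pi>\<close> evaluated on such lifts is the bivector \<open>\<pi>\<^sub>X\<close>.\<close>

subsection \<open>Calculus of smooth maps\<close>

text \<open>The obstacle is that \<open>chart_at\<close> need not vary continuously with the point: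
  the entries of \<open>differential X M id x\<close> may jump with x, so smoothness cannot be read
  off them. Pointwise arguments (translations, ranks, graphs) therefore use the preferred charts,
  while smoothness arguments fix one chart \<phi> of X and one chart \<psi> of M and differentiate
  the inclusion between them. The two sides are joined by
  \<open>differential M model_manifold \<psi> x\<close>, which the chain rule shows to be an
  isomorphism: it is the bundle chart of TM over the domain of \<psi>.

  A second constraint is that smoothness is defined by derivatives in fixed directions. Whenever a
  derivative, a covector field or a bivector is applied to varying arguments, these are expanded in
  a fixed finite basis, which leaves sums of products of smooth functions.

  Conditions (i) and (ii) are each obtained from transversality at one point, by the same local
  construction, and each gives back transversality pointwise; no passage between (i) and (ii) is
  made without (iii).\<close>

lemma k_times_smooth_on_cong:
  assumes "open S" "\<And>x. x \<in> S \<Longrightarrow> f x = g x" "k_times_smooth_on k S f"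
  shows "k_times_smooth_on k S g"
  using assms(2,3)
proof (induction k arbitrary: f g)
  case 0
  then show ?case
    using continuous_on_cong by fastforce
next
  case (Suc k)
  \<comment> \<open>The filter \<open>at x\<close> is that of the whole space, so agreement on S
    fixes the derivative only because S is a neighbourhood of x.\<close>
  have der: "(g has_derivative frechet_derivative f (at x)) (at x)" if "x \<in> S" for x
    using that Suc.prems assms(1) frechet_derivative_works[of f "at x"]
    by (auto intro: has_derivative_transform_within_open[of f _ x UNIV S g])
  then have eq: "frechet_derivative f (at x) = frechet_derivative g (at x)" if "x \<in> S" for x
    using that frechet_derivative_at by blast
  have "k_times_smooth_on k S (\<lambda>x. frechet_derivative g (at x) v)" for v
    by (rule Suc.IH[of "\<lambda>x. frechet_derivative f (at x) v"]) (use Suc.prems eq in auto)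
  then show ?case
    using der by (auto simp: differentiable_def)
qed

lemma k_times_smooth_on_subset:
  "k_times_smooth_on k S f \<Longrightarrow> T \<subseteq> S \<Longrightarrow> k_times_smooth_on k T f"
  by (induction k arbitrary: f) (auto intro: continuous_on_subset)

lemma k_times_smooth_on_SucD:
  "k_times_smooth_on (Suc k) S f \<Longrightarrow> k_times_smooth_on k S f"
proof (induction k arbitrary: f)
  case 0
  then show ?case
    by (auto intro!: continuous_at_imp_continuous_on differentiable_imp_continuous_within)
next
  case (Suc k)
  then show ?case
    using k_times_smooth_on.simps(2)[of "Suc k" S f] k_times_smooth_on.simps(2)[of k S f] by blast
qed

lemma k_times_smooth_on_local:
  assumes "\<And>x. x \<in> S \<Longrightarrow> \<exists>T. open T \<and> x \<in> T \<and> k_times_smooth_on k T f"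
  shows "k_times_smooth_on k S f"
  using assms
proof (induction k arbitrary: f)
  case 0
  have "isCont f x" if "x \<in> S" for x
    using 0[OF that] by (auto simp: continuous_on_eq_continuous_at)
  then show ?case
    by (simp add: continuous_at_imp_continuous_on)
next
  case (Suc k)
  have "k_times_smooth_on k S (\<lambda>x. frechet_derivative f (at x) v)" for v
    by (rule Suc.IH) (use Suc.prems in fastforce)
  then show ?case
    using Suc.prems by fastforce
qed

lemma k_times_smooth_on_const: "k_times_smooth_on k S (\<lambda>_. c)"
  by (induction k arbitrary: c) (auto simp: frechet_derivative_const)

lemma k_times_smooth_on_bounded_linear:
  assumes "bounded_linear l" "open S" "k_times_smooth_on k S f"
  shows "k_times_smooth_on k S (\<lambda>x. l (f x))"
  using assms(3)
proof (induction k arbitrary: f)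
  case 0
  then show ?case
    using bounded_linear.continuous_on[OF assms(1)] by auto
next
  case (Suc k)
  have der: "((\<lambda>x. l (f x)) has_derivative (\<lambda>v. l (frechet_derivative f (at x) v))) (at x)"
    if "x \<in> S" for x
    by (rule bounded_linear.has_derivative[OF assms(1)])
       (use that Suc.prems in \<open>auto simp flip: frechet_derivative_works\<close>)
  have "k_times_smooth_on k S (\<lambda>x. frechet_derivative (\<lambda>x. l (f x)) (at x) v)" for v
    by (rule k_times_smooth_on_cong[OF assms(2), of "\<lambda>x. l (frechet_derivative f (at x) v)"])
       (use Suc in \<open>auto simp: frechet_derivative_at[OF der, symmetric]\<close>)
  then show ?case
    using der by (auto simp: differentiable_def)
qed

lemma k_times_smooth_on_add:
  assumes "open S" "k_times_smooth_on k S f" "k_times_smooth_on k S g"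
  shows "k_times_smooth_on k S (\<lambda>x. f x + g x)"
  using assms(2,3)
proof (induction k arbitrary: f g)
  case 0
  then show ?case
    by (auto intro: continuous_on_add)
next
  case (Suc k)
  have der: "((\<lambda>x. f x + g x) has_derivative
      (\<lambda>v. frechet_derivative f (at x) v + frechet_derivative g (at x) v)) (at x)" if "x \<in> S" for x
    by (rule has_derivative_add) (use that Suc.prems in \<open>auto simp flip: frechet_derivative_works\<close>)
  have "k_times_smooth_on k S (\<lambda>x. frechet_derivative (\<lambda>x. f x + g x) (at x) v)" for v
    by (rule k_times_smooth_on_cong[OF assms(1),
          of "\<lambda>x. frechet_derivative f (at x) v + frechet_derivative g (at x) v"])
       (use Suc in \<open>auto simp: frechet_derivative_at[OF der, symmetric]\<close>)
  then show ?case
    using der by (auto simp: differentiable_def)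
qed

lemma k_times_smooth_on_sum:
  assumes "open S" "\<And>i. i \<in> I \<Longrightarrow> k_times_smooth_on k S (f i)"
  shows "k_times_smooth_on k S (\<lambda>x. \<Sum>i\<in>I. f i x)"
  using assms(2)
  by (induction I rule: infinite_finite_induct)
     (simp_all add: k_times_smooth_on_const k_times_smooth_on_add assms(1))

text \<open>The product rule replaces one product by two, each with one undifferentiated factor.
  Hence the induction runs over all pairs of functions, and that factor is lowered from order k + 1
  to order k.\<close>

lemma (in bounded_bilinear) k_times_smooth_on:
  assumes "open S" "k_times_smooth_on k S f" "k_times_smooth_on k S g"
  shows "k_times_smooth_on k S (\<lambda>x. prod (f x) (g x))"
  using assms(2,3)
proof (induction k arbitrary: f g)
  case 0
  then show ?case
    by (auto intro: continuous_on)
next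
  case (Suc k)
  have der: "((\<lambda>x. prod (f x) (g x)) has_derivative
      (\<lambda>v. prod (f x) (frechet_derivative g (at x) v) + prod (frechet_derivative f (at x) v) (g x)))
      (at x)" if "x \<in> S" for x
    by (rule FDERIV) (use that Suc.prems in \<open>auto simp flip: frechet_derivative_works\<close>)
  have "k_times_smooth_on k S (\<lambda>x. frechet_derivative (\<lambda>x. prod (f x) (g x)) (at x) v)" for v
  proof (rule k_times_smooth_on_cong[OF assms(1),
      of "\<lambda>x. prod (f x) (frechet_derivative g (at x) v) + prod (frechet_derivative f (at x) v) (g x)"])
    show "k_times_smooth_on k S
        (\<lambda>x. prod (f x) (frechet_derivative g (at x) v) + prod (frechet_derivative f (at x) v) (g x))"
      using Suc.prems k_times_smooth_on_SucD[OF Suc.prems(1)] k_times_smooth_on_SucD[OF Suc.prems(2)]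
      by (intro k_times_smooth_on_add assms(1) Suc.IH) auto
  qed (simp add: frechet_derivative_at[OF der, symmetric])
  then show ?case
    using der by (auto simp: differentiable_def)
qed

text \<open>The derivative of the reciprocal is a product containing the same reciprocal twice, so
  the induction hypothesis is applied to the function itself and the rest is the product
  rule.\<close>

lemma k_times_smooth_on_inverse:
  fixes f :: "'e::real_normed_vector \<Rightarrow> real"
  assumes "open S" "\<And>x. x \<in> S \<Longrightarrow> f x \<noteq> 0" "k_times_smooth_on k S f"
  shows "k_times_smooth_on k S (\<lambda>x. inverse (f x))"
  using assms(3)
proof (induction k)
  case 0
  then show ?case
    using assms(2) by (auto intro: continuous_on_inverse)
next
  case (Suc k)
  have der: "((\<lambda>x. inverse (f x)) has_derivative
      (\<lambda>v. - (inverse (f x) * (frechet_derivative f (at x) v * inverse (f x))))) (at x)"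
    if "x \<in> S" for x
  proof -
    have "(f has_derivative frechet_derivative f (at x)) (at x)"
      using that Suc.prems by (auto simp flip: frechet_derivative_works)
    from Deriv.has_derivative_inverse[OF assms(2)[OF that] this] show ?thesis
      by (simp add: mult.assoc)
  qed
  have "k_times_smooth_on k S (\<lambda>x. frechet_derivative (\<lambda>x. inverse (f x)) (at x) v)" for v
  proof (rule k_times_smooth_on_cong[OF assms(1),
      of "\<lambda>x. - (inverse (f x) * (frechet_derivative f (at x) v * inverse (f x)))"])
    have inv: "k_times_smooth_on k S (\<lambda>x. inverse (f x))"
      using Suc k_times_smooth_on_SucD by blast
    show "k_times_smooth_on k S (\<lambda>x. - (inverse (f x) * (frechet_derivative f (at x) v * inverse (f x))))"
      using Suc.prems
      by (intro k_times_smooth_on_bounded_linear[OF bounded_linear_minus[OF bounded_linear_ident]]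
          bounded_bilinear.k_times_smooth_on[OF bounded_bilinear_mult] inv assms(1)) auto
  qed (simp add: frechet_derivative_at[OF der, symmetric])
  then show ?case
    using der by (auto simp: differentiable_def)
qed

section \<open>Orthonormal coordinates on model spaces and the chain rule\<close>

lemma ex_orthonormal_basis:
  "\<exists>B::'e::fin_dim_inner set. finite B \<and> pairwise orthogonal B \<and> (\<forall>b\<in>B. norm b = 1) \<and> span B = UNIV"
proof -
  obtain A :: "'e set" where A: "finite A" "span A = UNIV"
    using ex_finite_span_UNIV by blast
  obtain B :: "'e set" where B: "finite B" "pairwise orthogonal B" "span B = UNIV"
    using basis_orthogonal[OF A(1)] A(2) by metis
  let ?N = "(\<lambda>b. b /\<^sub>R norm b) ` (B - {0})"
  have "b \<in> span ?N" if "b \<in> B" for b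
  proof (cases "b = 0")
    case False
    then have "norm b *\<^sub>R (b /\<^sub>R norm b) \<in> span ?N"
      using that by (intro span_scale span_base) auto
    then show ?thesis
      using False by simp
  qed (simp add: span_zero)
  then have "span B \<subseteq> span ?N"
    by (intro span_minimal) auto
  moreover have "pairwise orthogonal ?N"
    using B(2) by (auto simp: pairwise_def orthogonal_def)
  ultimately show ?thesis
    using B by (intro exI[of _ ?N]) auto
qed

text \<open>One fixed choice of coordinates for every model space. In dimension zero it is empty,
  and expansions over it are empty sums.\<close>

definition onb :: "'e::fin_dim_inner set"
  where "onb = (SOME B. finite B \<and> pairwise orthogonal B \<and> (\<forall>b\<in>B. norm b = 1) \<and> span B = UNIV)"

lemma onb:
  shows finite_onb: "finite (onb :: 'e::fin_dim_inner set)"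
    and orthogonal_onb: "pairwise orthogonal (onb :: 'e set)"
    and norm_onb: "b \<in> onb \<Longrightarrow> norm (b :: 'e) = 1"
    and span_onb: "span (onb :: 'e set) = UNIV"
  using someI_ex[OF ex_orthonormal_basis[where 'e='e]] unfolding onb_def by blast+

text \<open>The difference of the two sides is orthogonal to every basis vector, hence to the span,
  which contains the difference itself.\<close>

lemma onb_expansion: "(\<Sum>b\<in>onb. (v \<bullet> b) *\<^sub>R b) = (v :: 'e::fin_dim_inner)"
proof -
  let ?w = "v - (\<Sum>b\<in>onb. (v \<bullet> b) *\<^sub>R b)"
  have "orthogonal ?w b" if "b \<in> onb" for b
  proof -
    have "(\<Sum>a\<in>onb. (v \<bullet> a) * (a \<bullet> b)) = (\<Sum>a\<in>onb. if a = b then v \<bullet> b else 0)"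
      using orthogonal_onb[where 'e='e] norm_onb[OF that] that
      by (intro sum.cong) (auto simp: pairwise_def orthogonal_def norm_eq_1)
    then show ?thesis
      using that finite_onb[where 'e='e]
      by (simp add: orthogonal_def inner_diff_left inner_sum_left)
  qed
  then have "orthogonal ?w ?w"
    using orthogonal_to_span[of ?w onb ?w] span_onb[where 'e='e] by blast
  then show ?thesis
    by (simp add: orthogonal_def)
qed

lemma linear_onb_expansion:
  fixes l :: "'e::fin_dim_inner \<Rightarrow> 'f::real_vector"
  assumes "linear l"
  shows "l v = (\<Sum>b\<in>onb. (v \<bullet> b) *\<^sub>R l b)"
proof -
  have "l v = l (\<Sum>b\<in>onb. (v \<bullet> b) *\<^sub>R b)"
    by (simp add: onb_expansion)
  also have "\<dots> = (\<Sum>b\<in>onb. (v \<bullet> b) *\<^sub>R l b)"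
    using assms by (simp add: linear_sum linear_scale)
  finally show ?thesis .
qed

lemma covector_onb_expansion:
  "(\<Sum>b\<in>onb. blinfun_apply \<xi> b *\<^sub>R blinfun_inner_right b) = (\<xi> :: 'e::fin_dim_inner \<Rightarrow>\<^sub>L real)"
proof (rule blinfun_eqI)
  fix v
  show "blinfun_apply (\<Sum>b\<in>onb. blinfun_apply \<xi> b *\<^sub>R blinfun_inner_right b) v = blinfun_apply \<xi> v"
    using linear_onb_expansion[of "blinfun_apply \<xi>" v]
    by (simp add: blinfun.bilinear_simps mult.commute inner_commute bounded_linear.linear
        blinfun.bounded_linear_right)
qed

text \<open>The covectors \<open>blinfun_inner_right b\<close> form the basis dual to
  \<open>onb\<close>. This reduces a bivector with varying arguments to its finitely many values at
  constant covectors.\<close>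

lemma linear_on_covectors_expansion:
  fixes l :: "('e::fin_dim_inner \<Rightarrow>\<^sub>L real) \<Rightarrow> 'f::real_vector"
  assumes "linear l"
  shows "l \<xi> = (\<Sum>b\<in>onb. blinfun_apply \<xi> b *\<^sub>R l (blinfun_inner_right b))"
proof -
  have "l \<xi> = l (\<Sum>b\<in>onb. blinfun_apply \<xi> b *\<^sub>R blinfun_inner_right b)"
    by (simp add: covector_onb_expansion)
  also have "\<dots> = (\<Sum>b\<in>onb. blinfun_apply \<xi> b *\<^sub>R l (blinfun_inner_right b))"
    using assms by (simp add: linear_sum linear_scale)
  finally show ?thesis .
qed

text \<open>In the chain rule both the point and the direction of the derivative of f vary.
  Expanding the direction in \<open>onb\<close> leaves the functions y \<mapsto> f'(y) b with b
  fixed, and to these the induction hypothesis applies; hence f is generalised and g is not.\<close>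

lemma k_times_smooth_on_compose:
  fixes g :: "'e::real_normed_vector \<Rightarrow> 'f::fin_dim_inner"
    and f :: "'f \<Rightarrow> 'h::real_normed_vector"
  assumes "open S" "g ` S \<subseteq> T" "k_times_smooth_on k T f" "k_times_smooth_on k S g"
  shows "k_times_smooth_on k S (\<lambda>x. f (g x))"
  using assms(3,4)
proof (induction k arbitrary: f)
  case 0
  then show ?case
    using assms(2) by (auto intro: continuous_on_compose2)
next
  case (Suc k)
  let ?d = "\<lambda>x v. \<Sum>b\<in>onb. (frechet_derivative g (at x) v \<bullet> b) *\<^sub>R frechet_derivative f (at (g x)) b"
  have der: "((\<lambda>x. f (g x)) has_derivative ?d x) (at x)" if "x \<in> S" for x
  proof -
    have g: "(g has_derivative frechet_derivative g (at x)) (at x)"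
      and f: "(f has_derivative frechet_derivative f (at (g x))) (at (g x))"
      using that Suc.prems assms(2) by (auto simp flip: frechet_derivative_works)
    have "(\<lambda>v. frechet_derivative f (at (g x)) (frechet_derivative g (at x) v)) = ?d x"
      using linear_onb_expansion[OF has_derivative_linear[OF f]] by blast
    then show ?thesis
      using has_derivative_compose[OF g f] by simp
  qed
  have "k_times_smooth_on k S (\<lambda>x. frechet_derivative (\<lambda>x. f (g x)) (at x) v)" for v
  proof (rule k_times_smooth_on_cong[OF assms(1), of "\<lambda>x. ?d x v"])
    show "k_times_smooth_on k S (\<lambda>x. ?d x v)"
      using Suc.prems k_times_smooth_on_SucD[OF Suc.prems(2)]
      by (intro k_times_smooth_on_sum assms(1)
          bounded_bilinear.k_times_smooth_on[OF bounded_bilinear_scaleR] 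
          k_times_smooth_on_bounded_linear[OF bounded_linear_inner_left] Suc.IH) auto
  qed (simp add: frechet_derivative_at[OF der, symmetric])
  then show ?case
    using der by (auto simp: differentiable_def)
qed

section \<open>The same rules for smoothness of all orders\<close>

lemma smooth_on_cong:
  "open S \<Longrightarrow> smooth_on S f \<Longrightarrow> (\<And>x. x \<in> S \<Longrightarrow> f x = g x) \<Longrightarrow> smooth_on S g"
  unfolding smooth_on_def using k_times_smooth_on_cong by blast

lemma smooth_on_subset: "smooth_on S f \<Longrightarrow> T \<subseteq> S \<Longrightarrow> smooth_on T f"
  unfolding smooth_on_def using k_times_smooth_on_subset by blast

lemma smooth_on_local:
  "(\<And>x. x \<in> S \<Longrightarrow> \<exists>T. open T \<and> x \<in> T \<and> smooth_on T f) \<Longrightarrow> smooth_on S f"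
  unfolding smooth_on_def by (intro allI k_times_smooth_on_local) blast

lemma smooth_on_const: "smooth_on S (\<lambda>_. c)"
  by (simp add: smooth_on_def k_times_smooth_on_const)

lemma smooth_on_bounded_linear:
  "bounded_linear l \<Longrightarrow> open S \<Longrightarrow> smooth_on S f \<Longrightarrow> smooth_on S (\<lambda>x. l (f x))"
  by (simp add: smooth_on_def k_times_smooth_on_bounded_linear)

lemma smooth_on_sum:
  "open S \<Longrightarrow> (\<And>i. i \<in> I \<Longrightarrow> smooth_on S (f i)) \<Longrightarrow> smooth_on S (\<lambda>x. \<Sum>i\<in>I. f i x)"
  by (simp add: smooth_on_def k_times_smooth_on_sum)

lemma smooth_on_diff:
  assumes "open S" "smooth_on S f" "smooth_on S g"
  shows "smooth_on S (\<lambda>x. f x - g x)"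
proof -
  have "smooth_on S (\<lambda>x. - g x)"
    using smooth_on_bounded_linear[OF bounded_linear_minus[OF bounded_linear_ident]] assms by blast
  then have "smooth_on S (\<lambda>x. f x + - g x)"
    using assms by (simp add: smooth_on_def k_times_smooth_on_add del: add_uminus_conv_diff)
  then show ?thesis
    by simp
qed

lemma (in bounded_bilinear) smooth_on:
  "open S \<Longrightarrow> smooth_on S f \<Longrightarrow> smooth_on S g \<Longrightarrow> smooth_on S (\<lambda>x. prod (f x) (g x))"
  by (simp add: smooth_on_def k_times_smooth_on)

lemmas smooth_on_scaleR = bounded_bilinear.smooth_on[OF bounded_bilinear_scaleR]
  and smooth_on_blinfun_apply = bounded_bilinear.smooth_on[OF bounded_bilinear_blinfun_apply]

lemma smooth_on_inverse:
  fixes f :: "'e::real_normed_vector \<Rightarrow> real"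
  shows "open S \<Longrightarrow> (\<And>x. x \<in> S \<Longrightarrow> f x \<noteq> 0) \<Longrightarrow> smooth_on S f \<Longrightarrow> smooth_on S (\<lambda>x. inverse (f x))"
  by (simp add: smooth_on_def k_times_smooth_on_inverse)

lemma smooth_on_compose:
  fixes g :: "'e::real_normed_vector \<Rightarrow> 'f::fin_dim_inner"
  shows "open S \<Longrightarrow> g ` S \<subseteq> T \<Longrightarrow> smooth_on T f \<Longrightarrow> smooth_on S g \<Longrightarrow> smooth_on S (\<lambda>x. f (g x))"
  unfolding smooth_on_def using k_times_smooth_on_compose[of S g T _ f] by blast

lemma smooth_on_imp_differentiable: "smooth_on S f \<Longrightarrow> x \<in> S \<Longrightarrow> f differentiable (at x)"
  unfolding smooth_on_def using k_times_smooth_on.simps(2)[of 0 S f] by blast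

lemma smooth_on_imp_continuous_on: "smooth_on S f \<Longrightarrow> continuous_on S f"
  unfolding smooth_on_def using k_times_smooth_on.simps(1)[of S f] by blast

lemma smooth_on_frechet_derivative:
  "smooth_on S f \<Longrightarrow> smooth_on S (\<lambda>x. frechet_derivative f (at x) v)"
  unfolding smooth_on_def using k_times_smooth_on.simps(2)[of _ S f] by blast

text \<open>This is what changes the bundle chart of a section: f is a transition map and w the
  components of the section. The varying direction w is again expanded in
  \<open>onb\<close>.\<close>

lemma smooth_on_frechet_derivative_compose:
  fixes g :: "'e::real_normed_vector \<Rightarrow> 'f::fin_dim_inner"
    and f :: "'f \<Rightarrow> 'h::real_normed_vector"
  assumes "open S" "g ` S \<subseteq> T" "smooth_on T f" "smooth_on S g" "smooth_on S w"
  shows "smooth_on S (\<lambda>x. frechet_derivative f (at (g x)) (w x))"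
proof (rule smooth_on_cong[OF assms(1)])
  show "smooth_on S (\<lambda>x. \<Sum>b\<in>onb. (w x \<bullet> b) *\<^sub>R frechet_derivative f (at (g x)) b)"
  proof (intro smooth_on_sum smooth_on_scaleR)
    fix b :: 'f
    show "smooth_on S (\<lambda>x. w x \<bullet> b)"
      using assms by (intro smooth_on_bounded_linear[OF bounded_linear_inner_left])
    show "smooth_on S (\<lambda>x. frechet_derivative f (at (g x)) b)"
      using assms smooth_on_compose[where f = "\<lambda>y. frechet_derivative f (at y) b"]
        smooth_on_frechet_derivative by blast
  qed (use assms in auto)
  fix x assume "x \<in> S"
  then have "f differentiable (at (g x))"
    using assms smooth_on_imp_differentiable by blast
  then have "linear (frechet_derivative f (at (g x)))"
    by (rule linear_frechet_derivative)
  then show "(\<Sum>b\<in>onb. (w x \<bullet> b) *\<^sub>R frechet_derivative f (at (g x)) b) = frechet_derivative f (at (g x)) (w x)"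
    using linear_onb_expansion by metis
qed

subsection \<open>Smooth dual frames\<close>

definition smooth_dual_frame_on ::
    "'e::real_normed_vector set \<Rightarrow> 'i set \<Rightarrow> ('i \<Rightarrow> 'e \<Rightarrow> 'm::real_normed_vector) \<Rightarrow> ('i \<Rightarrow> 'e \<Rightarrow> 'm \<Rightarrow>\<^sub>L real) \<Rightarrow> bool"
  where "smooth_dual_frame_on W I f \<xi> \<longleftrightarrow> (\<forall>i\<in>I. smooth_on W (\<xi> i)) \<and>
    (\<forall>y\<in>W. \<forall>i\<in>I. \<forall>j\<in>I. blinfun_apply (\<xi> i y) (f j y) = (if i = j then 1 else 0))"

text \<open>Independence at a point is an open condition, and dual covectors certify it at nearby
  points. The family is enlarged by one member at a time, in the manner of Gram-Schmidt; each
  enlargement may shrink the neighbourhood.\<close>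

lemma ex_smooth_dual_frame:
  fixes f :: "'i \<Rightarrow> 'e::real_normed_vector \<Rightarrow> 'm::real_inner"
  assumes "finite I" "open S" "y0 \<in> S" "\<And>i. i \<in> I \<Longrightarrow> smooth_on S (f i)"
    and "\<And>c. (\<Sum>i\<in>I. c i *\<^sub>R f i y0) = 0 \<Longrightarrow> \<forall>i\<in>I. c i = 0"
  shows "\<exists>W \<xi>. open W \<and> y0 \<in> W \<and> W \<subseteq> S \<and> smooth_dual_frame_on W I f \<xi>"
  using assms(1,4,5)
proof (induction I)
  case empty
  then show ?case
    using assms(2,3) by (auto simp: smooth_dual_frame_on_def)
next
  case (insert i I)
  have "\<forall>j\<in>I. c j = 0" if "(\<Sum>j\<in>I. c j *\<^sub>R f j y0) = 0" for c
  proof -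
    let ?c = "c(i := 0)"
    have "(\<Sum>j\<in>I. ?c j *\<^sub>R f j y0) = (\<Sum>j\<in>I. c j *\<^sub>R f j y0)"
      using insert.hyps by (intro sum.cong) auto
    then have "(\<Sum>j\<in>insert i I. ?c j *\<^sub>R f j y0) = 0"
      using insert.hyps that by simp
    then show ?thesis
      using insert.prems(2)[of ?c] insert.hyps by (metis fun_upd_other insertCI)
  qed
  with insert.IH insert.prems(1) obtain W \<xi> where W: "open W" "y0 \<in> W" "W \<subseteq> S"
    and frame: "smooth_dual_frame_on W I f \<xi>"
    by blast
  have \<xi>: "\<And>j. j \<in> I \<Longrightarrow> smooth_on W (\<xi> j)"
    and dual: "\<And>y j l. y \<in> W \<Longrightarrow> j \<in> I \<Longrightarrow> l \<in> I \<Longrightarrow>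
      blinfun_apply (\<xi> j y) (f l y) = (if j = l then 1 else 0)"
    using frame by (auto simp: smooth_dual_frame_on_def)
  have f: "smooth_on W (f j)" if "j \<in> insert i I" for j
    using smooth_on_subset[OF insert.prems(1)[OF that] W(3)] .
  \<comment> \<open>The part of the new field not accounted for by the old ones. If it vanished at
    y0, there would be a linear relation with coefficient 1 at i.\<close>
  define w where "w y = f i y - (\<Sum>j\<in>I. blinfun_apply (\<xi> j y) (f i y) *\<^sub>R f j y)" for y
  have w0: "w y0 \<noteq> 0"
  proof
    assume "w y0 = 0"
    let ?c = "\<lambda>j. if j = i then 1 else - blinfun_apply (\<xi> j y0) (f i y0)"
    have "(\<Sum>j\<in>I. ?c j *\<^sub>R f j y0) = (\<Sum>j\<in>I. - (blinfun_apply (\<xi> j y0) (f i y0) *\<^sub>R f j y0))"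
      using insert.hyps by (intro sum.cong) auto
    then have "(\<Sum>j\<in>insert i I. ?c j *\<^sub>R f j y0) = 0"
      using insert.hyps \<open>w y0 = 0\<close> by (simp add: w_def sum_negf)
    then show False
      using insert.prems(2)[of ?c] by auto
  qed
  \<comment> \<open>A constant covector detecting w at y0; \<zeta> is its correction that vanishes
    on all old fields.\<close>
  define \<zeta>0 where "\<zeta>0 = blinfun_inner_right (w y0)"
  define \<zeta> where "\<zeta> y = \<zeta>0 - (\<Sum>j\<in>I. blinfun_apply \<zeta>0 (f j y) *\<^sub>R \<xi> j y)" for y
  have \<zeta>_smooth: "smooth_on W \<zeta>"
    unfolding \<zeta>_def[abs_def] using W \<xi> f
    by (intro smooth_on_diff smooth_on_const smooth_on_sum smooth_on_scaleR smooth_on_blinfun_apply) auto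
  have \<zeta>_j: "blinfun_apply (\<zeta> y) (f j y) = 0" if "y \<in> W" "j \<in> I" for y j
  proof -
    have "(\<Sum>l\<in>I. blinfun_apply \<zeta>0 (f l y) * blinfun_apply (\<xi> l y) (f j y)) =
        (\<Sum>l\<in>I. if l = j then blinfun_apply \<zeta>0 (f j y) else 0)"
      using that dual by (intro sum.cong) auto
    then show ?thesis
      using that insert.hyps by (simp add: \<zeta>_def blinfun.bilinear_simps)
  qed
  define g where "g y = blinfun_apply (\<zeta> y) (f i y)" for y
  have g_smooth: "smooth_on W g"
    unfolding g_def[abs_def] using W \<zeta>_smooth f by (intro smooth_on_blinfun_apply) auto
  \<comment> \<open>Moving the correction from the covector to the vector turns the value of \<zeta>
    on the new field into the value of \<zeta>0 on w.\<close>
  have "g y0 = w y0 \<bullet> w y0"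
    by (simp add: g_def \<zeta>_def \<zeta>0_def w_def blinfun.bilinear_simps inner_diff_right inner_sum_right
        mult.commute)
  then have g0: "g y0 \<noteq> 0"
    using w0 by simp
  define V where "V = W \<inter> g -` (- {0})"
  have V: "open V" "y0 \<in> V" "V \<subseteq> W" "\<And>y. y \<in> V \<Longrightarrow> g y \<noteq> 0"
    using continuous_open_preimage[OF smooth_on_imp_continuous_on[OF g_smooth] W(1)] W g0
    by (auto simp: V_def)
  define \<xi>i where "\<xi>i y = inverse (g y) *\<^sub>R \<zeta> y" for y
  have \<xi>i_smooth: "smooth_on V \<xi>i"
    unfolding \<xi>i_def[abs_def] using V g_smooth \<zeta>_smooth
    by (intro smooth_on_scaleR smooth_on_inverse) (auto intro: smooth_on_subset)
  \<comment> \<open>The normalised new covector kills the old fields, so subtracting multiples of it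
    makes the old covectors vanish on the new field without changing their values on the old
    ones.\<close>
  define \<xi>' where "\<xi>' = (\<lambda>j y. if j = i then \<xi>i y else \<xi> j y - blinfun_apply (\<xi> j y) (f i y) *\<^sub>R \<xi>i y)"
  have "smooth_on V (\<xi>' j)" if "j \<in> insert i I" for j
  proof (cases "j = i")
    case False
    then have "smooth_on V (\<lambda>y. \<xi> j y - blinfun_apply (\<xi> j y) (f i y) *\<^sub>R \<xi>i y)"
      using that V \<xi>i_smooth \<xi>[of j] f[of i]
      by (intro smooth_on_diff smooth_on_scaleR smooth_on_blinfun_apply) (auto intro: smooth_on_subset)
    then show ?thesis
      using False by (simp add: \<xi>'_def)
  qed (simp add: \<xi>'_def \<xi>i_smooth)
  moreover have "blinfun_apply (\<xi>' j y) (f l y) = (if j = l then 1 else 0)"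
    if "y \<in> V" "j \<in> insert i I" "l \<in> insert i I" for y j l
  proof -
    have \<xi>i: "blinfun_apply (\<xi>i y) (f i y) = 1" "\<And>l. l \<in> I \<Longrightarrow> blinfun_apply (\<xi>i y) (f l y) = 0"
      using V(3,4) that(1) \<zeta>_j by (auto simp: \<xi>i_def blinfun.bilinear_simps simp flip: g_def)
    have y: "y \<in> W"
      using V(3) that(1) by blast
    show ?thesis
      using that(2,3) insert.hyps(2) \<xi>i dual[OF y]
      by (auto simp: \<xi>'_def blinfun.bilinear_simps)
  qed
  ultimately have "smooth_dual_frame_on V (insert i I) f \<xi>'"
    unfolding smooth_dual_frame_on_def by blast
  then show ?case
    using V W(3) by blast
qed

text \<open>Applying one dual covector to a linear relation isolates one coefficient. Injectivity is
  recorded separately because independence of the image as a set does not see repeated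
  vectors.\<close>

lemma dual_frame_independent:
  fixes f :: "'i \<Rightarrow> 'm::real_normed_vector"
  assumes "finite I"
    and dual: "\<And>i j. i \<in> I \<Longrightarrow> j \<in> I \<Longrightarrow> blinfun_apply (\<xi> i) (f j) = (if i = j then 1 else (0::real))"
  shows "inj_on f I" "independent (f ` I)"
proof -
  show inj: "inj_on f I"
  proof (rule inj_onI)
    fix i j assume "i \<in> I" "j \<in> I" "f i = f j"
    then show "i = j"
      using dual[of i i] dual[of i j] by (auto split: if_splits)
  qed
  have "u (f j) = 0" if u: "(\<Sum>v\<in>f ` I. u v *\<^sub>R v) = 0" and j: "j \<in> I" for u j
  proof -
    have "(\<Sum>i\<in>I. u (f i) *\<^sub>R f i) = 0"
      using u by (simp add: sum.reindex[OF inj])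
    then have "blinfun_apply (\<xi> j) (\<Sum>i\<in>I. u (f i) *\<^sub>R f i) = 0"
      by simp
    then have "(\<Sum>i\<in>I. u (f i) * blinfun_apply (\<xi> j) (f i)) = 0"
      by (simp add: blinfun.bilinear_simps)
    moreover have "(\<Sum>i\<in>I. u (f i) * blinfun_apply (\<xi> j) (f i)) = (\<Sum>i\<in>I. if i = j then u (f j) else 0)"
      using dual j by (intro sum.cong) auto
    ultimately show ?thesis
      using j assms(1) by simp
  qed
  then show "independent (f ` I)"
    using assms(1) by (auto simp: dependent_finite)
qed


subsection \<open>Annihilators and bivectors\<close>

text \<open>The covector to test with is the inner product with u - v. As \<open>sharp\<close> is
  known only through its pairings, identities between contractions are proved in this way.\<close>

lemma covectors_separate:
  fixes u v :: "'m::real_inner"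
  assumes "\<And>\<eta> :: 'm \<Rightarrow>\<^sub>L real. blinfun_apply \<eta> u = blinfun_apply \<eta> v"
  shows "u = v"
proof -
  have "(u - v) \<bullet> u = (u - v) \<bullet> v"
    using assms[of "blinfun_inner_right (u - v)"] by simp
  then have "(u - v) \<bullet> (u - v) = 0"
    unfolding inner_diff_right by simp
  then show ?thesis
    by simp
qed

section \<open>Bases, dimension and separating covectors\<close>

lemma finite_independent:
  fixes B :: "'m::fin_dim_inner set"
  assumes "independent B"
  shows "finite B"
  using independent_span_bound[OF finite_onb assms] span_onb by auto

lemma subspace_basis:
  fixes R :: "'m::fin_dim_inner set"
  assumes "subspace R"
  obtains B where "finite B" "independent B" "span B = R" "card B = dim R"
proof -
  obtain B where "B \<subseteq> R" "independent B" "R \<subseteq> span B" "card B = dim R"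
    using basis_exists by blast
  then show ?thesis
    using that[of B] finite_independent span_minimal[OF _ assms] by blast
qed

text \<open>A vector of R outside the span could be added, giving an independent subset of R with
  more than \<open>dim R\<close> elements.\<close>

lemma independent_card_dim_spans:
  fixes R :: "'m::fin_dim_inner set"
  assumes "subspace R" "B \<subseteq> R" "independent B" "card B = dim R"
  shows "span B = R"
proof (rule ccontr)
  assume "span B \<noteq> R"
  then obtain v where v: "v \<in> R" "v \<notin> span B"
    using span_minimal[OF assms(2,1)] by blast
  then have "independent (insert v B)"
    using assms(3) independent_insertI by blast
  moreover obtain C where C: "finite C" "span C = R" "card C = dim R"
    using subspace_basis[OF assms(1)] by metis
  ultimately have "card (insert v B) \<le> card B"
    using independent_span_bound[OF C(1), of "insert v B"] assms(2,4) v(1) by auto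
  moreover have "v \<notin> B"
    using v(2) span_base by blast
  ultimately show False
    using finite_independent[OF assms(3)] by simp
qed

lemma dim_inj_linear_image:
  fixes l :: "'m::fin_dim_inner \<Rightarrow> 'n::real_vector"
  assumes "linear l" "inj l" "subspace R"
  shows "dim (l ` R) = dim R"
proof -
  obtain B where B: "finite B" "independent B" "span B = R" "card B = dim R"
    using subspace_basis[OF assms(3)] by metis
  have "span (l ` B) = span (l ` R)"
    using B(3) linear_span_image[OF assms(1)] by (metis span_span)
  moreover have "independent (l ` B)"
    using linear_independent_injective_image[OF assms(1) B(2)] assms(2) by (simp add: inj_on_subset)
  moreover have "card (l ` B) = card B"
    using assms(2) by (simp add: card_image inj_on_subset)
  ultimately show ?thesis
    using B(4) dim_eq_card by metis
qed

lemma ex_covector_separating: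
  fixes R :: "'m::fin_dim_inner set"
  assumes "subspace R" "u \<notin> R"
  shows "\<exists>\<nu>. (\<forall>v\<in>R. blinfun_apply \<nu> v = 0) \<and> blinfun_apply \<nu> u = (1::real)"
proof -
  obtain B where B: "finite B" "independent B" "span B = R"
    using subspace_basis[OF assms(1)] by metis
  have ind: "independent (insert u B)"
    using B assms(2) independent_insertI by blast
  have "\<forall>b\<in>insert u B. c b = 0" if "(\<Sum>b\<in>insert u B. c b *\<^sub>R b) = 0" for c
    using ind that B(1) by (auto simp: dependent_finite)
  \<comment> \<open>Constant fields over the real line turn the smooth statement into a pointwise
    one. The covector dual to u, taken at the parameter 0, separates u from R.\<close>
  with ex_smooth_dual_frame[of "insert u B" "UNIV :: real set" 0 "\<lambda>b _. b"] B(1)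
  obtain W \<xi> where W: "(0::real) \<in> W" "smooth_dual_frame_on W (insert u B) (\<lambda>b _. b) \<xi>"
    by (auto simp: smooth_on_const)
  have "u \<notin> B"
    using B(3) assms(2) span_base by blast
  then have "\<forall>b\<in>B. blinfun_apply (\<xi> u 0) b = 0" "blinfun_apply (\<xi> u 0) u = 1"
    using W by (auto simp: smooth_dual_frame_on_def)
  moreover have "blinfun_apply (\<xi> u 0) v = 0" if "v \<in> span B" "\<forall>b\<in>B. blinfun_apply (\<xi> u 0) b = 0" for v
    using that linear_eq_0_on_span[of "blinfun_apply (\<xi> u 0)" B v]
    by (simp add: bounded_linear.linear blinfun.bounded_linear_right)
  ultimately show ?thesis
    using B(3) by blast
qed

definition annihilator :: "'m::real_normed_vector set \<Rightarrow> ('m \<Rightarrow>\<^sub>L real) set"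
  where "annihilator R = {\<nu>. \<forall>v\<in>R. blinfun_apply \<nu> v = 0}"

lemma subspace_annihilator: "subspace (annihilator R)"
  by (auto simp: subspace_def annihilator_def blinfun.bilinear_simps)

section \<open>Linearity, duality and smoothness of contraction with a bivector\<close>

lemma is_bivector_linear:
  assumes "is_bivector P"
  shows "linear (P \<xi>)" "linear (\<lambda>\<xi>. P \<xi> \<eta>)"
  using assms unfolding is_bivector_def bilinear_def by blast+

lemma is_bivector_skew: "is_bivector P \<Longrightarrow> P \<xi> \<eta> = - P \<eta> \<xi>"
  unfolding is_bivector_def by blast

lemma linear_sharp:
  fixes P :: "'m::fin_dim_inner bivector"
  assumes "is_bivector P"
  shows "linear (sharp P)"
proof
  note lin = is_bivector_linear(2)[OF assms]
  show "sharp P (\<xi> + \<eta>) = sharp P \<xi> + sharp P \<eta>" for \<xi> \<eta>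
    by (rule covectors_separate) (simp add: sharp[OF assms] blinfun.bilinear_simps linear_add[OF lin])
  show "sharp P (c *\<^sub>R \<xi>) = c *\<^sub>R sharp P \<xi>" for \<xi> c
    by (rule covectors_separate) (simp add: sharp[OF assms] blinfun.bilinear_simps linear_scale[OF lin])
qed

lemma subspace_sharp_annihilator:
  fixes P :: "'m::fin_dim_inner bivector"
  shows "is_bivector P \<Longrightarrow> subspace (sharp P ` annihilator R)"
  by (intro linear_subspace_image linear_sharp subspace_annihilator)

text \<open>By skew-symmetry a covector \<nu> annihilating R takes on \<open>sharp P \<xi>\<close>
  minus the value of \<xi> on \<open>sharp P \<nu>\<close>, which is 0; and R is cut out by its
  annihilator. Later R is the tangent space of the orbit, so covectors killing the contracted
  conormals have tangent contraction.\<close>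

lemma sharp_mem_if_kills_sharp_annihilator:
  fixes P :: "'m::fin_dim_inner bivector"
  assumes "is_bivector P" "subspace R" "\<And>v. v \<in> sharp P ` annihilator R \<Longrightarrow> blinfun_apply \<xi> v = 0"
  shows "sharp P \<xi> \<in> R"
proof (rule ccontr)
  assume "sharp P \<xi> \<notin> R"
  then obtain \<nu> where \<nu>: "\<nu> \<in> annihilator R" "blinfun_apply \<nu> (sharp P \<xi>) = 1"
    using ex_covector_separating[OF assms(2)] by (auto simp: annihilator_def)
  have "blinfun_apply \<nu> (sharp P \<xi>) = - blinfun_apply \<xi> (sharp P \<nu>)"
    unfolding sharp[OF assms(1)] by (rule is_bivector_skew[OF assms(1)])
  then show False
    using \<nu> assms(3) by simp
qed

text \<open>The smoothness known for a bivector field concerns constant covectors only; bilinearity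
  and the dual basis extend it to smooth covector fields.\<close>

lemma smooth_on_bivector:
  fixes P :: "'e::real_normed_vector \<Rightarrow> 'm::fin_dim_inner bivector"
  assumes "open S" "\<And>y. y \<in> S \<Longrightarrow> is_bivector (P y)" "\<And>a b. smooth_on S (\<lambda>y. P y a b)"
    and "smooth_on S \<xi>" "smooth_on S \<eta>"
  shows "smooth_on S (\<lambda>y. P y (\<xi> y) (\<eta> y))"
proof (rule smooth_on_cong[OF assms(1)])
  show "smooth_on S (\<lambda>y. \<Sum>a\<in>onb. blinfun_apply (\<xi> y) a *\<^sub>R
      (\<Sum>b\<in>onb. blinfun_apply (\<eta> y) b *\<^sub>R P y (blinfun_inner_right a) (blinfun_inner_right b)))"
    using assms by (intro smooth_on_sum smooth_on_scaleR smooth_on_blinfun_apply smooth_on_const)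
  fix y assume "y \<in> S"
  then have "is_bivector (P y)"
    using assms(2) by blast
  note lin = is_bivector_linear[OF this]
  have "P y (\<xi> y) (\<eta> y) = (\<Sum>a\<in>onb. blinfun_apply (\<xi> y) a *\<^sub>R P y (blinfun_inner_right a) (\<eta> y))"
    using linear_on_covectors_expansion[OF lin(2), where \<xi> = "\<xi> y"] .
  also have "\<dots> = (\<Sum>a\<in>onb. blinfun_apply (\<xi> y) a *\<^sub>R
      (\<Sum>b\<in>onb. blinfun_apply (\<eta> y) b *\<^sub>R P y (blinfun_inner_right a) (blinfun_inner_right b)))"
    by (intro sum.cong refl arg_cong[of _ _ "scaleR _"] linear_on_covectors_expansion lin(1))
  finally show "(\<Sum>a\<in>onb. blinfun_apply (\<xi> y) a *\<^sub>R
      (\<Sum>b\<in>onb. blinfun_apply (\<eta> y) b *\<^sub>R P y (blinfun_inner_right a) (blinfun_inner_right b))) =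
      P y (\<xi> y) (\<eta> y)" ..
qed

text \<open>The coordinates of the contracted vector in \<open>onb\<close> are values of the
  bivector at basis covectors.\<close>

lemma smooth_on_sharp:
  fixes P :: "'e::real_normed_vector \<Rightarrow> 'm::fin_dim_inner bivector"
  assumes "open S" "\<And>y. y \<in> S \<Longrightarrow> is_bivector (P y)" "\<And>a b. smooth_on S (\<lambda>y. P y a b)"
    and "smooth_on S \<xi>"
  shows "smooth_on S (\<lambda>y. sharp (P y) (\<xi> y))"
proof (rule smooth_on_cong[OF assms(1)])
  show "smooth_on S (\<lambda>y. \<Sum>b\<in>onb. P y (\<xi> y) (blinfun_inner_right b) *\<^sub>R b)"
    by (intro smooth_on_sum smooth_on_scaleR smooth_on_bivector[OF assms] smooth_on_const assms(1))
  fix y assume "y \<in> S"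
  then have "P y (\<xi> y) (blinfun_inner_right b) = sharp (P y) (\<xi> y) \<bullet> b" for b
    using sharp[OF assms(2), of y "blinfun_inner_right b" "\<xi> y"] by (simp add: inner_commute)
  then show "(\<Sum>b\<in>onb. P y (\<xi> y) (blinfun_inner_right b) *\<^sub>R b) = sharp (P y) (\<xi> y)"
    by (simp add: onb_expansion)
qed

lemma onb_family_independent:
  assumes "(\<Sum>b\<in>onb. c b *\<^sub>R (b :: 'e::fin_dim_inner)) = 0" "b \<in> onb"
  shows "c b = 0"
proof -
  have "0 \<notin> (onb :: 'e set)"
    using norm_onb by fastforce
  then have "independent (onb :: 'e set)"
    using pairwise_orthogonal_independent orthogonal_onb by blast
  then show ?thesis
    using assms finite_onb dependent_finite by blast
qed

text \<open>Subtracting its \<open>T\<close>-components from a fixed covector gives a smooth conormal field, which leaves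
  the covectors conormal at the base point unchanged there. Applying \<open>P\<^sup>\<sharp>\<close> extends a basis
  of the fibre of \<open>P\<^sup>\<sharp>(N\<^sup>*)\<close> at the base point to a local frame, because the rank is constant.\<close>

lemma local_frame:
  fixes T :: "'x::fin_dim_inner \<Rightarrow> 'x \<Rightarrow> 'm::fin_dim_inner" and P :: "'x \<Rightarrow> 'm bivector"
  defines "F \<equiv> \<lambda>y. sharp (P y) ` annihilator (range (T y))"
  assumes \<Omega>: "open \<Omega>" "y0 \<in> \<Omega>"
    and T: "\<And>v. smooth_on \<Omega> (\<lambda>y. T y v)" "\<And>y. y \<in> \<Omega> \<Longrightarrow> linear (T y)" "\<And>y. y \<in> \<Omega> \<Longrightarrow> inj (T y)"
    and P: "\<And>y. y \<in> \<Omega> \<Longrightarrow> is_bivector (P y)" "\<And>a b. smooth_on \<Omega> (\<lambda>y. P y a b)"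
    and F: "F y0 \<inter> range (T y0) = {0}" "\<And>y. y \<in> \<Omega> \<Longrightarrow> dim (F y) = k"
  obtains W f and \<nu> :: "('x \<Rightarrow>\<^sub>L real) \<Rightarrow> 'x \<Rightarrow> 'm \<Rightarrow>\<^sub>L real" where "open W" "y0 \<in> W" "W \<subseteq> \<Omega>"
    and "\<And>j. j < card (onb :: 'x set) + k \<Longrightarrow> smooth_on W (f j)"
    and "\<And>y. y \<in> W \<Longrightarrow> inj_on (\<lambda>j. f j y) {..<card (onb :: 'x set) + k}"
    and "\<And>y. y \<in> W \<Longrightarrow> independent ((\<lambda>j. f j y) ` {..<card (onb :: 'x set) + k})"
    and "\<And>y. y \<in> W \<Longrightarrow>
      span ((\<lambda>j. f j y) ` {..<card (onb :: 'x set) + k}) = {u + v | u v. u \<in> range (T y) \<and> v \<in> F y}"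
    and "\<And>a. smooth_on W (\<nu> a)"
    and "\<And>a y v. y \<in> W \<Longrightarrow> blinfun_apply (\<nu> a y) (T y v) = blinfun_apply a v"
    and "\<And>a y v. y \<in> W \<Longrightarrow> v \<in> F y \<Longrightarrow> blinfun_apply (\<nu> a y) v = 0"
proof -
  let ?B = "onb :: 'x set"
  note finB = finite_onb[where 'e='x]
  have T_indep: "\<forall>b\<in>?B. c b = 0" if "(\<Sum>b\<in>?B. c b *\<^sub>R T y b) = 0" "y \<in> \<Omega>" for c y
  proof -
    have "T y (\<Sum>b\<in>?B. c b *\<^sub>R b) = T y 0"
      using that T(2) by (simp add: linear_sum linear_scale linear_0)
    then show ?thesis
      using injD[OF T(3)[OF that(2)], of "\<Sum>b\<in>?B. c b *\<^sub>R b" 0] onb_family_independent by blast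
  qed
  obtain W1 \<theta> where W1: "open W1" "y0 \<in> W1" "W1 \<subseteq> \<Omega>"
    and \<theta>_frame: "smooth_dual_frame_on W1 ?B (\<lambda>b y. T y b) \<theta>"
    using ex_smooth_dual_frame[OF finB \<Omega>, of "\<lambda>b y. T y b"] T(1) T_indep[OF _ \<Omega>(2)] by blast
  have \<theta>: "\<And>b. b \<in> ?B \<Longrightarrow> smooth_on W1 (\<theta> b)"
    and \<theta>_dual: "\<And>y b c. y \<in> W1 \<Longrightarrow> b \<in> ?B \<Longrightarrow> c \<in> ?B \<Longrightarrow>
      blinfun_apply (\<theta> b y) (T y c) = (if b = c then 1 else 0)"
    using \<theta>_frame by (auto simp: smooth_dual_frame_on_def)
  have T1: "smooth_on W1 (\<lambda>y. T y v)" for v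
    using smooth_on_subset[OF T(1) W1(3)] .
  have T_ann: "\<nu> \<in> annihilator (range (T y))" if "y \<in> \<Omega>" "\<And>b. b \<in> ?B \<Longrightarrow> blinfun_apply \<nu> (T y b) = 0" for y \<nu>
  proof -
    have "blinfun_apply \<nu> (T y v) = 0" for v
      using that(2) unfolding linear_onb_expansion[OF T(2)[OF that(1)], of v]
      by (simp add: blinfun.bilinear_simps)
    then show ?thesis
      by (auto simp: annihilator_def)
  qed
  define \<kappa> where "\<kappa> \<zeta> y = \<zeta> - (\<Sum>b\<in>?B. blinfun_apply \<zeta> (T y b) *\<^sub>R \<theta> b y)" for \<zeta> :: "'m \<Rightarrow>\<^sub>L real" and y
  have \<kappa>_smooth: "smooth_on W1 (\<kappa> \<zeta>)" for \<zeta>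
    unfolding \<kappa>_def[abs_def]
    by (intro smooth_on_diff smooth_on_const smooth_on_sum smooth_on_scaleR smooth_on_blinfun_apply
        W1(1) \<theta> T1)
  have \<kappa>_ann: "\<kappa> \<zeta> y \<in> annihilator (range (T y))" if "y \<in> W1" for \<zeta> y
  proof (rule T_ann)
    fix c assume c: "c \<in> ?B"
    have "(\<Sum>b\<in>?B. blinfun_apply \<zeta> (T y b) * blinfun_apply (\<theta> b y) (T y c)) =
        (\<Sum>b\<in>?B. if b = c then blinfun_apply \<zeta> (T y c) else 0)"
      using that c \<theta>_dual by (intro sum.cong) auto
    then show "blinfun_apply (\<kappa> \<zeta> y) (T y c) = 0"
      using c finB by (simp add: \<kappa>_def blinfun.bilinear_simps)
  qed (use that W1 in auto)
  have \<kappa>_id: "\<kappa> \<zeta> y = \<zeta>" if "\<zeta> \<in> annihilator (range (T y))" for \<zeta> y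
    using that by (simp add: \<kappa>_def annihilator_def)
  have subF: "subspace (F y)" if "y \<in> \<Omega>" for y
    unfolding F_def using P(1)[OF that] by (rule subspace_sharp_annihilator)
  obtain C where C: "finite C" "independent C" "span C = F y0" "card C = k"
    using subspace_basis[OF subF[OF \<Omega>(2)]] F(2)[OF \<Omega>(2)] by metis
  have "\<exists>\<zeta>. \<zeta> \<in> annihilator (range (T y0)) \<and> c = sharp (P y0) \<zeta>" if "c \<in> C" for c
    using that C(3) span_base[of c C] by (auto simp: F_def)
  then obtain \<zeta> where \<zeta>: "\<And>c. c \<in> C \<Longrightarrow> \<zeta> c \<in> annihilator (range (T y0)) \<and> c = sharp (P y0) (\<zeta> c)"
    by metis
  define s where "s c y = sharp (P y) (\<kappa> (\<zeta> c) y)" for c y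
  have s_smooth: "smooth_on W1 (s c)" for c
    unfolding s_def[abs_def]
    by (rule smooth_on_sharp[OF W1(1) _ smooth_on_subset[OF P(2) W1(3)] \<kappa>_smooth])
       (use P(1) W1(3) in blast)
  have s_F: "s c y \<in> F y" if "y \<in> W1" for c y
    using \<kappa>_ann[OF that] by (auto simp: s_def F_def)
  have s0: "s c y0 = c" if "c \<in> C" for c
    using \<zeta>[OF that] \<kappa>_id by (simp add: s_def)
  \<comment> \<open>The disjoint sum makes one family out of tangent fields and fields in F. Its
    dual covectors with index \<open>Inl\<close> then vanish on the F-part by duality alone.\<close>
  let ?I = "?B <+> C"
  define h where "h = case_sum (\<lambda>b y. T y b) s"
  have finI: "finite ?I" and cardI: "card ?I = card ?B + k"
    using finB C by (auto simp: card_Plus)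
  have sum_I: "(\<Sum>i\<in>?I. q i) = (\<Sum>b\<in>?B. q (Inl b)) + (\<Sum>c\<in>C. q (Inr c))" for q :: "'x + 'm \<Rightarrow> 'm"
    using finB C(1) by (simp add: sum.Plus)
  have "\<forall>i\<in>?I. q i = 0" if q: "(\<Sum>i\<in>?I. q i *\<^sub>R h i y0) = 0" for q
  proof -
    let ?u = "\<Sum>b\<in>?B. q (Inl b) *\<^sub>R T y0 b" and ?v = "\<Sum>c\<in>C. q (Inr c) *\<^sub>R c"
    have "?u + ?v = 0"
      using q s0 by (simp add: sum_I h_def)
    moreover have "?u \<in> range (T y0)"
      using linear_subspace_image[OF T(2)[OF \<Omega>(2)] subspace_UNIV]
      by (intro subspace_sum subspace_scale) auto
    moreover have v: "?v \<in> F y0"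
      unfolding C(3)[symmetric] by (intro span_sum span_scale span_base)
    moreover have "- ?v \<in> F y0"
      using v subF[OF \<Omega>(2)] by (rule subspace_neg[rotated])
    \<comment> \<open>The tangent part of the relation is minus the other part, so it lies in both
      spaces, and these meet in 0 at the base point.\<close>
    ultimately have u0: "?u = 0"
      using F(1) by (metis (no_types, lifting) IntI add_eq_0_iff2 singletonD)
    then have v0: "?v = 0"
      using \<open>?u + ?v = 0\<close> by simp
    have "\<forall>c\<in>C. q (Inr c) = 0"
      using v0 C(1,2) by (auto simp: dependent_finite)
    then show ?thesis
      using T_indep[OF u0 \<Omega>(2)] by auto
  qed
  moreover have h_smooth: "smooth_on W1 (h i)" for i
    using s_smooth T1 by (cases i) (auto simp: h_def)
  ultimately obtain W \<xi> where W: "open W" "y0 \<in> W" "W \<subseteq> W1"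
    and \<xi>_frame: "smooth_dual_frame_on W ?I h \<xi>"
    using ex_smooth_dual_frame[OF finI W1(1,2), of h] by blast
  have \<xi>: "\<And>i. i \<in> ?I \<Longrightarrow> smooth_on W (\<xi> i)"
    and \<xi>_dual: "\<And>y i j. y \<in> W \<Longrightarrow> i \<in> ?I \<Longrightarrow> j \<in> ?I \<Longrightarrow>
      blinfun_apply (\<xi> i y) (h j y) = (if i = j then 1 else 0)"
    using \<xi>_frame unfolding smooth_dual_frame_on_def by blast+
  have W\<Omega>: "W \<subseteq> \<Omega>"
    using W(3) W1(3) by blast
  have indep: "inj_on (\<lambda>i. h i y) ?I" "independent ((\<lambda>i. h i y) ` ?I)" if "y \<in> W" for y
    using dual_frame_independent[OF finI, of "\<lambda>i. \<xi> i y" "\<lambda>i. h i y"] \<xi>_dual[OF that] by blast+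
  \<comment> \<open>Each section stays in F and their independence persists on W. As the dimension
    of F remains k, the k sections must span it; here constancy of the rank is used.\<close>
  have span_s: "span ((\<lambda>c. s c y) ` C) = F y" if "y \<in> W" for y
  proof (rule independent_card_dim_spans)
    have eq: "(\<lambda>c. s c y) ` C = (\<lambda>i. h i y) ` Inr ` C"
      by (auto simp: h_def image_iff)
    show "independent ((\<lambda>c. s c y) ` C)"
      using indep(2)[OF that] unfolding eq by (rule independent_mono) auto
    have "inj_on (\<lambda>i. h i y) (Inr ` C)"
      using indep(1)[OF that] by (rule inj_on_subset) auto
    then have "card ((\<lambda>c. s c y) ` C) = card C"
      unfolding eq by (simp add: card_image)
    then show "card ((\<lambda>c. s c y) ` C) = dim (F y)"
      using C(4) F(2) that W\<Omega> by auto
  qed (use subF s_F that W W\<Omega> in auto)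
  have span_T: "span (T y ` ?B) = range (T y)" if "y \<in> \<Omega>" for y
    using linear_span_image[OF T(2)[OF that]] span_onb by metis
  \<comment> \<open>Vector subbundles are defined through frames indexed by an initial segment of
    the naturals, so the disjoint sum is renumbered.\<close>
  obtain e where e: "bij_betw e {..<card ?B + k} ?I"
    using ex_bij_betw_nat_finite[OF finI] cardI by (auto simp: atLeast0LessThan)
  define f where "f j = h (e j)" for j
  have f_image: "(\<lambda>j. f j y) ` {..<card ?B + k} = (\<lambda>i. h i y) ` ?I" for y
    using bij_betw_imp_surj_on[OF e, symmetric] by (simp add: f_def image_image)
  \<comment> \<open>The covector with the prescribed values on the tangent frame and the value 0 on
    the frame of F: only dual covectors of the tangent part occur.\<close>
  define \<nu> where "\<nu> a y = (\<Sum>b\<in>?B. blinfun_apply a b *\<^sub>R \<xi> (Inl b) y)" for a :: "'x \<Rightarrow>\<^sub>L real" and y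
  show thesis
  proof
    show "open W" "y0 \<in> W" "W \<subseteq> \<Omega>"
      using W W\<Omega> by auto
    show "smooth_on W (f j)" for j
      using h_smooth W(3) by (auto simp: f_def intro: smooth_on_subset)
    show "smooth_on W (\<nu> a)" for a
      unfolding \<nu>_def[abs_def] using W \<xi>
      by (intro smooth_on_sum smooth_on_scaleR smooth_on_const) auto
    fix y assume y: "y \<in> W"
    show "inj_on (\<lambda>j. f j y) {..<card ?B + k}"
      using comp_inj_on[OF bij_betw_imp_inj_on[OF e], of "\<lambda>i. h i y"] indep(1)[OF y]
        bij_betw_imp_surj_on[OF e] by (simp add: f_def comp_def)
    show "independent ((\<lambda>j. f j y) ` {..<card ?B + k})"
      unfolding f_image by (rule indep(2)[OF y])
    have "(\<lambda>i. h i y) ` ?I = T y ` ?B \<union> (\<lambda>c. s c y) ` C"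
      by (force simp: h_def image_iff)
    then show "span ((\<lambda>j. f j y) ` {..<card ?B + k}) = {u + v | u v. u \<in> range (T y) \<and> v \<in> F y}"
      unfolding f_image using span_T[of y] span_s[OF y] y W\<Omega> by (simp add: span_Un subset_iff)
    fix a :: "'x \<Rightarrow>\<^sub>L real"
    have "blinfun_apply (\<nu> a y) (T y c) = blinfun_apply a c" if "c \<in> ?B" for c
    proof -
      have "(\<Sum>b\<in>?B. blinfun_apply a b * blinfun_apply (\<xi> (Inl b) y) (T y c)) =
          (\<Sum>b\<in>?B. if b = c then blinfun_apply a c else 0)"
        using \<xi>_dual[OF y InlI InlI, of _ c] that by (intro sum.cong) (auto simp: h_def)
      then show ?thesis
        using that finB by (simp add: \<nu>_def blinfun.bilinear_simps)
    qed
    then show "blinfun_apply (\<nu> a y) (T y v) = blinfun_apply a v" for v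
      using linear_onb_expansion[OF T(2), of y v] linear_onb_expansion[of "blinfun_apply a" v] y W\<Omega>
      by (auto simp: blinfun.bilinear_simps bounded_linear.linear blinfun.bounded_linear_right
          intro!: sum.cong)
    have s_kill: "blinfun_apply (\<nu> a y) v = 0" if "v \<in> (\<lambda>c. s c y) ` C" for v
      using that \<xi>_dual[OF y InlI InrI]
      by (auto simp: \<nu>_def blinfun.bilinear_simps h_def intro!: sum.neutral)
    show "blinfun_apply (\<nu> a y) v = 0" if "v \<in> F y" for v
      using linear_eq_0_on_span[of "blinfun_apply (\<nu> a y)" "(\<lambda>c. s c y) ` C" v] s_kill that span_s[OF y]
      by (simp add: bounded_linear.linear blinfun.bounded_linear_right)
  qed
qed

subsection \<open>Differentials of maps between manifolds\<close>

text \<open>The topological condition on a single atlas entry, stated for any topology so that it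
  can be checked on product charts directly.\<close>

definition is_chart :: "'a topology \<Rightarrow> 'a set \<Rightarrow> ('a \<Rightarrow> 'e::real_normed_vector) \<Rightarrow> bool" where
  "is_chart X U \<phi> \<longleftrightarrow> openin X U \<and> open (\<phi> ` U) \<and>
     homeomorphic_map (subtopology X U) (top_of_set (\<phi> ` U)) \<phi>"

lemma is_chart_inj_on: "is_chart X U \<phi> \<Longrightarrow> inj_on \<phi> U"
  unfolding is_chart_def homeomorphic_map_def
  by (metis openin_subset topspace_subtopology_subset)

lemma is_chart_open_image:
  assumes "is_chart X U \<phi>" "openin X V"
  shows "open (\<phi> ` (U \<inter> V))"
proof -
  have "openin (subtopology X U) (U \<inter> V)"
    using assms(2) by (auto simp: openin_subtopology)
  then have "openin (top_of_set (\<phi> ` U)) (\<phi> ` (U \<inter> V))"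
    using assms(1) homeomorphic_imp_open_map unfolding is_chart_def open_map_def by blast
  then show ?thesis
    using assms(1) openin_open_trans unfolding is_chart_def by blast
qed

lemma is_chart_openin_vimage:
  assumes "is_chart X U \<phi>" "open S"
  shows "openin X (U \<inter> \<phi> -` S)"
proof -
  have U: "openin X U" "U \<subseteq> topspace X"
    using assms(1) openin_subset unfolding is_chart_def by auto
  have "continuous_map (subtopology X U) (top_of_set (\<phi> ` U)) \<phi>"
    using assms(1) homeomorphic_imp_continuous_map unfolding is_chart_def by blast
  then have "continuous_map (subtopology X U) euclidean \<phi>"
    by (simp add: continuous_map_in_subtopology)
  then have "openin (subtopology X U) {x \<in> topspace (subtopology X U). \<phi> x \<in> S}"
    by (rule openin_continuous_map_preimage) (use assms(2) in \<open>simp flip: open_openin\<close>)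
  moreover have "{x \<in> topspace (subtopology X U). \<phi> x \<in> S} = U \<inter> \<phi> -` S"
    using U by auto
  ultimately show ?thesis
    using U(1) openin_trans_full by metis
qed

lemma is_chart_prod:
  assumes "is_chart X U \<phi>" "is_chart Y V \<psi>"
  shows "is_chart (prod_topology X Y) (U \<times> V) (map_prod \<phi> \<psi>)"
proof -
  obtain \<phi>' \<psi>' where "homeomorphic_maps (subtopology X U) (top_of_set (\<phi> ` U)) \<phi> \<phi>'"
      "homeomorphic_maps (subtopology Y V) (top_of_set (\<psi> ` V)) \<psi> \<psi>'"
    using assms unfolding is_chart_def homeomorphic_map_maps by blast
  then have "homeomorphic_maps (prod_topology (subtopology X U) (subtopology Y V))
      (prod_topology (top_of_set (\<phi> ` U)) (top_of_set (\<psi> ` V)))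
      (\<lambda>(x, y). (\<phi> x, \<psi> y)) (\<lambda>(x, y). (\<phi>' x, \<psi>' y))"
    unfolding homeomorphic_maps_prod by blast
  then have "homeomorphic_map (subtopology (prod_topology X Y) (U \<times> V))
      (top_of_set (map_prod \<phi> \<psi> ` (U \<times> V))) (map_prod \<phi> \<psi>)"
    unfolding homeomorphic_map_maps subtopology_Times map_prod_surj_on map_prod_def
    by (auto simp: map_prod_surj_on[unfolded map_prod_def])
  moreover have "map_prod \<phi> \<psi> ` (U \<times> V) = \<phi> ` U \<times> \<psi> ` V"
    by auto
  ultimately show ?thesis
    using assms unfolding is_chart_def by (auto simp: openin_prod_Times_iff open_Times)
qed

text \<open>A differential at x involves only the preferred chart at x. This local condition passes
  to products, so the chain rule is available on a product once both factors are charted at the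
  point.\<close>

definition charted_at :: "('a, 'e::real_normed_vector) manifold \<Rightarrow> 'a \<Rightarrow> bool" where
  "charted_at M x \<longleftrightarrow> chart_at M x \<in> atlas M \<and> x \<in> fst (chart_at M x) \<and>
     is_chart (mtop M) (fst (chart_at M x)) (snd (chart_at M x))"

lemma smooth_manifold_is_chart:
  "smooth_manifold M \<Longrightarrow> (U, \<phi>) \<in> atlas M \<Longrightarrow> is_chart (mtop M) U \<phi>"
  unfolding smooth_manifold_def is_chart_def by blast

lemma smooth_manifold_transition:
  "smooth_manifold M \<Longrightarrow> (U, \<phi>) \<in> atlas M \<Longrightarrow> (V, \<psi>) \<in> atlas M \<Longrightarrow>
   smooth_on (\<phi> ` (U \<inter> V)) (\<lambda>y. \<psi> (inv_into U \<phi> y))"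
  unfolding smooth_manifold_def comp_def by blast

lemma smooth_manifold_charted_at:
  assumes "smooth_manifold M" "x \<in> points M"
  shows "charted_at M x"
proof -
  obtain U \<phi> where U: "chart_at M x = (U, \<phi>)"
    by fastforce
  then have "(U, \<phi>) \<in> atlas M" "x \<in> U"
    using assms unfolding smooth_manifold_def by auto
  then show ?thesis
    using U smooth_manifold_is_chart[OF assms(1)] by (simp add: charted_at_def)
qed

lemma smooth_manifold_chart_subset_points:
  "smooth_manifold M \<Longrightarrow> (U, \<phi>) \<in> atlas M \<Longrightarrow> U \<subseteq> points M"
  using smooth_manifold_is_chart openin_subset unfolding is_chart_def points_def by blast

lemma charted_at_model_manifold: "charted_at model_manifold y"
  by (simp add: charted_at_def model_manifold_def is_chart_def)

lemma charted_at_prod_manifold: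
  assumes "charted_at M x" "charted_at N y"
  shows "charted_at (prod_manifold M N) (x, y)"
proof -
  obtain U \<phi> V \<psi> where U: "chart_at M x = (U, \<phi>)" and V: "chart_at N y = (V, \<psi>)"
    by fastforce
  have "(U \<times> V, map_prod \<phi> \<psi>) \<in> atlas (prod_manifold M N)"
    using assms U V by (auto simp: charted_at_def prod_manifold_def)
  moreover have "is_chart (mtop (prod_manifold M N)) (U \<times> V) (map_prod \<phi> \<psi>)"
    using assms U V by (auto simp: charted_at_def prod_manifold_def intro: is_chart_prod)
  moreover have "chart_at (prod_manifold M N) (x, y) = (U \<times> V, map_prod \<phi> \<psi>)"
    using U V by (simp add: prod_manifold_def)
  ultimately show ?thesis
    using assms U V by (auto simp: charted_at_def)
qed

section \<open>Differentiability and differentials in the preferred charts\<close>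

definition chart_expr ::
    "('a, 'e::real_normed_vector) manifold \<Rightarrow> ('b, 'f::real_normed_vector) manifold \<Rightarrow>
     ('a \<Rightarrow> 'b) \<Rightarrow> 'a \<Rightarrow> 'e \<Rightarrow> 'f"
  where "chart_expr M N f x z =
    snd (chart_at N (f x)) (f (inv_into (fst (chart_at M x)) (snd (chart_at M x)) z))"

lemma differential_eq_chart_expr:
  "differential M N f x =
    Blinfun (frechet_derivative (chart_expr M N f x) (at (snd (chart_at M x) x)))"
  by (simp add: differential_def chart_expr_def[abs_def] case_prod_beta comp_def)

text \<open>Continuity at x is demanded separately: a chart map of N has arbitrary values outside
  its domain, so differentiability of the chart expression does not ensure that f maps a
  neighbourhood of x into the preferred chart at \<open>f x\<close>.\<close>

definition mdiff_at ::
    "('a, 'e::real_normed_vector) manifold \<Rightarrow> ('b, 'f::real_normed_vector) manifold \<Rightarrow>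
     ('a \<Rightarrow> 'b) \<Rightarrow> 'a \<Rightarrow> bool" where
  "mdiff_at M N f x \<longleftrightarrow> charted_at M x \<and> charted_at N (f x) \<and>
     (\<forall>V. openin (mtop N) V \<and> f x \<in> V \<longrightarrow> (\<exists>U. openin (mtop M) U \<and> x \<in> U \<and> f ` U \<subseteq> V)) \<and>
     chart_expr M N f x differentiable (at (snd (chart_at M x) x))"

lemma differential_eqI:
  assumes "(chart_expr M N f x has_derivative blinfun_apply D) (at (snd (chart_at M x) x))"
  shows "differential M N f x = D"
  using frechet_derivative_at[OF assms, symmetric]
  by (simp add: differential_eq_chart_expr blinfun_apply_inverse)

lemma mdiff_at_has_derivative:
  assumes "mdiff_at M N f x"
  shows "(chart_expr M N f x has_derivative blinfun_apply (differential M N f x))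
    (at (snd (chart_at M x) x))"
proof -
  have "(chart_expr M N f x has_derivative
      frechet_derivative (chart_expr M N f x) (at (snd (chart_at M x) x))) (at (snd (chart_at M x) x))"
    using assms frechet_derivative_works unfolding mdiff_at_def by blast
  then show ?thesis
    using has_derivative_bounded_linear bounded_linear_Blinfun_apply
    unfolding differential_eq_chart_expr by metis
qed

lemma mdiff_atI:
  assumes "charted_at M x" "charted_at N (f x)"
    and "\<And>V. openin (mtop N) V \<Longrightarrow> f x \<in> V \<Longrightarrow> \<exists>U. openin (mtop M) U \<and> x \<in> U \<and> f ` U \<subseteq> V"
    and "(chart_expr M N f x has_derivative blinfun_apply D) (at (snd (chart_at M x) x))"
  shows "mdiff_at M N f x" "differential M N f x = D"
proof -
  have "chart_expr M N f x differentiable (at (snd (chart_at M x) x))"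
    using assms(4) unfolding differentiable_def by blast
  then show "mdiff_at M N f x"
    using assms(1-3) unfolding mdiff_at_def by simp
qed (rule differential_eqI[OF assms(4)])

lemma charted_at_open_image:
  assumes "charted_at M x" "openin (mtop M) W" "x \<in> W"
  shows "open (snd (chart_at M x) ` (fst (chart_at M x) \<inter> W))"
    "snd (chart_at M x) x \<in> snd (chart_at M x) ` (fst (chart_at M x) \<inter> W)"
  using assms is_chart_open_image unfolding charted_at_def by blast+

lemma charted_at_inv_into:
  assumes "charted_at M x" "p \<in> fst (chart_at M x)"
  shows "inv_into (fst (chart_at M x)) (snd (chart_at M x)) (snd (chart_at M x) p) = p"
  using assms is_chart_inj_on inv_into_f_f unfolding charted_at_def by metis

lemma charted_at_self: "charted_at M x \<Longrightarrow> x \<in> fst (chart_at M x)"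
  by (simp add: charted_at_def)

lemma charted_at_openin: "charted_at M x \<Longrightarrow> openin (mtop M) (fst (chart_at M x))"
  by (simp add: charted_at_def is_chart_def)

lemma mdiff_at_cong:
  assumes "mdiff_at M N f x" "openin (mtop M) W" "x \<in> W" "\<And>y. y \<in> W \<Longrightarrow> f y = g y"
  shows "mdiff_at M N g x" "differential M N g x = differential M N f x"
proof -
  have ch: "charted_at M x" "charted_at N (f x)"
    using assms(1) by (auto simp: mdiff_at_def)
  have gx: "g x = f x"
    using assms(3,4) by simp
  have "(chart_expr M N g x has_derivative blinfun_apply (differential M N f x)) (at (snd (chart_at M x) x))"
    using mdiff_at_has_derivative[OF assms(1)] charted_at_open_image[OF ch(1) assms(2,3)]
  proof (rule has_derivative_transform_within_open)
    fix z assume "z \<in> snd (chart_at M x) ` (fst (chart_at M x) \<inter> W)"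
    then show "chart_expr M N f x z = chart_expr M N g x z"
      using assms(4) gx charted_at_inv_into[OF ch(1)] by (auto simp: chart_expr_def)
  qed
  moreover have "\<exists>U. openin (mtop M) U \<and> x \<in> U \<and> g ` U \<subseteq> V" if V: "openin (mtop N) V" "g x \<in> V" for V
  proof -
    obtain U where "openin (mtop M) U" "x \<in> U" "f ` U \<subseteq> V"
      using V assms(1) gx unfolding mdiff_at_def by metis
    then show ?thesis
      using assms(2-4) by (intro exI[of _ "U \<inter> W"]) auto
  qed
  ultimately show "mdiff_at M N g x" "differential M N g x = differential M N f x"
    using mdiff_atI[of M x N g] ch gx by metis+
qed

text \<open>On a neighbourhood that f maps into the preferred chart at \<open>f x\<close>, the
  middle chart cancels against its inverse and the chart expressions compose; the rest is the chain
  rule between model spaces.\<close>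

lemma mdiff_at_comp:
  assumes f: "mdiff_at M N f x" and h: "mdiff_at N P h (f x)"
  shows "mdiff_at M P (\<lambda>y. h (f y)) x"
    "differential M P (\<lambda>y. h (f y)) x = differential N P h (f x) o\<^sub>L differential M N f x"
proof -
  have ch: "charted_at M x" "charted_at N (f x)" "charted_at P (h (f x))"
    using assms by (auto simp: mdiff_at_def)
  obtain W where W: "openin (mtop M) W" "x \<in> W" "f ` W \<subseteq> fst (chart_at N (f x))"
    using f charted_at_self[OF ch(2)] charted_at_openin[OF ch(2)] unfolding mdiff_at_def by meson
  have base: "chart_expr M N f x (snd (chart_at M x) x) = snd (chart_at N (f x)) (f x)"
    using charted_at_inv_into[OF ch(1) charted_at_self[OF ch(1)]] by (simp add: chart_expr_def)
  have "((\<lambda>z. chart_expr N P h (f x) (chart_expr M N f x z)) has_derivative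
      (\<lambda>v. blinfun_apply (differential N P h (f x)) (blinfun_apply (differential M N f x) v)))
      (at (snd (chart_at M x) x))"
    using has_derivative_compose[OF mdiff_at_has_derivative[OF f]] mdiff_at_has_derivative[OF h] base
    by metis
  then have "(chart_expr M P (\<lambda>y. h (f y)) x has_derivative
      (\<lambda>v. blinfun_apply (differential N P h (f x)) (blinfun_apply (differential M N f x) v)))
      (at (snd (chart_at M x) x))"
    using charted_at_open_image[OF ch(1) W(1,2)]
  proof (rule has_derivative_transform_within_open)
    fix z assume "z \<in> snd (chart_at M x) ` (fst (chart_at M x) \<inter> W)"
    then obtain p where p: "p \<in> fst (chart_at M x)" "p \<in> W" "z = snd (chart_at M x) p"
      by auto
    have "f p \<in> fst (chart_at N (f x))"
      using p(2) W(3) by blast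
    then show "chart_expr N P h (f x) (chart_expr M N f x z) = chart_expr M P (\<lambda>y. h (f y)) x z"
      by (simp add: chart_expr_def p charted_at_inv_into[OF ch(1)] charted_at_inv_into[OF ch(2)])
  qed
  moreover have "(\<lambda>v. blinfun_apply (differential N P h (f x)) (blinfun_apply (differential M N f x) v)) =
      blinfun_apply (differential N P h (f x) o\<^sub>L differential M N f x)"
    by auto
  moreover have "\<exists>U. openin (mtop M) U \<and> x \<in> U \<and> (\<lambda>y. h (f y)) ` U \<subseteq> V"
    if V: "openin (mtop P) V" "h (f x) \<in> V" for V
  proof -
    obtain V' where V': "openin (mtop N) V'" "f x \<in> V'" "h ` V' \<subseteq> V"
      using V h unfolding mdiff_at_def by metis
    obtain U where "openin (mtop M) U" "x \<in> U" "f ` U \<subseteq> V'"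
      using V'(1,2) f unfolding mdiff_at_def by metis
    then show ?thesis
      using V'(3) by (intro exI[of _ U]) auto
  qed
  ultimately show "mdiff_at M P (\<lambda>y. h (f y)) x"
    "differential M P (\<lambda>y. h (f y)) x = differential N P h (f x) o\<^sub>L differential M N f x"
    using mdiff_atI[of M x P "\<lambda>y. h (f y)"] ch by metis+
qed

lemma mdiff_at_ident:
  assumes "charted_at M x"
  shows "mdiff_at M M (\<lambda>y. y) x" "differential M M (\<lambda>y. y) x = id_blinfun"
proof -
  have "((\<lambda>z. z) has_derivative (\<lambda>v. v)) (at (snd (chart_at M x) x))"
    by (rule has_derivative_ident)
  then have "(chart_expr M M (\<lambda>y. y) x has_derivative (\<lambda>v. v)) (at (snd (chart_at M x) x))"
    using charted_at_open_image[OF assms charted_at_openin[OF assms] charted_at_self[OF assms]]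
    by (rule has_derivative_transform_within_open) (auto simp: chart_expr_def charted_at_inv_into[OF assms])
  moreover have "(\<lambda>v. v) = blinfun_apply id_blinfun"
    by auto
  ultimately show "mdiff_at M M (\<lambda>y. y) x" "differential M M (\<lambda>y. y) x = id_blinfun"
    using mdiff_atI[of M x M "\<lambda>y. y" id_blinfun] assms by (metis image_ident order_refl)+
qed

text \<open>The preferred charts belong to the atlases, so the chart condition of
  \<open>smooth_map\<close> covers the pair of charts that defines the differential.\<close>

lemma smooth_map_mdiff_at:
  assumes "smooth_map M N f" "charted_at M x" "charted_at N (f x)"
  shows "mdiff_at M N f x"
proof -
  obtain U \<phi> V \<psi> where U: "chart_at M x = (U, \<phi>)" and V: "chart_at N (f x) = (V, \<psi>)"
    by fastforce
  have cont: "continuous_map (mtop M) (mtop N) f"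
    using assms(1) by (simp add: smooth_map_def)
  have nbhd: "\<exists>W. openin (mtop M) W \<and> x \<in> W \<and> f ` W \<subseteq> V'" if "openin (mtop N) V'" "f x \<in> V'" for V'
  proof -
    have "x \<in> topspace (mtop M)"
      using charted_at_self[OF assms(2)] openin_subset[OF charted_at_openin[OF assms(2)]] by blast
    then show ?thesis
      using openin_continuous_map_preimage[OF cont that(1)] that(2)
      by (intro exI[of _ "{y \<in> topspace (mtop M). f y \<in> V'}"]) auto
  qed
  obtain W where W: "openin (mtop M) W" "x \<in> W" "f ` W \<subseteq> V"
    using nbhd[OF charted_at_openin[OF assms(3)] charted_at_self[OF assms(3)]] V by auto
  have "smooth_on (\<phi> ` (U \<inter> f -` V)) (\<psi> \<circ> f \<circ> inv_into U \<phi>)"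
    using assms U V unfolding smooth_map_def charted_at_def by auto
  moreover have "\<phi> x \<in> \<phi> ` (U \<inter> f -` V)"
    using charted_at_self[OF assms(2)] charted_at_self[OF assms(3)] U V by auto
  ultimately have "(\<psi> \<circ> f \<circ> inv_into U \<phi>) differentiable (at (\<phi> x))"
    by (rule smooth_on_imp_differentiable)
  then have "chart_expr M N f x differentiable (at (snd (chart_at M x) x))"
    by (simp add: chart_expr_def[abs_def] U V comp_def)
  then show ?thesis
    using assms(2,3) nbhd unfolding mdiff_at_def by blast
qed

section \<open>Charts and inverse charts as differentiable maps\<close>

lemma chart_expr_model_manifold:
  "chart_expr M model_manifold f x z = f (inv_into (fst (chart_at M x)) (snd (chart_at M x)) z)"
  "chart_expr model_manifold N f' y z' = snd (chart_at N (f' y)) (f' z')"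
  by (simp_all add: chart_expr_def model_manifold_def)

text \<open>Seen from the preferred chart at x, any chart of the atlas is a transition map.\<close>

lemma mdiff_at_chart:
  assumes "smooth_manifold M" "(U, \<phi>) \<in> atlas M" "x \<in> U"
  shows "mdiff_at M model_manifold \<phi> x"
proof -
  note U = smooth_manifold_is_chart[OF assms(1,2)]
  have ch: "charted_at M x"
    using smooth_manifold_charted_at[OF assms(1)] smooth_manifold_chart_subset_points[OF assms(1,2)]
      assms(3) by blast
  obtain V \<psi> where V: "chart_at M x = (V, \<psi>)"
    by fastforce
  have "smooth_on (\<psi> ` (V \<inter> U)) (\<lambda>y. \<phi> (inv_into V \<psi> y))"
    using ch V assms unfolding charted_at_def by (intro smooth_manifold_transition[OF assms(1)]) auto
  moreover have "\<psi> x \<in> \<psi> ` (V \<inter> U)"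
    using charted_at_self[OF ch] V assms(3) by auto
  ultimately have "(\<lambda>y. \<phi> (inv_into V \<psi> y)) differentiable (at (\<psi> x))"
    by (rule smooth_on_imp_differentiable)
  moreover have "\<exists>W. openin (mtop M) W \<and> x \<in> W \<and> \<phi> ` W \<subseteq> S" if "open S" "\<phi> x \<in> S" for S
    using is_chart_openin_vimage[OF U that(1)] that(2) assms(3)
    by (intro exI[of _ "U \<inter> \<phi> -` S"]) auto
  moreover have "chart_expr M model_manifold \<phi> x = (\<lambda>y. \<phi> (inv_into V \<psi> y))"
    using V by (simp add: fun_eq_iff chart_expr_model_manifold)
  moreover have "mtop (model_manifold :: ('b, 'b) manifold) = euclidean"
    by (simp add: model_manifold_def)
  ultimately show ?thesis
    using ch charted_at_model_manifold V by (simp add: mdiff_at_def flip: open_openin)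
qed

text \<open>The transition map now runs from the given chart to the preferred one.\<close>

lemma mdiff_at_inv_chart:
  assumes "smooth_manifold M" "(U, \<phi>) \<in> atlas M" "x \<in> U"
  shows "mdiff_at model_manifold M (inv_into U \<phi>) (\<phi> x)"
proof -
  note U = smooth_manifold_is_chart[OF assms(1,2)]
  have inv: "inv_into U \<phi> (\<phi> p) = p" if "p \<in> U" for p
    using is_chart_inj_on[OF U] that by simp
  have ch: "charted_at M x"
    using smooth_manifold_charted_at[OF assms(1)] smooth_manifold_chart_subset_points[OF assms(1,2)]
      assms(3) by blast
  obtain V \<psi> where V: "chart_at M x = (V, \<psi>)"
    by fastforce
  have "smooth_on (\<phi> ` (U \<inter> V)) (\<lambda>y. \<psi> (inv_into U \<phi> y))"
    using ch V assms unfolding charted_at_def by (intro smooth_manifold_transition[OF assms(1)]) auto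
  moreover have "\<phi> x \<in> \<phi> ` (U \<inter> V)"
    using charted_at_self[OF ch] V assms(3) by auto
  ultimately have "(\<lambda>y. \<psi> (inv_into U \<phi> y)) differentiable (at (\<phi> x))"
    by (rule smooth_on_imp_differentiable)
  moreover have "\<exists>S. open S \<and> \<phi> x \<in> S \<and> inv_into U \<phi> ` S \<subseteq> W" if "openin (mtop M) W" "x \<in> W" for W
    using is_chart_open_image[OF U that(1)] that(2) assms(3) inv
    by (intro exI[of _ "\<phi> ` (U \<inter> W)"]) auto
  moreover have "chart_expr model_manifold M (inv_into U \<phi>) (\<phi> x) = (\<lambda>y. \<psi> (inv_into U \<phi> y))"
    using V inv[OF assms(3)] by (simp add: fun_eq_iff chart_expr_model_manifold)
  moreover have "snd (chart_at model_manifold (\<phi> x)) (\<phi> x) = \<phi> x" "mtop (model_manifold :: ('b, 'b) manifold) = euclidean"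
    by (simp_all add: model_manifold_def)
  ultimately show ?thesis
    using ch charted_at_model_manifold inv[OF assms(3)]
    by (simp add: mdiff_at_def flip: open_openin)
qed

lemma mdiff_at_model_has_derivative:
  assumes "mdiff_at model_manifold model_manifold f y"
  shows "(f has_derivative blinfun_apply (differential model_manifold model_manifold f y)) (at y)"
proof -
  have "chart_expr model_manifold model_manifold f y = f"
    by (simp add: fun_eq_iff chart_expr_def model_manifold_def)
  moreover have "snd (chart_at model_manifold y) y = y"
    by (simp add: model_manifold_def)
  ultimately show ?thesis
    using mdiff_at_has_derivative[OF assms] by simp
qed

text \<open>The chain rule is applied to the two composites, each of which is the identity near the
  point. This gives the fibrewise isomorphism between the tangent space in its preferred
  identification and its coordinates in a fixed chart.\<close>

lemma differential_chart_inverse: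
  assumes "smooth_manifold M" "(U, \<phi>) \<in> atlas M" "x \<in> U"
  defines "A \<equiv> differential M model_manifold \<phi> x"
    and "A' \<equiv> differential model_manifold M (inv_into U \<phi>) (\<phi> x)"
  shows "A' o\<^sub>L A = id_blinfun" "A o\<^sub>L A' = id_blinfun"
proof -
  note U = smooth_manifold_is_chart[OF assms(1,2)]
  have inv: "inv_into U \<phi> (\<phi> p) = p" if "p \<in> U" for p
    using is_chart_inj_on[OF U] that by simp
  have ch: "charted_at M x"
    using smooth_manifold_charted_at[OF assms(1)] smooth_manifold_chart_subset_points[OF assms(1,2)]
      assms(3) by blast
  have Uopen: "openin (mtop M) U" "openin (mtop (model_manifold :: ('b, 'b) manifold)) (\<phi> ` U)"
    using U by (auto simp: is_chart_def model_manifold_def simp flip: open_openin)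
  note d = mdiff_at_chart[OF assms(1-3)] and d' = mdiff_at_inv_chart[OF assms(1-3)]
  have "differential M M (\<lambda>p. inv_into U \<phi> (\<phi> p)) x = differential M M (\<lambda>p. p) x"
    by (rule mdiff_at_cong(2)[OF mdiff_at_ident(1)[OF ch] Uopen(1) assms(3)]) (simp add: inv)
  then show "A' o\<^sub>L A = id_blinfun"
    unfolding A_def A'_def mdiff_at_comp(2)[OF d d', symmetric] by (simp add: mdiff_at_ident(2)[OF ch])
  have d2: "mdiff_at M model_manifold \<phi> (inv_into U \<phi> (\<phi> x))"
    using d by (simp add: inv[OF assms(3)])
  have "differential model_manifold model_manifold (\<lambda>y. \<phi> (inv_into U \<phi> y)) (\<phi> x) =
      differential model_manifold model_manifold (\<lambda>p. p) (\<phi> x)"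
    by (rule mdiff_at_cong(2)[OF mdiff_at_ident(1)[OF charted_at_model_manifold] Uopen(2)])
       (use assms(3) inv in auto)
  then show "A o\<^sub>L A' = id_blinfun"
    using mdiff_at_comp(2)[OF d' d2]
    by (simp add: A_def A'_def inv[OF assms(3)] mdiff_at_ident(2)[OF charted_at_model_manifold])
qed

section \<open>Slices of a product and partial differentials\<close>

lemma mdiff_at_Pair_left:
  fixes M :: "('a, 'e::real_normed_vector) manifold" and N :: "('b, 'f::real_normed_vector) manifold"
  assumes "charted_at M x" "charted_at N y"
  shows "mdiff_at M (prod_manifold M N) (\<lambda>p. (p, y)) x"
    "differential M (prod_manifold M N) (\<lambda>p. (p, y)) x = Blinfun (\<lambda>u. (u, 0))"
proof -
  have "bounded_linear (\<lambda>u::'e. (u, 0::'f))"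
    by (intro bounded_linear_Pair bounded_linear_ident bounded_linear_zero)
  then have I: "blinfun_apply (Blinfun (\<lambda>u::'e. (u, 0::'f))) = (\<lambda>u. (u, 0))"
    by (rule bounded_linear_Blinfun_apply)
  have "((\<lambda>z. (z, snd (chart_at N y) y)) has_derivative (\<lambda>u. (u, 0))) (at (snd (chart_at M x) x))"
    by (intro has_derivative_Pair has_derivative_ident has_derivative_const)
  then have "(chart_expr M (prod_manifold M N) (\<lambda>p. (p, y)) x has_derivative (\<lambda>u. (u, 0)))
      (at (snd (chart_at M x) x))"
    using charted_at_open_image[OF assms(1) charted_at_openin[OF assms(1)] charted_at_self[OF assms(1)]]
    by (rule has_derivative_transform_within_open)
       (auto simp: chart_expr_def prod_manifold_def charted_at_inv_into[OF assms(1)])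
  moreover have "\<exists>U. openin (mtop M) U \<and> x \<in> U \<and> (\<lambda>p. (p, y)) ` U \<subseteq> V"
    if V: "openin (mtop (prod_manifold M N)) V" "(x, y) \<in> V" for V
  proof -
    have "openin (prod_topology (mtop M) (mtop N)) V"
      using V(1) by (simp add: prod_manifold_def)
    then obtain S T where "openin (mtop M) S" "openin (mtop N) T" "x \<in> S" "y \<in> T" "S \<times> T \<subseteq> V"
      using V(2) unfolding openin_prod_topology_alt by metis
    then show ?thesis
      by blast
  qed
  ultimately show "mdiff_at M (prod_manifold M N) (\<lambda>p. (p, y)) x"
    "differential M (prod_manifold M N) (\<lambda>p. (p, y)) x = Blinfun (\<lambda>u. (u, 0))"
    using mdiff_atI[of M x "prod_manifold M N" "\<lambda>p. (p, y)" "Blinfun (\<lambda>u. (u, 0))"]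
      charted_at_prod_manifold[OF assms] assms(1) unfolding I by blast+
qed

lemma mdiff_at_Pair_right:
  fixes M :: "('a, 'e::real_normed_vector) manifold" and N :: "('b, 'f::real_normed_vector) manifold"
  assumes "charted_at M x" "charted_at N y"
  shows "mdiff_at N (prod_manifold M N) (\<lambda>p. (x, p)) y"
    "differential N (prod_manifold M N) (\<lambda>p. (x, p)) y = Blinfun (\<lambda>u. (0, u))"
proof -
  have "bounded_linear (\<lambda>u::'f. (0::'e, u))"
    by (intro bounded_linear_Pair bounded_linear_ident bounded_linear_zero)
  then have I: "blinfun_apply (Blinfun (\<lambda>u::'f. (0::'e, u))) = (\<lambda>u. (0, u))"
    by (rule bounded_linear_Blinfun_apply)
  have "((\<lambda>z. (snd (chart_at M x) x, z)) has_derivative (\<lambda>u. (0, u))) (at (snd (chart_at N y) y))"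
    by (intro has_derivative_Pair has_derivative_ident has_derivative_const)
  then have "(chart_expr N (prod_manifold M N) (\<lambda>p. (x, p)) y has_derivative (\<lambda>u. (0, u)))
      (at (snd (chart_at N y) y))"
    using charted_at_open_image[OF assms(2) charted_at_openin[OF assms(2)] charted_at_self[OF assms(2)]]
    by (rule has_derivative_transform_within_open)
       (auto simp: chart_expr_def prod_manifold_def charted_at_inv_into[OF assms(2)])
  moreover have "\<exists>U. openin (mtop N) U \<and> y \<in> U \<and> (\<lambda>p. (x, p)) ` U \<subseteq> V"
    if V: "openin (mtop (prod_manifold M N)) V" "(x, y) \<in> V" for V
  proof -
    have "openin (prod_topology (mtop M) (mtop N)) V"
      using V(1) by (simp add: prod_manifold_def)
    then obtain S T where "openin (mtop M) S" "openin (mtop N) T" "x \<in> S" "y \<in> T" "S \<times> T \<subseteq> V"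
      using V(2) unfolding openin_prod_topology_alt by metis
    then show ?thesis
      by blast
  qed
  ultimately show "mdiff_at N (prod_manifold M N) (\<lambda>p. (x, p)) y"
    "differential N (prod_manifold M N) (\<lambda>p. (x, p)) y = Blinfun (\<lambda>u. (0, u))"
    using mdiff_atI[of N y "prod_manifold M N" "\<lambda>p. (x, p)" "Blinfun (\<lambda>u. (0, u))"]
      charted_at_prod_manifold[OF assms] assms(2) unfolding I by blast+
qed

text \<open>The two constant injections are those in \<open>prod_bivector_field\<close>. Composing
  with them turns a Poisson condition on a product into one on the partial differentials.\<close>

lemma mdiff_at_partial:
  assumes "charted_at M x" "charted_at N y" "mdiff_at (prod_manifold M N) P (\<lambda>(p, q). f p q) (x, y)"
  shows "mdiff_at M P (\<lambda>p. f p y) x" "mdiff_at N P (f x) y"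
    and "differential (prod_manifold M N) P (\<lambda>(p, q). f p q) (x, y) o\<^sub>L Blinfun (\<lambda>u. (u, 0)) =
      differential M P (\<lambda>p. f p y) x"
    and "differential (prod_manifold M N) P (\<lambda>(p, q). f p q) (x, y) o\<^sub>L Blinfun (\<lambda>u. (0, u)) =
      differential N P (f x) y"
  using mdiff_at_comp[OF mdiff_at_Pair_left(1)[OF assms(1,2)] assms(3)]
    mdiff_at_comp[OF mdiff_at_Pair_right(1)[OF assms(1,2)] assms(3)]
    mdiff_at_Pair_left(2)[OF assms(1,2)] mdiff_at_Pair_right(2)[OF assms(1,2)]
  by simp_all

subsection \<open>Translation along an orbit\<close>

lemma range_blinfun_compose_surj:
  assumes "surj (blinfun_apply g)"
  shows "range (blinfun_apply (f o\<^sub>L g)) = range (blinfun_apply f)"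
proof -
  have "blinfun_apply (f o\<^sub>L g) = blinfun_apply f \<circ> blinfun_apply g"
    by (simp add: fun_eq_iff)
  then show ?thesis
    using assms by (simp only: image_comp[symmetric])
qed

locale poisson_orbit =
  fixes G :: "('g, 'z) monoid_scheme"
    and L :: "('g, 'k::fin_dim_inner) manifold"
    and \<pi>G :: "'g \<Rightarrow> 'k bivector"
    and M :: "('a, 'm::fin_dim_inner) manifold"
    and \<pi>M :: "'a \<Rightarrow> 'm bivector"
    and \<alpha> :: "'g \<Rightarrow> 'a \<Rightarrow> 'a"
    and X :: "('a, 'x::fin_dim_inner) manifold"
  assumes lie: "poisson_lie_group G L \<pi>G"
    and poisson: "poisson_manifold M \<pi>M"
    and action: "poisson_action G L \<pi>G M \<pi>M \<alpha>"
    and orbit: "orbit_manifold G L \<alpha> M X"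
begin

sublocale group_action G "points M" \<alpha>
  using action by (simp add: poisson_action_def)

sublocale group G
  using group_hom by (simp add: group_hom_def)

lemma smooth_L: "smooth_manifold L" and points_L: "points L = carrier G"
  and smooth_M: "smooth_manifold M" and smooth_X: "smooth_manifold X"
  and smooth_bivector_M: "smooth_bivector_field M \<pi>M" and smooth_bivector_L: "smooth_bivector_field L \<pi>G"
  using lie poisson orbit
  by (auto simp: poisson_lie_group_def lie_group_def poisson_manifold_def orbit_manifold_def)

lemma bivector_G: "g \<in> carrier G \<Longrightarrow> is_bivector (\<pi>G g)"
  and bivector_M: "x \<in> points M \<Longrightarrow> is_bivector (\<pi>M x)"
  using smooth_bivector_L smooth_bivector_M points_L unfolding smooth_bivector_field_def by blast+

lemma charted_L: "g \<in> carrier G \<Longrightarrow> charted_at L g"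
  and charted_M: "x \<in> points M \<Longrightarrow> charted_at M x"
  and charted_X: "x \<in> points X \<Longrightarrow> charted_at X x"
  by (rule smooth_manifold_charted_at[OF smooth_L] smooth_manifold_charted_at[OF smooth_M]
      smooth_manifold_charted_at[OF smooth_X]; simp add: points_L)+

lemma ex_base_point:
  obtains x0 where "x0 \<in> points M" "points X = orbit G \<alpha> x0" "submersion L X (\<lambda>g. \<alpha> g x0)"
  using orbit by (auto simp: orbit_manifold_def)

lemma act_closed: "g \<in> carrier G \<Longrightarrow> x \<in> points M \<Longrightarrow> \<alpha> g x \<in> points M"
  using element_image by blast

lemma points_X_subset: "points X \<subseteq> points M"
proof -
  obtain x0 where "x0 \<in> points M" "points X = orbit G \<alpha> x0"
    by (rule ex_base_point)
  then show ?thesis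
    using act_closed by (auto simp: orbit_def)
qed

lemma points_X_transitive:
  assumes "x \<in> points X" "y \<in> points X"
  shows "\<exists>k\<in>carrier G. y = \<alpha> k x"
proof -
  obtain x0 where x0: "x0 \<in> points M" "points X = orbit G \<alpha> x0"
    by (rule ex_base_point)
  obtain g h where g: "g \<in> carrier G" "x = \<alpha> g x0" and h: "h \<in> carrier G" "y = \<alpha> h x0"
    using assms x0 by (auto simp: orbit_def)
  have "\<alpha> (h \<otimes>\<^bsub>G\<^esub> inv\<^bsub>G\<^esub> g) x = \<alpha> h (\<alpha> (inv\<^bsub>G\<^esub> g) x)"
    using assms(1) points_X_subset g(1) h(1) by (intro composition_rule) auto
  also have "\<alpha> (inv\<^bsub>G\<^esub> g) x = x0"
    using orbit_sym_aux g x0(1) by blast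
  finally show ?thesis
    using g(1) h by (intro bexI[of _ "h \<otimes>\<^bsub>G\<^esub> inv\<^bsub>G\<^esub> g"]) auto
qed

section \<open>Differentials of the action, of the multiplication and of the inclusion\<close>

lemma mdiff_act:
  assumes "g \<in> carrier G" "x \<in> points M"
  shows "mdiff_at (prod_manifold L M) M (\<lambda>(g, x). \<alpha> g x) (g, x)"
  using assms action act_closed
  by (intro smooth_map_mdiff_at charted_at_prod_manifold)
     (auto simp: poisson_action_def poisson_map_def charted_L charted_M)

lemma mdiff_mult:
  assumes "g \<in> carrier G" "h \<in> carrier G"
  shows "mdiff_at (prod_manifold L L) L (\<lambda>(g, h). g \<otimes>\<^bsub>G\<^esub> h) (g, h)"
  using assms lie
  by (intro smooth_map_mdiff_at charted_at_prod_manifold)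
     (auto simp: poisson_lie_group_def lie_group_def charted_L)

lemma mdiff_act_partial:
  assumes "g \<in> carrier G" "x \<in> points M"
  shows "mdiff_at M M (\<alpha> g) x"
    "differential (prod_manifold L M) M (\<lambda>(g, x). \<alpha> g x) (g, x) o\<^sub>L Blinfun (\<lambda>u. (u, 0)) =
      differential L M (\<lambda>g. \<alpha> g x) g"
    "differential (prod_manifold L M) M (\<lambda>(g, x). \<alpha> g x) (g, x) o\<^sub>L Blinfun (\<lambda>u. (0, u)) =
      differential M M (\<alpha> g) x"
  using mdiff_at_partial[OF charted_L[OF assms(1)] charted_M[OF assms(2)] mdiff_act[OF assms]] by blast+

lemma mdiff_mult_partial:
  assumes "g \<in> carrier G" "h \<in> carrier G"
  shows "mdiff_at L L (\<lambda>p. p \<otimes>\<^bsub>G\<^esub> h) g" "mdiff_at L L (\<lambda>p. g \<otimes>\<^bsub>G\<^esub> p) h"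
  using mdiff_at_partial[OF charted_L[OF assms(1)] charted_L[OF assms(2)] mdiff_mult[OF assms]] by blast+

lemma mdiff_inclusion: "x \<in> points X \<Longrightarrow> mdiff_at X M id x"
  using orbit points_X_subset
  by (intro smooth_map_mdiff_at) (auto simp: orbit_manifold_def immersion_def charted_M charted_X)

lemma openin_carrier: "openin (mtop L) (carrier G)"
  using points_L by (simp add: points_def flip: points_L)

text \<open>The orbit map into M factors through X, where it is a submersion; precomposing the
  differential of the inclusion with a surjection does not change its range.\<close>

lemma orbit_map_range:
  assumes "x0 \<in> points M" "points X = orbit G \<alpha> x0" "submersion L X (\<lambda>g. \<alpha> g x0)" "g \<in> carrier G"
  shows "mdiff_at L M (\<lambda>g. \<alpha> g x0) g"
    "range (blinfun_apply (differential L M (\<lambda>g. \<alpha> g x0) g)) = tangent_subspace X M (\<alpha> g x0)"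
proof -
  have x: "\<alpha> g x0 \<in> points X"
    using assms by (auto simp: orbit_def)
  have d: "mdiff_at L X (\<lambda>g. \<alpha> g x0) g"
    using assms x by (intro smooth_map_mdiff_at charted_L charted_X) (auto simp: submersion_def)
  note comp = mdiff_at_comp[OF d mdiff_inclusion[OF x], unfolded id_apply]
  show "mdiff_at L M (\<lambda>g. \<alpha> g x0) g"
    by (rule comp(1))
  have "surj (blinfun_apply (differential L X (\<lambda>g. \<alpha> g x0) g))"
    using assms points_L by (auto simp: submersion_def)
  then show "range (blinfun_apply (differential L M (\<lambda>g. \<alpha> g x0) g)) = tangent_subspace X M (\<alpha> g x0)"
    unfolding comp(2) tangent_subspace_def id_def by (rule range_blinfun_compose_surj)
qed

text \<open>All orbit maps are reduced to the one at the base point x0. Translation by k after it is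
  the same map after left multiplication by k; the orbit map at \<open>\<alpha> g x0\<close> is the
  same map after right multiplication by g. Differentiating puts both images into ranges of
  differentials of the base orbit map.\<close>

lemma translation_tangent:
  assumes k: "k \<in> carrier G" and x: "x \<in> points X"
  shows "blinfun_apply (differential M M (\<alpha> k) x) ` tangent_subspace X M x \<subseteq> tangent_subspace X M (\<alpha> k x)"
    and "range (blinfun_apply (differential L M (\<lambda>g. \<alpha> g x) k)) \<subseteq> tangent_subspace X M (\<alpha> k x)"
proof -
  obtain x0 where x0: "x0 \<in> points M" "points X = orbit G \<alpha> x0" "submersion L X (\<lambda>g. \<alpha> g x0)"
    by (rule ex_base_point)
  obtain g where g: "g \<in> carrier G" and xg: "x = \<alpha> g x0"
    using x x0 by (auto simp: orbit_def)
  have xM: "\<alpha> g x0 \<in> points M"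
    using act_closed g x0(1) by blast
  have kg: "k \<otimes>\<^bsub>G\<^esub> g \<in> carrier G" "\<alpha> (k \<otimes>\<^bsub>G\<^esub> g) x0 = \<alpha> k (\<alpha> g x0)"
    using k g composition_rule[OF x0(1) k g] by auto
  note orb = orbit_map_range[OF x0]
  note left = mdiff_at_comp[OF mdiff_mult_partial(2)[OF k g] orb(1)[OF kg(1)]]
  \<comment> \<open>The action law holds for group elements only, and the carrier is an open set on
    which the two maps agree.\<close>
  have "differential L M (\<lambda>h. \<alpha> k (\<alpha> h x0)) g = differential L M (\<lambda>h. \<alpha> (k \<otimes>\<^bsub>G\<^esub> h) x0) g"
    by (rule mdiff_at_cong(2)[OF left(1) openin_carrier g]) (simp add: composition_rule x0(1) k)
  then have eq: "differential M M (\<alpha> k) (\<alpha> g x0) o\<^sub>L differential L M (\<lambda>h. \<alpha> h x0) g =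
      differential L M (\<lambda>h. \<alpha> h x0) (k \<otimes>\<^bsub>G\<^esub> g) o\<^sub>L differential L L (\<lambda>h. k \<otimes>\<^bsub>G\<^esub> h) g"
    using mdiff_at_comp(2)[OF orb(1)[OF g] mdiff_act_partial(1)[OF k xM]] left(2) by simp
  show "blinfun_apply (differential M M (\<alpha> k) x) ` tangent_subspace X M x \<subseteq> tangent_subspace X M (\<alpha> k x)"
  proof (rule image_subsetI)
    fix u assume "u \<in> tangent_subspace X M x"
    then obtain w where "u = blinfun_apply (differential L M (\<lambda>h. \<alpha> h x0) g) w"
      unfolding xg orb(2)[OF g, symmetric] by blast
    then have "blinfun_apply (differential M M (\<alpha> k) x) u =
        blinfun_apply (differential M M (\<alpha> k) (\<alpha> g x0) o\<^sub>L differential L M (\<lambda>h. \<alpha> h x0) g) w"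
      by (simp add: xg)
    also have "\<dots> \<in> range (blinfun_apply (differential L M (\<lambda>h. \<alpha> h x0) (k \<otimes>\<^bsub>G\<^esub> g)))"
      unfolding eq by simp
    finally show "blinfun_apply (differential M M (\<alpha> k) x) u \<in> tangent_subspace X M (\<alpha> k x)"
      unfolding orb(2)[OF kg(1)] kg(2) xg .
  qed
  note right = mdiff_at_comp[OF mdiff_mult_partial(1)[OF k g] orb(1)[OF kg(1)]]
  have "differential L M (\<lambda>h. \<alpha> h (\<alpha> g x0)) k = differential L M (\<lambda>h. \<alpha> (h \<otimes>\<^bsub>G\<^esub> g) x0) k"
    by (rule mdiff_at_cong(2)[OF right(1) openin_carrier k]) (simp add: composition_rule x0(1) g)
  then have "range (blinfun_apply (differential L M (\<lambda>h. \<alpha> h (\<alpha> g x0)) k)) \<subseteq>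
      range (blinfun_apply (differential L M (\<lambda>h. \<alpha> h x0) (k \<otimes>\<^bsub>G\<^esub> g)))"
    unfolding right(2) by auto
  then show "range (blinfun_apply (differential L M (\<lambda>g. \<alpha> g x) k)) \<subseteq> tangent_subspace X M (\<alpha> k x)"
    unfolding orb(2)[OF kg(1)] kg(2) xg .
qed

text \<open>Multiplicativity of the action map writes \<open>\<pi>M\<close> at \<open>\<alpha> k x\<close> as a sum of push-forwards of \<open>\<pi>G\<close> and
  \<open>\<pi>M\<close>; covectors conormal to the orbit do not see the first one, as the orbit map
  is tangent to the orbit.\<close>

lemma sharp_conormal_translation:
  assumes k: "k \<in> carrier G" and x: "x \<in> points X" and \<xi>: "\<xi> \<in> conormal_space X M (\<alpha> k x)"
  defines "C \<equiv> differential M M (\<alpha> k) x"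
  shows "sharp (\<pi>M (\<alpha> k x)) \<xi> = blinfun_apply C (sharp (\<pi>M x) (\<xi> o\<^sub>L C))"
proof (rule covectors_separate)
  fix \<eta> :: "'m \<Rightarrow>\<^sub>L real"
  have xM: "x \<in> points M" "\<alpha> k x \<in> points M"
    using x points_X_subset act_closed[OF k] by auto
  let ?D = "differential (prod_manifold L M) M (\<lambda>(g, x). \<alpha> g x) (k, x)"
  let ?B = "differential L M (\<lambda>g. \<alpha> g x) k"
  have assoc: "(\<zeta> o\<^sub>L ?D) o\<^sub>L i = \<zeta> o\<^sub>L (?D o\<^sub>L i)" for \<zeta> :: "'m \<Rightarrow>\<^sub>L real" and i :: "'n::real_normed_vector \<Rightarrow>\<^sub>L ('k \<times> 'm)"
    by (rule blinfun_eqI) simp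
  have "(k, x) \<in> points (prod_manifold L M)"
    using k xM points_L by (simp add: points_def prod_manifold_def)
  then have "\<pi>M (\<alpha> k x) \<xi> \<eta> = prod_bivector_field \<pi>G \<pi>M (k, x) (\<xi> o\<^sub>L ?D) (\<eta> o\<^sub>L ?D)"
    using action unfolding poisson_action_def poisson_map_def by fastforce
  also have "\<dots> = \<pi>G k (\<xi> o\<^sub>L ?B) (\<eta> o\<^sub>L ?B) + \<pi>M x (\<xi> o\<^sub>L C) (\<eta> o\<^sub>L C)"
    unfolding prod_bivector_field_def Let_def prod.case assoc C_def
      mdiff_act_partial(2,3)[OF k xM(1)] ..
  also have "\<xi> o\<^sub>L ?B = 0"
    using \<xi> translation_tangent(2)[OF k x]
    by (auto simp: conormal_space_def subset_iff intro!: blinfun_eqI)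
  also have "\<pi>G k 0 (\<eta> o\<^sub>L ?B) = 0"
    using linear_0[OF is_bivector_linear(2)[OF bivector_G[OF k]]] .
  finally have "\<pi>M (\<alpha> k x) \<xi> \<eta> = \<pi>M x (\<xi> o\<^sub>L C) (\<eta> o\<^sub>L C)"
    by simp
  then show "blinfun_apply \<eta> (sharp (\<pi>M (\<alpha> k x)) \<xi>) = blinfun_apply \<eta> (blinfun_apply C (sharp (\<pi>M x) (\<xi> o\<^sub>L C)))"
    using sharp[OF bivector_M[OF xM(1)], of "\<eta> o\<^sub>L C"] by (simp add: sharp[OF bivector_M[OF xM(2)]])
qed

definition sharp_conormal :: "'a \<Rightarrow> 'm set"
  where "sharp_conormal x = sharp (\<pi>M x) ` conormal_space X M x"

text \<open>Translation maps tangent spaces of the orbit into tangent spaces, so pulling back along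
  it preserves conormality. The reverse inclusion is obtained later from the inverse
  translation.\<close>

lemma sharp_conormal_translation_subset:
  assumes k: "k \<in> carrier G" and x: "x \<in> points X"
  shows "sharp_conormal (\<alpha> k x) \<subseteq> blinfun_apply (differential M M (\<alpha> k) x) ` sharp_conormal x"
proof
  fix v assume "v \<in> sharp_conormal (\<alpha> k x)"
  then obtain \<xi> where \<xi>: "\<xi> \<in> conormal_space X M (\<alpha> k x)" "v = sharp (\<pi>M (\<alpha> k x)) \<xi>"
    by (auto simp: sharp_conormal_def)
  have "\<xi> o\<^sub>L differential M M (\<alpha> k) x \<in> conormal_space X M x"
    using \<xi>(1) translation_tangent(1)[OF k x] by (auto simp: conormal_space_def image_subset_iff)
  then show "v \<in> blinfun_apply (differential M M (\<alpha> k) x) ` sharp_conormal x"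
    using sharp_conormal_translation[OF k x \<xi>(1)] \<xi>(2) by (auto simp: sharp_conormal_def)
qed

lemma translation_inverse:
  assumes k: "k \<in> carrier G" and x: "x \<in> points M"
  shows "differential M M (\<alpha> (inv\<^bsub>G\<^esub> k)) (\<alpha> k x) o\<^sub>L differential M M (\<alpha> k) x = id_blinfun"
proof -
  have k': "inv\<^bsub>G\<^esub> k \<in> carrier G" and y: "\<alpha> k x \<in> points M"
    using k act_closed[OF k x] by auto
  have "differential M M (\<lambda>p. \<alpha> (inv\<^bsub>G\<^esub> k) (\<alpha> k p)) x = differential M M (\<lambda>p. p) x"
  proof (rule mdiff_at_cong(2)[OF mdiff_at_ident(1)[OF charted_M[OF x]]])
    show "openin (mtop M) (points M)"
      by (simp add: points_def)
  qed (use orbit_sym_aux[OF k] x in auto)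
  then show ?thesis
    using mdiff_at_comp(2)[OF mdiff_act_partial(1)[OF k x] mdiff_act_partial(1)[OF k' y]]
    by (simp add: mdiff_at_ident(2)[OF charted_M[OF x]])
qed

text \<open>Tangent vectors are pushed forward and covectors pulled back, so the two inclusions
  known for k point in opposite directions. The same inclusions for the inverse of k, whose
  differential is a two-sided inverse, turn both into equalities.\<close>

lemma orbit_translation:
  assumes "x \<in> points X" "y \<in> points X"
  obtains C where "linear C" "inj C" "C ` tangent_subspace X M x = tangent_subspace X M y"
    "C ` sharp_conormal x = sharp_conormal y"
proof -
  obtain k where k: "k \<in> carrier G" and y: "y = \<alpha> k x"
    using points_X_transitive[OF assms] by blast
  have k': "inv\<^bsub>G\<^esub> k \<in> carrier G"
    using k by simp
  have x: "x \<in> points M" and yM: "y \<in> points M"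
    using assms points_X_subset by auto
  have inv_y: "\<alpha> (inv\<^bsub>G\<^esub> k) y = x"
    using orbit_sym_aux[OF k x] y by simp
  define C where "C = blinfun_apply (differential M M (\<alpha> k) x)"
  define C' where "C' = blinfun_apply (differential M M (\<alpha> (inv\<^bsub>G\<^esub> k)) y)"
  have left_inv: "C' (C u) = u" and right_inv: "C (C' u) = u" for u
    using translation_inverse[OF k x] translation_inverse[OF k' yM] k
    unfolding inv_y y[symmetric] C_def C'_def
    by (simp_all add: inv_inv flip: blinfun_apply_blinfun_compose)
  have sub: "C ` tangent_subspace X M x \<subseteq> tangent_subspace X M y" "sharp_conormal y \<subseteq> C ` sharp_conormal x"
    using translation_tangent(1)[OF k assms(1)] sharp_conormal_translation_subset[OF k assms(1)]
    by (simp_all add: C_def y)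
  have sub': "C' ` tangent_subspace X M y \<subseteq> tangent_subspace X M x" "sharp_conormal x \<subseteq> C' ` sharp_conormal y"
    using translation_tangent(1)[OF k' assms(2)] sharp_conormal_translation_subset[OF k' assms(2)]
    by (simp_all add: C'_def inv_y)
  show thesis
  proof
    show "linear C"
      by (simp add: C_def bounded_linear.linear blinfun.bounded_linear_right)
    show "inj C"
      using left_inv by (rule inj_on_inverseI)
    show "C ` tangent_subspace X M x = tangent_subspace X M y"
    proof
      show "tangent_subspace X M y \<subseteq> C ` tangent_subspace X M x"
        using sub'(1) right_inv by (metis image_eqI image_subset_iff subsetI)
    qed (rule sub(1))
    show "C ` sharp_conormal x = sharp_conormal y"
    proof
      show "C ` sharp_conormal x \<subseteq> sharp_conormal y"
        using sub'(2) right_inv by (auto simp: subset_iff image_iff)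
    qed (rule sub(2))
  qed
qed

end

section \<open>Transport of bivectors and of sums of subspaces by linear maps\<close>

lemma is_bivector_pullback:
  assumes "is_bivector P"
  shows "is_bivector (\<lambda>a b. P (a o\<^sub>L A) (b o\<^sub>L A))"
proof -
  have comp: "linear (\<lambda>a. a o\<^sub>L A)"
    by (rule bounded_linear.linear[OF bounded_bilinear.bounded_linear_left[OF bounded_bilinear_blinfun_compose]])
  have "linear (\<lambda>b. P (a o\<^sub>L A) (b o\<^sub>L A))" "linear (\<lambda>a. P (a o\<^sub>L A) (b o\<^sub>L A))" for a b
    using linear_compose[OF comp is_bivector_linear(1)[OF assms]]
      linear_compose[OF comp is_bivector_linear(2)[OF assms]] by (simp_all add: comp_def)
  then show ?thesis
    unfolding is_bivector_def bilinear_def using is_bivector_skew[OF assms] by blast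
qed

lemma linear_image_set_sum:
  assumes "linear l"
  shows "l ` {u + v | u v. u \<in> S \<and> v \<in> T} = {u + v | u v. u \<in> l ` S \<and> v \<in> l ` T}"
proof (rule subset_antisym; rule subsetI)
  fix w assume "w \<in> l ` {u + v | u v. u \<in> S \<and> v \<in> T}"
  then show "w \<in> {u + v | u v. u \<in> l ` S \<and> v \<in> l ` T}"
    using linear_add[OF assms] by auto
next
  fix w assume "w \<in> {u + v | u v. u \<in> l ` S \<and> v \<in> l ` T}"
  then obtain u v where "u \<in> S" "v \<in> T" "w = l (u + v)"
    using linear_add[OF assms] by auto
  then show "w \<in> l ` {u + v | u v. u \<in> S \<and> v \<in> T}"
    by blast
qed

lemma id_blinfun_composeD: "f o\<^sub>L g = id_blinfun \<Longrightarrow> blinfun_apply f (blinfun_apply g u) = u"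
  by (metis blinfun_apply_blinfun_compose blinfun_apply_id_blinfun)

context poisson_orbit
begin

subsection \<open>Adapted frames along an orbit\<close>

lemma continuous_inclusion: "continuous_map (mtop X) (mtop M) id"
  using orbit by (simp add: orbit_manifold_def immersion_def smooth_map_def)

lemma chart_X_subset: "(U, \<phi>) \<in> atlas X \<Longrightarrow> U \<subseteq> points X"
  using smooth_manifold_chart_subset_points[OF smooth_X] .

text \<open>The topology of X may be finer than the one induced by M, so the domain V is pulled back
  along the continuous inclusion.\<close>

lemma openin_chart_Int:
  assumes "(U, \<phi>) \<in> atlas X" "(V, \<psi>) \<in> atlas M"
  shows "openin (mtop X) (U \<inter> V)"
proof -
  have U: "openin (mtop X) U" and V: "openin (mtop M) V"
    using assms smooth_manifold_is_chart smooth_X smooth_M unfolding is_chart_def by blast+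
  have "openin (mtop X) {x \<in> topspace (mtop X). id x \<in> V}"
    using openin_continuous_map_preimage[OF continuous_inclusion V] .
  then have "openin (mtop X) (U \<inter> {x \<in> topspace (mtop X). id x \<in> V})"
    using U by blast
  also have "U \<inter> {x \<in> topspace (mtop X). id x \<in> V} = U \<inter> V"
    using openin_subset[OF U] by auto
  finally show ?thesis .
qed

lemma smooth_inclusion_chart:
  assumes "(U, \<phi>) \<in> atlas X" "(V, \<psi>) \<in> atlas M"
  shows "smooth_on (\<phi> ` (U \<inter> V)) (\<lambda>y. \<psi> (inv_into U \<phi> y))"
proof -
  have "smooth_map X M id"
    using orbit by (simp add: orbit_manifold_def immersion_def)
  then have "smooth_on (\<phi> ` (U \<inter> id -` V)) (\<psi> \<circ> id \<circ> inv_into U \<phi>)"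
    using assms unfolding smooth_map_def by blast
  then show ?thesis
    by (simp add: comp_def)
qed

lemma inv_into_chart_X: "(U, \<phi>) \<in> atlas X \<Longrightarrow> x \<in> U \<Longrightarrow> inv_into U \<phi> (\<phi> x) = x"
  using is_chart_inj_on[OF smooth_manifold_is_chart[OF smooth_X]] by simp

lemma inv_into_chart_M: "(V, \<psi>) \<in> atlas M \<Longrightarrow> x \<in> V \<Longrightarrow> inv_into V \<psi> (\<psi> x) = x"
  using is_chart_inj_on[OF smooth_manifold_is_chart[OF smooth_M]] by simp

text \<open>The chain rule for inverse chart, inclusion and chart. The left side is smooth in the
  coordinate, the right side is built from the differentials in preferred charts, so this is the
  bridge between local smoothness and the pointwise definitions.\<close>

lemma inclusion_derivative:
  assumes U: "(U, \<phi>) \<in> atlas X" "x \<in> U" and V: "(V, \<psi>) \<in> atlas M" "x \<in> V"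
  shows "frechet_derivative (\<lambda>y. \<psi> (inv_into U \<phi> y)) (at (\<phi> x)) =
    blinfun_apply (differential M model_manifold \<psi> x o\<^sub>L
      (differential X M id x o\<^sub>L differential model_manifold X (inv_into U \<phi>) (\<phi> x)))"
proof -
  note inv = inv_into_chart_X[OF U]
  have xX: "x \<in> points X"
    using chart_X_subset U by blast
  have 1: "mdiff_at X M id (inv_into U \<phi> (\<phi> x))"
    unfolding inv by (rule mdiff_inclusion[OF xX])
  note c1 = mdiff_at_comp[OF mdiff_at_inv_chart[OF smooth_X U] 1]
  have id_inv: "id (inv_into U \<phi> (\<phi> x)) = x"
    using inv by simp
  have 2: "mdiff_at M model_manifold \<psi> (id (inv_into U \<phi> (\<phi> x)))"
    unfolding id_inv by (rule mdiff_at_chart[OF smooth_M V])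
  note c2 = mdiff_at_comp[OF c1(1) 2]
  have "((\<lambda>y. \<psi> (id (inv_into U \<phi> y))) has_derivative blinfun_apply
      (differential M model_manifold \<psi> x o\<^sub>L
        (differential X M id x o\<^sub>L differential model_manifold X (inv_into U \<phi>) (\<phi> x)))) (at (\<phi> x))"
    using mdiff_at_model_has_derivative[OF c2(1)] unfolding c2(2) unfolding c1(2) id_inv inv id_apply[of x] .
  from frechet_derivative_at[OF this] show ?thesis
    by simp
qed

lemma inj_differential_inclusion: "x \<in> points X \<Longrightarrow> inj (blinfun_apply (differential X M id x))"
  using orbit by (simp add: orbit_manifold_def immersion_def)

lemma conormal_space_eq_annihilator: "conormal_space X M x = annihilator (tangent_subspace X M x)"
  by (simp add: conormal_space_def annihilator_def)

lemma subspace_tangent: "subspace (tangent_subspace X M x)"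
  unfolding tangent_subspace_def
  by (intro linear_subspace_image subspace_UNIV bounded_linear.linear blinfun.bounded_linear_right)

lemma subspace_sharp_conormal: "x \<in> points M \<Longrightarrow> subspace (sharp_conormal x)"
  unfolding sharp_conormal_def conormal_space_eq_annihilator
  by (intro subspace_sharp_annihilator bivector_M)

text \<open>The restriction of \<open>\<pi>M\<close> to X as a bundle-valued function: the fibre is
  trivialised by the chart \<psi> of M, while the parameter is a coordinate on X.\<close>

definition chart_bivector :: "'a set \<Rightarrow> ('a \<Rightarrow> 'x) \<Rightarrow> ('a \<Rightarrow> 'm) \<Rightarrow> 'x \<Rightarrow> 'm bivector" where
  "chart_bivector U \<phi> \<psi> y = (\<lambda>a b.
     \<pi>M (inv_into U \<phi> y) (a o\<^sub>L differential M model_manifold \<psi> (inv_into U \<phi> y))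
       (b o\<^sub>L differential M model_manifold \<psi> (inv_into U \<phi> y)))"

lemma is_bivector_chart_bivector:
  assumes "(U, \<phi>) \<in> atlas X" "y \<in> \<phi> ` U"
  shows "is_bivector (chart_bivector U \<phi> \<psi> y)"
  using assms chart_X_subset points_X_subset inv_into_into[of y \<phi> U]
  unfolding chart_bivector_def by (intro is_bivector_pullback bivector_M) blast

lemma smooth_chart_bivector:
  assumes "(U, \<phi>) \<in> atlas X" "(V, \<psi>) \<in> atlas M"
  shows "smooth_on (\<phi> ` (U \<inter> V)) (\<lambda>y. chart_bivector U \<phi> \<psi> y a b)"
proof -
  let ?P = "\<lambda>z. \<pi>M (inv_into V \<psi> z) (a o\<^sub>L differential M model_manifold \<psi> (inv_into V \<psi> z))
    (b o\<^sub>L differential M model_manifold \<psi> (inv_into V \<psi> z))"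
  have opn: "open (\<phi> ` (U \<inter> V))"
    using is_chart_open_image[OF smooth_manifold_is_chart[OF smooth_X assms(1)] openin_chart_Int[OF assms]]
    by (simp add: Int_assoc[symmetric])
  have "smooth_on (\<psi> ` V) ?P"
    using smooth_bivector_M assms(2) unfolding smooth_bivector_field_def Let_def by blast
  moreover have "(\<lambda>y. \<psi> (inv_into U \<phi> y)) ` \<phi> ` (U \<inter> V) \<subseteq> \<psi> ` V"
    using inv_into_chart_X[OF assms(1)] by auto
  ultimately have "smooth_on (\<phi> ` (U \<inter> V)) (\<lambda>y. ?P (\<psi> (inv_into U \<phi> y)))"
    using smooth_on_compose[OF opn _ _ smooth_inclusion_chart[OF assms]] by blast
  then show ?thesis
    by (rule smooth_on_cong[OF opn])
       (auto simp: chart_bivector_def inv_into_chart_X[OF assms(1)] inv_into_chart_M[OF assms(2)])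
qed

text \<open>Contraction is natural under the isomorphism A, and composition with A carries covectors
  annihilating the image of A bijectively to conormal covectors. The family treated by
  \<open>local_frame\<close> is thus the coordinate form of \<open>sharp_conormal\<close>, with the
  same rank and transversality.\<close>

lemma sharp_conormal_chart:
  assumes U: "(U, \<phi>) \<in> atlas X" "x \<in> U" and V: "(V, \<psi>) \<in> atlas M" "x \<in> V"
  defines "T \<equiv> frechet_derivative (\<lambda>y. \<psi> (inv_into U \<phi> y)) (at (\<phi> x))"
    and "A \<equiv> blinfun_apply (differential M model_manifold \<psi> x)"
  shows "range T = A ` tangent_subspace X M x"
    and "sharp (chart_bivector U \<phi> \<psi> (\<phi> x)) ` annihilator (range T) = A ` sharp_conormal x"
proof -
  have xM: "x \<in> points M"
    using chart_X_subset points_X_subset U by blast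
  define A' where "A' = differential model_manifold M (inv_into V \<psi>) (\<psi> x)"
  note A_inv = differential_chart_inverse[OF smooth_M V, folded A'_def]
  note B_inv = differential_chart_inverse[OF smooth_X U]
  have "surj (blinfun_apply (differential model_manifold X (inv_into U \<phi>) (\<phi> x)))"
    by (rule surjI[where f = "blinfun_apply (differential X model_manifold \<phi> x)"])
       (rule id_blinfun_composeD[OF B_inv(1)])
  moreover have "range T = A ` blinfun_apply (differential X M id x) `
      range (blinfun_apply (differential model_manifold X (inv_into U \<phi>) (\<phi> x)))"
    unfolding T_def A_def inclusion_derivative[OF U V] by (simp add: image_image)
  ultimately show range_T: "range T = A ` tangent_subspace X M x"
    by (simp add: tangent_subspace_def)
  let ?D = "differential M model_manifold \<psi> x"
  have P: "chart_bivector U \<phi> \<psi> (\<phi> x) a b = \<pi>M x (a o\<^sub>L ?D) (b o\<^sub>L ?D)" for a b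
    by (simp add: chart_bivector_def inv_into_chart_X[OF U])
  have sharp_P: "sharp (chart_bivector U \<phi> \<psi> (\<phi> x)) a = A (sharp (\<pi>M x) (a o\<^sub>L ?D))" for a
  proof (rule covectors_separate)
    fix b :: "'m \<Rightarrow>\<^sub>L real"
    have "blinfun_apply b (sharp (chart_bivector U \<phi> \<psi> (\<phi> x)) a) = \<pi>M x (a o\<^sub>L ?D) (b o\<^sub>L ?D)"
      using sharp[OF is_bivector_chart_bivector[OF U(1)], of "\<phi> x"] U(2) by (simp add: P)
    also have "\<dots> = blinfun_apply b (A (sharp (\<pi>M x) (a o\<^sub>L ?D)))"
      using sharp[OF bivector_M[OF xM], of "b o\<^sub>L ?D"] by (simp add: A_def)
    finally show "blinfun_apply b (sharp (chart_bivector U \<phi> \<psi> (\<phi> x)) a) =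
        blinfun_apply b (A (sharp (\<pi>M x) (a o\<^sub>L ?D)))" .
  qed
  have "(\<lambda>a. a o\<^sub>L ?D) ` annihilator (range T) = conormal_space X M x"
  proof
    show "(\<lambda>a. a o\<^sub>L ?D) ` annihilator (range T) \<subseteq> conormal_space X M x"
      unfolding range_T by (auto simp: annihilator_def conormal_space_def A_def)
    show "conormal_space X M x \<subseteq> (\<lambda>a. a o\<^sub>L ?D) ` annihilator (range T)"
    proof
      fix \<xi> assume \<xi>: "\<xi> \<in> conormal_space X M x"
      have "\<xi> = (\<xi> o\<^sub>L A') o\<^sub>L ?D"
        by (rule blinfun_eqI) (simp add: id_blinfun_composeD[OF A_inv(1)])
      moreover have "\<xi> o\<^sub>L A' \<in> annihilator (range T)"
        using \<xi> unfolding range_T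
        by (auto simp: annihilator_def conormal_space_def A_def id_blinfun_composeD[OF A_inv(1)])
      ultimately show "\<xi> \<in> (\<lambda>a. a o\<^sub>L ?D) ` annihilator (range T)"
        by blast
    qed
  qed
  moreover have "sharp (chart_bivector U \<phi> \<psi> (\<phi> x)) ` annihilator (range T) =
      A ` sharp (\<pi>M x) ` (\<lambda>a. a o\<^sub>L ?D) ` annihilator (range T)"
    by (simp add: image_image sharp_P)
  ultimately show "sharp (chart_bivector U \<phi> \<psi> (\<phi> x)) ` annihilator (range T) = A ` sharp_conormal x"
    by (simp add: sharp_conormal_def)
qed

definition adapted_frame_on ::
    "'a set \<Rightarrow> ('a \<Rightarrow> 'x) \<Rightarrow> ('a \<Rightarrow> 'm) \<Rightarrow> nat \<Rightarrow> 'x set \<Rightarrow> (nat \<Rightarrow> 'x \<Rightarrow> 'm) \<Rightarrow> bool" where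
  "adapted_frame_on N \<phi> \<psi> r W f \<longleftrightarrow> (\<forall>j<r. smooth_on W (f j)) \<and>
     (\<forall>x\<in>N. \<phi> x \<in> W \<longrightarrow>
        inj_on (\<lambda>j. f j (\<phi> x)) {..<r} \<and> independent ((\<lambda>j. f j (\<phi> x)) ` {..<r}) \<and>
        span ((\<lambda>j. f j (\<phi> x)) ` {..<r}) = blinfun_apply (differential M model_manifold \<psi> x) `
          {u + v | u v. u \<in> tangent_subspace X M x \<and> v \<in> sharp_conormal x})"

text \<open>\<nu> a extends the covector field with constant components a in the chart \<phi> from
  TX to TM along X, by 0 on \<open>sharp_conormal\<close>. Constant components are what
  \<open>smooth_bivector_field\<close> tests.\<close>

definition covector_lift_on ::
    "'a set \<Rightarrow> ('a \<Rightarrow> 'x) \<Rightarrow> ('a \<Rightarrow> 'm) \<Rightarrow> 'x set \<Rightarrow> (('x \<Rightarrow>\<^sub>L real) \<Rightarrow> 'x \<Rightarrow> 'm \<Rightarrow>\<^sub>L real) \<Rightarrow> bool" where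
  "covector_lift_on N \<phi> \<psi> W \<nu> \<longleftrightarrow> (\<forall>a. smooth_on W (\<nu> a)) \<and>
     (\<forall>a. \<forall>x\<in>N. \<phi> x \<in> W \<longrightarrow>
        (\<nu> a (\<phi> x) o\<^sub>L differential M model_manifold \<psi> x) o\<^sub>L differential X M id x =
          a o\<^sub>L differential X model_manifold \<phi> x \<and>
        (\<forall>v\<in>sharp_conormal x. blinfun_apply (\<nu> a (\<phi> x) o\<^sub>L differential M model_manifold \<psi> x) v = 0))"

text \<open>One application of \<open>local_frame\<close> in a pair of charts supplies both outputs:
  the frame serves the subbundle in (i), the lifts serve the smoothness of the bivector in
  (ii).\<close>

lemma ex_adapted_frame:
  assumes transversal: "\<And>x. x \<in> points X \<Longrightarrow> sharp_conormal x \<inter> tangent_subspace X M x = {0}"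
    and rank: "\<And>x. x \<in> points X \<Longrightarrow> dim (sharp_conormal x) = k"
    and U: "(U, \<phi>) \<in> atlas X" "p \<in> U" and V: "(V, \<psi>) \<in> atlas M" "p \<in> V"
  obtains W f \<nu> where "open W" "\<phi> p \<in> W" "W \<subseteq> \<phi> ` (U \<inter> V)"
    "adapted_frame_on (U \<inter> V) \<phi> \<psi> (card (onb :: 'x set) + k) W f" "covector_lift_on (U \<inter> V) \<phi> \<psi> W \<nu>"
proof -
  \<comment> \<open>The rank of the sum: the size of \<open>onb\<close> is the dimension of X, and k
    is the rank of the contracted conormals.\<close>
  define r where "r = card (onb :: 'x set) + k"
  define A where "A = (\<lambda>x. differential M model_manifold \<psi> x)"
  let ?\<Omega> = "\<phi> ` (U \<inter> V)"
  let ?T = "\<lambda>y. frechet_derivative (\<lambda>y. \<psi> (inv_into U \<phi> y)) (at y)"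
  let ?P = "chart_bivector U \<phi> \<psi>"
  have \<Omega>: "open ?\<Omega>" "\<phi> p \<in> ?\<Omega>"
    using is_chart_open_image[OF smooth_manifold_is_chart[OF smooth_X U(1)] openin_chart_Int[OF U(1) V(1)]]
      U(2) V(2) by (simp_all add: Int_assoc[symmetric])
  have pts: "x \<in> points X" if "x \<in> U" for x
    using that chart_X_subset[OF U(1)] by blast
  have T_eq: "?T (\<phi> x) = blinfun_apply (A x o\<^sub>L
      (differential X M id x o\<^sub>L differential model_manifold X (inv_into U \<phi>) (\<phi> x)))" if "x \<in> U \<inter> V" for x
    using inclusion_derivative[OF U(1) _ V(1)] that by (simp add: A_def)
  have inj_A: "inj (blinfun_apply (A x))" if "x \<in> V" for x
    using id_blinfun_composeD[OF differential_chart_inverse(1)[OF smooth_M V(1) that]]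
    unfolding A_def by (rule inj_on_inverseI)
  have lin_A: "linear (blinfun_apply (A x))" for x
    by (intro bounded_linear.linear blinfun.bounded_linear_right)
  note chart = sharp_conormal_chart[OF U(1) _ V(1), folded A_def]
  have smT: "smooth_on ?\<Omega> (\<lambda>y. ?T y v)" for v
    by (rule smooth_on_frechet_derivative[OF smooth_inclusion_chart[OF U(1) V(1)]])
  have linT: "linear (?T y)" and injT: "inj (?T y)" if y: "y \<in> ?\<Omega>" for y
  proof -
    obtain x where x: "x \<in> U" "x \<in> V" "y = \<phi> x"
      using y by auto
    show "linear (?T y)"
      unfolding x(3) T_eq[OF IntI[OF x(1,2)]] by (intro bounded_linear.linear blinfun.bounded_linear_right)
    have "inj (blinfun_apply (differential model_manifold X (inv_into U \<phi>) (\<phi> x)))"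
      using id_blinfun_composeD[OF differential_chart_inverse(2)[OF smooth_X U(1) x(1)]]
      by (rule inj_on_inverseI)
    then show "inj (?T y)"
      using inj_A[OF x(2)] inj_differential_inclusion[OF pts[OF x(1)]]
      unfolding x(3) T_eq[OF IntI[OF x(1,2)]] by (simp add: inj_def)
  qed
  have biv: "is_bivector (?P y)" if "y \<in> ?\<Omega>" for y
    using is_bivector_chart_bivector[OF U(1)] that by blast
  have F0: "sharp (?P (\<phi> p)) ` annihilator (range (?T (\<phi> p))) \<inter> range (?T (\<phi> p)) = {0}"
    unfolding chart(2)[OF U(2) V(2)] unfolding chart(1)[OF U(2) V(2)]
    using transversal[OF pts[OF U(2)]] image_Int[OF inj_A[OF V(2)], symmetric] linear_0[OF lin_A]
    by simp
  have F_dim: "dim (sharp (?P y) ` annihilator (range (?T y))) = k" if y: "y \<in> ?\<Omega>" for y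
  proof -
    obtain x where x: "x \<in> U" "x \<in> V" "y = \<phi> x"
      using y by auto
    show ?thesis
      unfolding x(3) chart(2)[OF x(1,2)]
      using rank[OF pts[OF x(1)]] dim_inj_linear_image[OF lin_A inj_A[OF x(2)]]
        subspace_sharp_conormal[of x] points_X_subset pts[OF x(1)] by auto
  qed
  obtain W f and \<nu> :: "('x \<Rightarrow>\<^sub>L real) \<Rightarrow> 'x \<Rightarrow> 'm \<Rightarrow>\<^sub>L real" where W: "open W" "\<phi> p \<in> W" "W \<subseteq> ?\<Omega>"
    and f: "\<And>j. j < r \<Longrightarrow> smooth_on W (f j)"
      "\<And>y. y \<in> W \<Longrightarrow> inj_on (\<lambda>j. f j y) {..<r}"
      "\<And>y. y \<in> W \<Longrightarrow> independent ((\<lambda>j. f j y) ` {..<r})"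
      "\<And>y. y \<in> W \<Longrightarrow> span ((\<lambda>j. f j y) ` {..<r}) =
        {u + v | u v. u \<in> range (?T y) \<and> v \<in> sharp (?P y) ` annihilator (range (?T y))}"
    and \<nu>: "\<And>a. smooth_on W (\<nu> a)"
      "\<And>a y v. y \<in> W \<Longrightarrow> blinfun_apply (\<nu> a y) (?T y v) = blinfun_apply a v"
      "\<And>a y v. y \<in> W \<Longrightarrow> v \<in> sharp (?P y) ` annihilator (range (?T y)) \<Longrightarrow> blinfun_apply (\<nu> a y) v = 0"
    using local_frame[of ?\<Omega> "\<phi> p" ?T ?P k, OF \<Omega> smT linT injT biv smooth_chart_bivector[OF U(1) V(1)] F0 F_dim]
    unfolding r_def by blast
  have "span ((\<lambda>j. f j (\<phi> x)) ` {..<r}) =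
      blinfun_apply (A x) ` {u + v | u v. u \<in> tangent_subspace X M x \<and> v \<in> sharp_conormal x}"
    and kills: "\<And>a v. v \<in> sharp_conormal x \<Longrightarrow> blinfun_apply (\<nu> a (\<phi> x) o\<^sub>L A x) v = 0"
    and lifts: "\<And>a. (\<nu> a (\<phi> x) o\<^sub>L A x) o\<^sub>L differential X M id x = a o\<^sub>L differential X model_manifold \<phi> x"
    if x: "x \<in> U \<inter> V" "\<phi> x \<in> W" for x
  proof -
    have xU: "x \<in> U" "x \<in> V"
      using x by auto
    show "span ((\<lambda>j. f j (\<phi> x)) ` {..<r}) =
        blinfun_apply (A x) ` {u + v | u v. u \<in> tangent_subspace X M x \<and> v \<in> sharp_conormal x}"
      unfolding f(4)[OF x(2)] chart(2)[OF xU] unfolding chart(1)[OF xU] linear_image_set_sum[OF lin_A] ..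
    show "blinfun_apply (\<nu> a (\<phi> x) o\<^sub>L A x) v = 0" if "v \<in> sharp_conormal x" for a v
      using \<nu>(3)[OF x(2), unfolded chart(2)[OF xU]] that by simp
    show "(\<nu> a (\<phi> x) o\<^sub>L A x) o\<^sub>L differential X M id x = a o\<^sub>L differential X model_manifold \<phi> x" for a
    proof (rule blinfun_eqI)
      fix v
      \<comment> \<open>The lifting property is used at the \<phi>-coordinates of v, so that the
        inverse-chart factor in the derivative of the inclusion cancels.\<close>
      have "blinfun_apply a (blinfun_apply (differential X model_manifold \<phi> x) v) =
          blinfun_apply (\<nu> a (\<phi> x)) (?T (\<phi> x) (blinfun_apply (differential X model_manifold \<phi> x) v))"
        using \<nu>(2)[OF x(2)] by simp
      then show "blinfun_apply ((\<nu> a (\<phi> x) o\<^sub>L A x) o\<^sub>L differential X M id x) v =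
          blinfun_apply (a o\<^sub>L differential X model_manifold \<phi> x) v"
        unfolding T_eq[OF x(1)]
        by (simp add: id_blinfun_composeD[OF differential_chart_inverse(1)[OF smooth_X U(1) xU(1)]])
    qed
  qed
  note span = this(1)
  have "adapted_frame_on (U \<inter> V) \<phi> \<psi> r W f"
    unfolding adapted_frame_on_def
    by (intro conjI allI ballI impI f(1-3) span[unfolded A_def])
  moreover have "covector_lift_on (U \<inter> V) \<phi> \<psi> W \<nu>"
    unfolding covector_lift_on_def
    by (intro conjI allI ballI impI \<nu>(1) lifts[unfolded A_def] kills[unfolded A_def])
  ultimately show thesis
    using that W unfolding r_def by blast
qed

subsection \<open>The three conditions\<close>

lemma pullback_graph_iff:
  "(u, a) \<in> pullback_graph X M \<pi>M x \<longleftrightarrow>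
    (\<exists>\<xi>. a = \<xi> o\<^sub>L differential X M id x \<and> blinfun_apply (differential X M id x) u = sharp (\<pi>M x) \<xi>)"
  by (auto simp: pullback_graph_def bivector_graph_def)

lemma transversal_of_poisson_dirac:
  assumes "poisson_dirac_submanifold X M \<pi>M" "x \<in> points X"
  shows "sharp_conormal x \<inter> tangent_subspace X M x = {0}"
proof -
  let ?I = "differential X M id x"
  obtain \<pi>X where \<pi>X: "is_bivector (\<pi>X x)" "pullback_graph X M \<pi>M x = bivector_graph (\<pi>X x)"
    using assms unfolding poisson_dirac_submanifold_def smooth_bivector_field_def by blast
  have "v = 0" if v: "v \<in> sharp_conormal x" "v \<in> tangent_subspace X M x" for v
  proof -
    obtain \<xi> u where \<xi>: "\<xi> \<in> conormal_space X M x" and u: "v = sharp (\<pi>M x) \<xi>" "v = blinfun_apply ?I u"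
      using v by (auto simp: sharp_conormal_def tangent_subspace_def)
    have "\<xi> o\<^sub>L ?I = 0"
      using \<xi> by (auto simp: conormal_space_def tangent_subspace_def intro!: blinfun_eqI)
    then have "(u, 0) \<in> bivector_graph (\<pi>X x)"
      using u pullback_graph_iff \<pi>X(2) by metis
    then have "u = 0"
      using linear_0[OF linear_sharp[OF \<pi>X(1)]] by (simp add: bivector_graph_def)
    then show ?thesis
      using u(2) by simp
  qed
  moreover have "0 \<in> sharp_conormal x" "0 \<in> tangent_subspace X M x"
    using subspace_0[OF subspace_sharp_conormal] subspace_0[OF subspace_tangent] assms(2) points_X_subset
    by blast+
  ultimately show ?thesis
    by blast
qed

section \<open>Consequences of transversality at a single point x1\<close>

context
  fixes x1
  assumes x1: "x1 \<in> points X" and transversal_x1: "sharp_conormal x1 \<inter> tangent_subspace X M x1 = {0}"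
begin

lemma transversal: "x \<in> points X \<Longrightarrow> sharp_conormal x \<inter> tangent_subspace X M x = {0}"
  and rank: "x \<in> points X \<Longrightarrow> dim (sharp_conormal x) = dim (sharp_conormal x1)"
proof -
  assume x: "x \<in> points X"
  obtain C where C: "linear C" "inj C" "C ` tangent_subspace X M x1 = tangent_subspace X M x"
      "C ` sharp_conormal x1 = sharp_conormal x"
    using orbit_translation[OF x1 x] .
  show "sharp_conormal x \<inter> tangent_subspace X M x = {0}"
    unfolding C(3,4)[symmetric] image_Int[OF C(2), symmetric] transversal_x1
    using linear_0[OF C(1)] by simp
  show "dim (sharp_conormal x) = dim (sharp_conormal x1)"
    unfolding C(4)[symmetric] using x1 points_X_subset
    by (intro dim_inj_linear_image[OF C(1,2)] subspace_sharp_conormal) blast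
qed

lemma coregular: "coregular_poisson_dirac_submanifold X M \<pi>M"
proof -
  let ?r = "card (onb :: 'x set) + dim (sharp_conormal x1)"
  let ?E = "\<lambda>x. {u + v | u v. u \<in> tangent_subspace X M x \<and> v \<in> sharp_conormal x}"
  have "\<exists>W s. openin (mtop X) W \<and> p \<in> W \<and> (\<forall>j<?r. smooth_section_along X M W (s j)) \<and>
      (\<forall>y\<in>W. inj_on (\<lambda>j. s j y) {..<?r} \<and> independent ((\<lambda>j. s j y) ` {..<?r}) \<and>
              span ((\<lambda>j. s j y) ` {..<?r}) = ?E y)" if p: "p \<in> points X" for p
  proof -
    obtain U \<phi> where U: "(U, \<phi>) \<in> atlas X" "p \<in> U"
      using charted_X[OF p] unfolding charted_at_def by (metis prod.collapse)
    obtain V \<psi> where V: "(V, \<psi>) \<in> atlas M" "p \<in> V"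
      using charted_M[of p] p points_X_subset unfolding charted_at_def by (metis prod.collapse subsetD)
    let ?A = "\<lambda>x. differential M model_manifold \<psi> x"
    let ?A' = "\<lambda>x. differential model_manifold M (inv_into V \<psi>) (\<psi> x)"
    obtain W f where W: "open W" "\<phi> p \<in> W" "W \<subseteq> \<phi> ` (U \<inter> V)"
      and frame: "adapted_frame_on (U \<inter> V) \<phi> \<psi> ?r W f"
      by (rule ex_adapted_frame[OF transversal rank U V])
    have f: "smooth_on W (f j)" if "j < ?r" for j
      using frame that unfolding adapted_frame_on_def by blast
    have f_fibre: "inj_on (\<lambda>j. f j (\<phi> x)) {..<?r}" "independent ((\<lambda>j. f j (\<phi> x)) ` {..<?r})"
      "span ((\<lambda>j. f j (\<phi> x)) ` {..<?r}) = blinfun_apply (?A x) ` ?E x"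
      if "x \<in> U \<inter> V" "\<phi> x \<in> W" for x
      using frame that unfolding adapted_frame_on_def by simp_all
    define N where "N = (U \<inter> V) \<inter> (U \<inter> \<phi> -` W)"
    have N: "openin (mtop X) N" "p \<in> N"
      using openin_chart_Int[OF U(1) V(1)] U V W
        is_chart_openin_vimage[OF smooth_manifold_is_chart[OF smooth_X U(1)] W(1)]
      by (auto simp: N_def)
    have N_sub: "x \<in> U \<inter> V" "\<phi> x \<in> W" if "x \<in> N" for x
      using that by (auto simp: N_def)
    \<comment> \<open>The frame lives in \<psi>-coordinates; the inverse bundle chart brings it back
      to the tangent spaces in their preferred identification.\<close>
    define s where "s j x = blinfun_apply (?A' x) (f j (\<phi> x))" for j x
    have "smooth_section_along X M N (s j)" if j: "j < ?r" for j
      unfolding smooth_section_along_def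
    proof clarify
      fix U1 \<phi>1 V1 \<psi>1 assume U1: "(U1, \<phi>1) \<in> atlas X" and V1: "(V1, \<psi>1) \<in> atlas M"
      let ?S = "\<phi>1 ` (N \<inter> U1 \<inter> V1)"
      let ?x = "\<lambda>y. inv_into U1 \<phi>1 y"
      have "?S = \<phi>1 ` (U1 \<inter> (N \<inter> (U1 \<inter> V1)))"
        by (rule arg_cong[of _ _ "image \<phi>1"]) blast
      moreover have "openin (mtop X) (N \<inter> (U1 \<inter> V1))"
        using N(1) openin_chart_Int[OF U1 V1] by blast
      ultimately have S: "open ?S"
        using is_chart_open_image[OF smooth_manifold_is_chart[OF smooth_X U1]] by metis
      have x_S: "?x y \<in> N" "?x y \<in> U1" "?x y \<in> V1" if "y \<in> ?S" for y
        using that inv_into_chart_X[OF U1] by auto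
      have "smooth_on ?S (\<lambda>y. \<phi> (?x y))"
        by (rule smooth_on_subset[OF smooth_manifold_transition[OF smooth_X U1 U(1)]])
           (use N_sub in blast)
      then have w: "smooth_on ?S (\<lambda>y. f j (\<phi> (?x y)))"
        by (intro smooth_on_compose[OF S _ f[OF j]]) (use x_S N_sub in blast)
      have g: "smooth_on ?S (\<lambda>y. \<psi> (?x y))"
        by (rule smooth_on_subset[OF smooth_inclusion_chart[OF U1 V(1)]]) (use N_sub in blast)
      \<comment> \<open>Smoothness of a section is tested in every pair of charts. In \<psi>1 the
        components of s are those of f transformed by the derivative of the transition from \<psi>
        to \<psi>1, and the preferred chart drops out.\<close>
      have "smooth_on ?S (\<lambda>y. frechet_derivative (\<lambda>z. \<psi>1 (inv_into V \<psi> z)) (at (\<psi> (?x y))) (f j (\<phi> (?x y))))"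
        by (rule smooth_on_frechet_derivative_compose[OF S _ smooth_manifold_transition[OF smooth_M V(1) V1] g w])
           (use x_S N_sub in blast)
      then show "smooth_on ?S (\<lambda>y. let x = ?x y in blinfun_apply (differential M model_manifold \<psi>1 x) (s j x))"
      proof (rule smooth_on_cong[OF S])
        fix y assume "y \<in> ?S"
        note x = x_S[OF this]
        have xV: "?x y \<in> V"
          using N_sub x(1) by blast
        note inv = inv_into_chart_M[OF V(1) xV]
        have "mdiff_at M model_manifold \<psi>1 (inv_into V \<psi> (\<psi> (?x y)))"
          unfolding inv by (rule mdiff_at_chart[OF smooth_M V1 x(3)])
        note comp = mdiff_at_comp[OF mdiff_at_inv_chart[OF smooth_M V(1) xV] this]
        have "frechet_derivative (\<lambda>z. \<psi>1 (inv_into V \<psi> z)) (at (\<psi> (?x y))) =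
            blinfun_apply (differential M model_manifold \<psi>1 (?x y) o\<^sub>L ?A' (?x y))"
          using frechet_derivative_at[OF mdiff_at_model_has_derivative[OF comp(1)]]
          unfolding comp(2) inv by simp
        then show "frechet_derivative (\<lambda>z. \<psi>1 (inv_into V \<psi> z)) (at (\<psi> (?x y))) (f j (\<phi> (?x y))) =
            (let x = ?x y in blinfun_apply (differential M model_manifold \<psi>1 x) (s j x))"
          by (simp add: s_def Let_def)
      qed
    qed
    moreover have "inj_on (\<lambda>j. s j x) {..<?r} \<and> independent ((\<lambda>j. s j x) ` {..<?r}) \<and>
        span ((\<lambda>j. s j x) ` {..<?r}) = ?E x" if x: "x \<in> N" for x
    proof -
      have xV: "x \<in> V"
        using N_sub(1)[OF x] by blast
      note inv = differential_chart_inverse[OF smooth_M V(1) xV]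
      have lin: "linear (blinfun_apply (?A' x))"
        by (intro bounded_linear.linear blinfun.bounded_linear_right)
      have inj: "inj (blinfun_apply (?A' x))"
        using id_blinfun_composeD[OF inv(2)] by (rule inj_on_inverseI)
      have image: "(\<lambda>j. s j x) ` {..<?r} = blinfun_apply (?A' x) ` (\<lambda>j. f j (\<phi> x)) ` {..<?r}"
        by (simp add: s_def image_image)
      have "inj_on (\<lambda>j. s j x) {..<?r}"
        using f_fibre(1)[OF N_sub[OF x]] inj by (auto simp: s_def inj_on_def)
      moreover have "independent ((\<lambda>j. s j x) ` {..<?r})"
        unfolding image using f_fibre(2)[OF N_sub[OF x]] inj
        by (intro linear_independent_injective_image[OF lin]) (auto intro: inj_on_subset)
      moreover have "span ((\<lambda>j. s j x) ` {..<?r}) = ?E x"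
        unfolding image linear_span_image[OF lin] f_fibre(3)[OF N_sub[OF x]]
        by (simp add: image_image id_blinfun_composeD[OF inv(1)])
      ultimately show ?thesis
        by blast
    qed
    ultimately show ?thesis
      using N by (intro exI[of _ N] exI[of _ s]) simp
  qed
  then have "vector_subbundle_along X M ?E"
    unfolding vector_subbundle_along_def by blast
  then show ?thesis
    unfolding coregular_poisson_dirac_submanifold_def
    using transversal unfolding sharp_conormal_def by blast
qed

text \<open>Skew-symmetry makes the contraction of such a covector tangent to the orbit, and a
  tangent contraction is exactly a point of the pulled-back graph.\<close>

lemma pullback_graph_lift:
  assumes x: "x \<in> points X" and \<xi>: "\<And>v. v \<in> sharp_conormal x \<Longrightarrow> blinfun_apply \<xi> v = 0"
  shows "\<exists>u. blinfun_apply (differential X M id x) u = sharp (\<pi>M x) \<xi> \<and>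
    (u, \<xi> o\<^sub>L differential X M id x) \<in> pullback_graph X M \<pi>M x"
proof -
  have "sharp (\<pi>M x) \<xi> \<in> tangent_subspace X M x"
    using bivector_M x points_X_subset \<xi>
    by (intro sharp_mem_if_kills_sharp_annihilator subspace_tangent)
       (auto simp: sharp_conormal_def conormal_space_eq_annihilator)
  then show ?thesis
    unfolding pullback_graph_iff tangent_subspace_def by (metis imageE)
qed

text \<open>Transversality allows every covector of X to be extended by 0 on the contracted
  conormals; the value at x of a local lift is such an extension.\<close>

lemma pullback_graph_ex:
  assumes x: "x \<in> points X"
  shows "\<exists>u. (u, a) \<in> pullback_graph X M \<pi>M x"
proof -
  obtain U \<phi> where U: "(U, \<phi>) \<in> atlas X" "x \<in> U"
    using charted_X[OF x] unfolding charted_at_def by (metis prod.collapse)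
  obtain V \<psi> where V: "(V, \<psi>) \<in> atlas M" "x \<in> V"
    using charted_M[of x] x points_X_subset unfolding charted_at_def by (metis prod.collapse subsetD)
  let ?A = "differential M model_manifold \<psi> x"
  let ?B = "differential X model_manifold \<phi> x"
  obtain W \<nu> where W: "\<phi> x \<in> W" and lift: "covector_lift_on (U \<inter> V) \<phi> \<psi> W \<nu>"
    by (rule ex_adapted_frame[OF transversal rank U V])
  \<comment> \<open>Lifts are indexed by covectors in \<phi>-coordinates, so a is first rewritten in
    them.\<close>
  let ?b = "a o\<^sub>L differential model_manifold X (inv_into U \<phi>) (\<phi> x)"
  have "x \<in> U \<inter> V"
    using U V by blast
  then have \<nu>: "(\<nu> ?b (\<phi> x) o\<^sub>L ?A) o\<^sub>L differential X M id x = ?b o\<^sub>L ?B"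
    "\<And>v. v \<in> sharp_conormal x \<Longrightarrow> blinfun_apply (\<nu> ?b (\<phi> x) o\<^sub>L ?A) v = 0"
    using lift W unfolding covector_lift_on_def by blast+
  have "a = ?b o\<^sub>L ?B"
    by (rule blinfun_eqI) (simp add: id_blinfun_composeD[OF differential_chart_inverse(1)[OF smooth_X U]])
  then show ?thesis
    using pullback_graph_lift[OF x \<nu>(2)] unfolding \<nu>(1) by auto
qed

text \<open>Two extensions of the same covector differ by a conormal one, whose contraction would be
  tangent as well; transversality makes it 0, and the inclusion is an immersion.\<close>

lemma pullback_graph_unique:
  assumes x: "x \<in> points X" and "(u, a) \<in> pullback_graph X M \<pi>M x" "(w, a) \<in> pullback_graph X M \<pi>M x"
  shows "u = w"
proof -
  let ?I = "differential X M id x"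
  obtain \<xi> \<eta> where \<xi>: "a = \<xi> o\<^sub>L ?I" "blinfun_apply ?I u = sharp (\<pi>M x) \<xi>"
    and \<eta>: "a = \<eta> o\<^sub>L ?I" "blinfun_apply ?I w = sharp (\<pi>M x) \<eta>"
    using assms pullback_graph_iff by metis
  have xM: "x \<in> points M"
    using x points_X_subset by blast
  have "blinfun_apply (\<xi> - \<eta>) (blinfun_apply ?I z) = 0" for z
    using arg_cong[OF \<xi>(1)[unfolded \<eta>(1)], of "\<lambda>f. blinfun_apply f z"] by (simp add: blinfun.diff_left)
  then have "\<xi> - \<eta> \<in> conormal_space X M x"
    by (auto simp: conormal_space_def tangent_subspace_def)
  then have "sharp (\<pi>M x) (\<xi> - \<eta>) \<in> sharp_conormal x"
    by (simp add: sharp_conormal_def)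
  moreover have "sharp (\<pi>M x) (\<xi> - \<eta>) = blinfun_apply ?I (u - w)"
    using linear_diff[OF linear_sharp[OF bivector_M[OF xM]]] \<xi>(2) \<eta>(2) by (simp add: blinfun.diff_right)
  ultimately have "blinfun_apply ?I (u - w) \<in> sharp_conormal x \<inter> tangent_subspace X M x"
    by (auto simp: tangent_subspace_def)
  then have "blinfun_apply ?I (u - w) = blinfun_apply ?I 0"
    unfolding transversal[OF x] by simp
  then show "u = w"
    using inj_differential_inclusion[OF x] by (metis eq_iff_diff_eq_0 injD)
qed

section \<open>The bivector induced on the orbit\<close>

definition pullback_vector :: "'a \<Rightarrow> ('x \<Rightarrow>\<^sub>L real) \<Rightarrow> 'x"
  where "pullback_vector x a = (THE u. (u, a) \<in> pullback_graph X M \<pi>M x)"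

definition pullback_bivector :: "'a \<Rightarrow> 'x bivector"
  where "pullback_bivector x a b = blinfun_apply b (pullback_vector x a)"

lemma pullback_graph_iff_vector:
  assumes "x \<in> points X"
  shows "(u, a) \<in> pullback_graph X M \<pi>M x \<longleftrightarrow> u = pullback_vector x a"
proof -
  obtain w where w: "(w, a) \<in> pullback_graph X M \<pi>M x"
    using pullback_graph_ex[OF assms] by blast
  then have "pullback_vector x a = w"
    unfolding pullback_vector_def using pullback_graph_unique[OF assms] by blast
  then show ?thesis
    using w pullback_graph_unique[OF assms] by blast
qed

text \<open>Once the contraction of \<xi> is tangent to the orbit, \<eta> pairs with it only through
  its restriction to the orbit, so an arbitrary extension \<eta> of the second covector may be
  used.\<close>

lemma pullback_bivector_eq:
  assumes x: "x \<in> points X"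
    and "blinfun_apply (differential X M id x) u = sharp (\<pi>M x) \<xi>"
  shows "pullback_bivector x (\<xi> o\<^sub>L differential X M id x) (\<eta> o\<^sub>L differential X M id x) = \<pi>M x \<xi> \<eta>"
proof -
  have "(u, \<xi> o\<^sub>L differential X M id x) \<in> pullback_graph X M \<pi>M x"
    using assms pullback_graph_iff by blast
  then have "pullback_vector x (\<xi> o\<^sub>L differential X M id x) = u"
    using pullback_graph_iff_vector[OF x] by simp
  then show ?thesis
    using assms(2) sharp[OF bivector_M, of x] x points_X_subset by (auto simp: pullback_bivector_def)
qed

text \<open>Linearity in the second argument is evaluation at a vector. Skew-symmetry is inherited
  from \<open>\<pi>M\<close> by choosing extensions of both covectors with tangent contraction, and
  linearity in the first argument then follows from the other two.\<close>

lemma is_bivector_pullback_bivector: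
  assumes x: "x \<in> points X"
  shows "is_bivector (pullback_bivector x)"
proof -
  let ?I = "differential X M id x"
  have xM: "x \<in> points M"
    using x points_X_subset by blast
  have skew: "pullback_bivector x a b = - pullback_bivector x b a" for a b
  proof -
    obtain \<xi> \<eta> where \<xi>: "a = \<xi> o\<^sub>L ?I" "blinfun_apply ?I (pullback_vector x a) = sharp (\<pi>M x) \<xi>"
      and \<eta>: "b = \<eta> o\<^sub>L ?I" "blinfun_apply ?I (pullback_vector x b) = sharp (\<pi>M x) \<eta>"
      using pullback_graph_iff_vector[OF x] pullback_graph_iff by metis
    show ?thesis
      unfolding \<xi>(1) \<eta>(1) pullback_bivector_eq[OF x \<xi>(2)] pullback_bivector_eq[OF x \<eta>(2)]
      by (rule is_bivector_skew[OF bivector_M[OF xM]])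
  qed
  have lin: "linear (pullback_bivector x a)" for a
    unfolding pullback_bivector_def
    by (intro bounded_linear.linear blinfun.bounded_linear_left)
  have "linear (\<lambda>a. - pullback_bivector x b a)" for b
    using linear_compose_neg[OF lin] .
  then have "linear (\<lambda>a. pullback_bivector x a b)" for b
    unfolding skew[of _ b] .
  then show ?thesis
    unfolding is_bivector_def bilinear_def using lin skew by blast
qed

lemma pullback_graph_eq:
  assumes "x \<in> points X"
  shows "pullback_graph X M \<pi>M x = bivector_graph (pullback_bivector x)"
proof -
  have "sharp (pullback_bivector x) a = pullback_vector x a" for a
    by (rule covectors_separate)
       (simp add: sharp[OF is_bivector_pullback_bivector[OF assms]] pullback_bivector_def)
  then show ?thesis
    using pullback_graph_iff_vector[OF assms] by (auto simp: bivector_graph_def)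
qed

lemma smooth_pullback_bivector: "smooth_bivector_field X pullback_bivector"
  unfolding smooth_bivector_field_def
proof (intro conjI ballI)
  show "is_bivector (pullback_bivector x)" if "x \<in> points X" for x
    using is_bivector_pullback_bivector[OF that] .
  show "case c of (U, \<phi>) \<Rightarrow> \<forall>a b. smooth_on (\<phi> ` U)
      (\<lambda>y. let x = inv_into U \<phi> y; D = differential X model_manifold \<phi> x
           in pullback_bivector x (a o\<^sub>L D) (b o\<^sub>L D))" if c: "c \<in> atlas X" for c
  proof (clarify, rule smooth_on_local)
    fix U \<phi> a b y assume "c = (U, \<phi>)" "y \<in> \<phi> ` U"
    then obtain p where U: "(U, \<phi>) \<in> atlas X" "p \<in> U" and y: "y = \<phi> p"
      using c by blast
    then have p: "p \<in> points X"
      using chart_X_subset by blast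
    obtain V \<psi> where V: "(V, \<psi>) \<in> atlas M" "p \<in> V"
      using charted_M[of p] p points_X_subset unfolding charted_at_def by (metis prod.collapse subsetD)
    obtain W \<nu> where W: "open W" "\<phi> p \<in> W" "W \<subseteq> \<phi> ` (U \<inter> V)"
      and lift: "covector_lift_on (U \<inter> V) \<phi> \<psi> W \<nu>"
      by (rule ex_adapted_frame[OF transversal rank U V])
    have \<nu>_smooth: "smooth_on W (\<nu> c)" for c
      using lift unfolding covector_lift_on_def by blast
    have \<nu>: "(\<nu> c (\<phi> x) o\<^sub>L differential M model_manifold \<psi> x) o\<^sub>L differential X M id x =
        c o\<^sub>L differential X model_manifold \<phi> x"
      "\<And>v. v \<in> sharp_conormal x \<Longrightarrow>
        blinfun_apply (\<nu> c (\<phi> x) o\<^sub>L differential M model_manifold \<psi> x) v = 0"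
      if "x \<in> U \<inter> V" "\<phi> x \<in> W" for c x
      using lift that unfolding covector_lift_on_def by blast+
    have biv: "is_bivector (chart_bivector U \<phi> \<psi> z)" if "z \<in> W" for z
      using is_bivector_chart_bivector[OF U(1)] W(3) that by blast
    \<comment> \<open>The components of the induced bivector in the chart \<phi> are the values of
      \<open>\<pi>M\<close> on lifts of constant covectors, and these lifts depend smoothly on the
      point.\<close>
    have "smooth_on W (\<lambda>z. chart_bivector U \<phi> \<psi> z (\<nu> a z) (\<nu> b z))"
      by (rule smooth_on_bivector[OF W(1) biv
            smooth_on_subset[OF smooth_chart_bivector[OF U(1) V(1)] W(3)] \<nu>_smooth \<nu>_smooth])
    then have "smooth_on W (\<lambda>y. let x = inv_into U \<phi> y; D = differential X model_manifold \<phi> x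
        in pullback_bivector x (a o\<^sub>L D) (b o\<^sub>L D))"
    proof (rule smooth_on_cong[OF W(1)])
      fix z assume z: "z \<in> W"
      then obtain x where x: "x \<in> U \<inter> V" "z = \<phi> x"
        using W(3) by blast
      then have xW: "\<phi> x \<in> W" and inv: "inv_into U \<phi> z = x"
        using z inv_into_chart_X[OF U(1)] by auto
      have xX: "x \<in> points X"
        using x(1) chart_X_subset[OF U(1)] by blast
      obtain u where "blinfun_apply (differential X M id x) u =
          sharp (\<pi>M x) (\<nu> a (\<phi> x) o\<^sub>L differential M model_manifold \<psi> x)"
        using pullback_graph_lift[OF xX \<nu>(2)[OF x(1) xW]] by blast
      from pullback_bivector_eq[OF xX this, of "\<nu> b (\<phi> x) o\<^sub>L differential M model_manifold \<psi> x"]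
      show "chart_bivector U \<phi> \<psi> z (\<nu> a z) (\<nu> b z) =
          (let x = inv_into U \<phi> z; D = differential X model_manifold \<phi> x
           in pullback_bivector x (a o\<^sub>L D) (b o\<^sub>L D))"
        unfolding \<nu>(1)[OF x(1) xW] by (simp add: chart_bivector_def inv x(2)[symmetric])
    qed
    then show "\<exists>T. open T \<and> y \<in> T \<and> smooth_on T (\<lambda>y. let x = inv_into U \<phi> y;
        D = differential X model_manifold \<phi> x in pullback_bivector x (a o\<^sub>L D) (b o\<^sub>L D))"
      using W(1,2) y by blast
  qed
qed

lemma poisson_dirac: "poisson_dirac_submanifold X M \<pi>M"
  unfolding poisson_dirac_submanifold_def
  using smooth_pullback_bivector pullback_graph_eq by blast

end

section \<open>Assembling the equivalence\<close>

lemma points_X_nonempty: "\<exists>x. x \<in> points X"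
proof -
  obtain x0 where "x0 \<in> points M" "points X = orbit G \<alpha> x0"
    by (rule ex_base_point)
  then show ?thesis
    using orbit_refl by blast
qed

lemma poisson_dirac_equivalences:
  "(coregular_poisson_dirac_submanifold X M \<pi>M \<longleftrightarrow> poisson_dirac_submanifold X M \<pi>M) \<and>
   (poisson_dirac_submanifold X M \<pi>M \<longleftrightarrow>
      (\<exists>x\<in>points X. sharp (\<pi>M x) ` conormal_space X M x \<inter> tangent_subspace X M x = {0}))"
proof -
  \<comment> \<open>Condition (iii) asserts that a point exists, so deriving it from (i) or (ii)
    uses that an orbit is nonempty.\<close>
  obtain x where x: "x \<in> points X"
    using points_X_nonempty by blast
  define P where "P x \<longleftrightarrow> sharp_conormal x \<inter> tangent_subspace X M x = {0}" for x
  have "P x" if "coregular_poisson_dirac_submanifold X M \<pi>M"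
    using that x unfolding P_def coregular_poisson_dirac_submanifold_def sharp_conormal_def by blast
  moreover have "P x" if "poisson_dirac_submanifold X M \<pi>M"
    unfolding P_def using that x by (rule transversal_of_poisson_dirac)
  moreover have "coregular_poisson_dirac_submanifold X M \<pi>M" "poisson_dirac_submanifold X M \<pi>M"
    if "y \<in> points X" "P y" for y
    using coregular[OF that(1)] poisson_dirac[OF that(1)] that(2) unfolding P_def by blast+
  ultimately show ?thesis
    using x unfolding sharp_conormal_def[symmetric] P_def[symmetric] by blast
qed

end

theorem lemma4p2:
  fixes G :: "('g, 'z) monoid_scheme"
    and L :: "('g, 'k::fin_dim_inner) manifold"
    and \<pi>G :: "'g \<Rightarrow> 'k bivector"
    and M :: "('a, 'm::fin_dim_inner) manifold"
    and \<pi>M :: "'a \<Rightarrow> 'm bivector"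
    and \<alpha> :: "'g \<Rightarrow> 'a \<Rightarrow> 'a"
    and X :: "('a, 'x::fin_dim_inner) manifold"
  assumes "poisson_lie_group G L \<pi>G"
    and "poisson_manifold M \<pi>M"
    and "poisson_action G L \<pi>G M \<pi>M \<alpha>"
    and "orbit_manifold G L \<alpha> M X"
  shows "(coregular_poisson_dirac_submanifold X M \<pi>M \<longleftrightarrow> poisson_dirac_submanifold X M \<pi>M) \<and>
         (poisson_dirac_submanifold X M \<pi>M \<longleftrightarrow>
            (\<exists>x\<in>points X. sharp (\<pi>M x) ` conormal_space X M x \<inter> tangent_subspace X M x = {0}))"
  by (rule poisson_orbit.poisson_dirac_equivalences[OF poisson_orbit.intro[OF assms]])

end
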